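(* Let $d=3$ and let $\tau>0$ be a fixed time step. For every $m\ge0$ let $(\boldsymbol u_h^{m+1},\tilde p_h^{m+1},\kappa_{s,h}^{m+1},\tilde H_h^{m+1},\widetilde{\boldsymbol w}_h^{m+1},\varphi_{c,h}^{m+1},\psi_{c,h}^{m+1})$ be the solution of the scheme (3D-a)--(3D-c) written out in the context, with domains $\Omega_h^m$ updated as described there. Let $$E_h^m:=\frac12\|\boldsymbol u_h^m\|_{L^2(\Omega_h^{m-1})}^2+\frac1{We}|\Gamma_{F,h}^m|-\frac{\cos\theta_Y}{We}|\Gamma_{s,h}^m|+g\int_{\Omega_h^m}z\,\mathrm dx .$$ Assume that $\beta_s,\beta_c>0$, that $E_h^m$ is bounded from below (uniformly in $m$), and that $|\Gamma_{s,h}^m|>0$ for all $m$. Assume further that the family $\{\Omega_h^m\}_{m\ge0}$ admits a uniform Korn inequality: there is a constant $C_\Omega>0$ independent of $m$ such that for all $m\ge0$ $$\|\boldsymbol v\|_{L^2(\Omega_h^m)}^2\le C_\Omega\big(\|D(\boldsymbol v)\|_{L^2(\Omega_h^m)}^2+\|\boldsymbol v\|_{L^2(\Gamma_{s,h}^m)}^2\big)\qquad\forall\,\boldsymbol v\in H^1(\Omega_h^m)^d .$$ Then the discrete velocity asymptotically vanishes: $$\lim_{m\to\infty}\|\boldsymbol u_h^{m+1}\|_{L^2(\Omega_h^m)}=0 .$$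
   Context: **Parameters.** $d=3$; $Re,We>0$; $\beta_s,\beta_c\ge0$; $g$ is the dimensionless gravitational acceleration; $\theta_Y$ is Young's equilibrium contact angle; $\tau>0$ is the time step, $t_m=m\tau$. $\boldsymbol e_z$ is the vertical unit vector and $z=\boldsymbol x\cdot\boldsymbol e_z$. $D(\boldsymbol u)=\frac12(\nabla\boldsymbol u+(\nabla\boldsymbol u)^\top)$. $|\Gamma_{F,h}^m|$ and $|\Gamma_{s,h}^m|$ are surface areas. **Domains.** $\Omega_h^m\subset\mathbb R^3$ is a polyhedral domain with simplicial triangulation $\mathcal K_h^m$. Its boundary is $\Gamma_h^m=\Gamma_{F,h}^m\cup\Gamma_{s,h}^m$ (free surface and wetted solid boundary), with contact line $\Gamma_{c,h}^m=\Gamma_{F,h}^m\cap\Gamma_{s,h}^m$, a closed polygonal curve. The solid substrate is flat: $\Gamma_{s,h}^m$ lies in a fixed plane with constant unit normal $\boldsymbol n_s$ (outward to the fluid); $\mathbb P_s=\mathbb I-\boldsymbol n_s\otimes\boldsymbol n_s$. $\boldsymbol n_{F,h}^m$ is the elementwise constant unit outward normal on $\Gamma_{F,h}^m$. The mesh is updated by $\psi_h^{m+1}=\mathrm{id}+\tau\boldsymbol w_h^{m+1}$, $\Omega_h^{m+1}=\psi_h^{m+1}(\Omega_h^m)$, with $\mathcal K_h^{m+1}$, $\Gamma_{F,h}^{m+1}$, $\Gamma_{s,h}^{m+1}$, $\Gamma_{c,h}^{m+1}$ the images of the corresponding objects. The maps $\mathrm{id}+\vartheta\tau\boldsymbol w_h^{m+1}$,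 $\vartheta\in[0,1]$, are nondegenerate (injective, orientation preserving) and all triangulations are valid, shape-regular and quasi-uniform. Conventions: $\Omega_h^{-1}=\Omega_h^0$, $\psi_h^0=\mathrm{id}$, $\boldsymbol w_h^0=\mathbf 0$, and $\boldsymbol u_h^0$ is the interpolant of the initial velocity on $\Omega_h^0$. For $m\ge1$, $\boldsymbol u_h^m$ and $\boldsymbol w_h^m$ are defined on $\Omega_h^{m-1}$. **Spaces.** $\mathcal U_h^m$: continuous $\mathbb R^d$-valued piecewise quadratic functions on $\mathcal K_h^m$. $\mathcal Q_h^m$: continuous scalar piecewise linear functions. $\mathcal W_h^m$: continuous $\mathbb R^d$-valued piecewise linear functions. For a discrete boundary part $\Gamma$, $S_h(\Gamma)$ and $S_{h,2}(\Gamma)$ are the continuous scalar piecewise linear and piecewise quadratic functions on $\Gamma$; $S_h(\Gamma)^d$ is the vector version. **Pairings.** $(\cdot,\cdot)_\Omega$ and $\langle\cdot,\cdot\rangle_\Gamma$ are $L^2$ inner products over $\Omega$ and $\Gamma$. $\langle f,g\rangle_\Gamma^h$ is the mass-lumped product: on each $k$-simplex $\sigma$ of $\Gamma$, the contribution is $\frac{|\sigma|}{k+1}\sum_{P\text{ vertex of }\sigma}(f\cdot g)(P)$ with one-sided limits taken from $\sigma$. On $\Gamma_{s,h}^m$, $$\langle\lambda\boldsymbol n_s,\boldsymbol u\rangle_{\Gamma_{s,h}^m}^{s,h}=\sum_{\sigma}\frac{|\sigma|}{N_2}\sum_{P\in\mathcal N_2(\sigma)}\lambda(P)\,\boldsymbol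 n_s\cdot\boldsymbol u(P),$$ where $\sigma$ runs over the boundary triangles of $\Gamma_{s,h}^m$, $\mathcal N_2(\sigma)$ is the set of quadratic Lagrange nodes (vertices and edge midpoints) of $\sigma$, and $N_2=\dim\mathbb P_2(\sigma)$. The trilinear form is $b(\boldsymbol z;\boldsymbol u,\boldsymbol v)_\Omega=\frac12(\boldsymbol z\cdot\nabla\boldsymbol u,\boldsymbol v)_\Omega-\frac12(\boldsymbol z\cdot\nabla\boldsymbol v,\boldsymbol u)_\Omega$. $\nabla_\Gamma$ is the (elementwise) surface gradient. **Contact data.** With $s$ the arc length on $\Gamma_{c,h}^m$, oriented so that the result is outward, $\boldsymbol\mu_{s,h}^m=\partial_s(\mathrm{id}|_{\Gamma_{c,h}^m})\times\boldsymbol n_s$ is the unit outward conormal to $\Gamma_{s,h}^m$, and $$\boldsymbol\mu_{s,h}^{m+1/2}=\tfrac12\big[\partial_s(\mathrm{id}|_{\Gamma_{c,h}^m})+\partial_s(\mathrm{id}|_{\Gamma_{c,h}^m}+\tau\widetilde{\boldsymbol w}_h^{m+1}|_{\Gamma_{c,h}^m})\big]\times\boldsymbol n_s;$$ $\boldsymbol\xi_{c,h}^m$ is the tangential direction on $\Gamma_{c,h}^m$. Further, $\theta_{c,h}^m=\arccos(\Pi_{[-1,1]}(c_{c,h}^m))$, where $\Pi_{[-1,1]}(r)=\min\{1,\max\{-1,r\}\}$ and $c_{c,h}^m=\mathcal I_{h,0}(\cos\theta_Y-We\,\beta_c\,\widetilde{\boldsymbol w}_h^m\cdot\boldsymbol\mu_{s,h}^m)$.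 Here $\mathcal I_{h,0}$ is elementwise midpoint interpolation into piecewise constants on $\Gamma_{c,h}^m$, and $\widetilde{\boldsymbol w}_h^m$ is the previous free-boundary mesh velocity, transported to $\Gamma_{c,h}^m$ ($\widetilde{\boldsymbol w}_h^0=\mathbf 0$). Thus $\theta_{c,h}^m$ is known data, constant on each element of $\Gamma_{c,h}^m$. **Intermediate geometry.** For $\vartheta\in[0,1]$, on $\Gamma_{F,h}^m$: $\boldsymbol X(\vartheta)=\mathrm{id}+\tau\vartheta\widetilde{\boldsymbol w}_h^{m+1}$, $z_h^m(\vartheta)=\boldsymbol X(\vartheta)\cdot\boldsymbol e_z$, and $\hat{\boldsymbol n}(\vartheta)=\partial_{s_1}\boldsymbol X(\vartheta)\times\partial_{s_2}\boldsymbol X(\vartheta)$, where on each triangle $s_1,s_2$ are local surface parameters with $\hat{\boldsymbol n}(0)=\boldsymbol n_{F,h}^m$. Define $$\mathcal G(\widetilde{\boldsymbol w}_h^{m+1})=\int_0^1z_h^m(\vartheta)\hat{\boldsymbol n}(\vartheta)\,\mathrm d\vartheta=\tfrac16z_h^m(0)\hat{\boldsymbol n}(0)+\tfrac23z_h^m(\tfrac12)\hat{\boldsymbol n}(\tfrac12)+\tfrac16z_h^m(1)\hat{\boldsymbol n}(1),$$ $$\tilde{\boldsymbol n}_{F,h}^{m+1/2}=\int_0^1\hat{\boldsymbol n}(\vartheta)\,\mathrm d\vartheta=\tfrac16\hat{\boldsymbol n}(0)+\tfrac23\hat{\boldsymbol n}(\tfrac12)+\tfrac16\hat{\boldsymbol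 n}(1).$$ **3D scheme.** Given $\boldsymbol u_h^m,\boldsymbol w_h^m,\psi_h^m,\Omega_h^m$, find $(\boldsymbol u_h^{m+1},\tilde p_h^{m+1},\kappa_{s,h}^{m+1},\tilde H_h^{m+1},\widetilde{\boldsymbol w}_h^{m+1},\varphi_{c,h}^{m+1},\psi_{c,h}^{m+1})\in\mathcal U_h^m\times\mathcal Q_h^m\times S_{h,2}(\Gamma_{s,h}^m)\times S_h(\Gamma_{F,h}^m)\times S_h(\Gamma_{F,h}^m)^d\times S_h(\Gamma_{c,h}^m)\times S_h(\Gamma_{c,h}^m)$ such that for all $(\boldsymbol v,q,\lambda_s,\phi_F,\boldsymbol\eta,\phi_c,\chi_c)$ in the same product of spaces (order: $\mathcal U_h^m$, $\mathcal Q_h^m$, $S_{h,2}(\Gamma_{s,h}^m)$, $S_h(\Gamma_{F,h}^m)$, $S_h(\Gamma_{F,h}^m)^d$, $S_h(\Gamma_{c,h}^m)$, $S_h(\Gamma_{c,h}^m)$): (3D-a) $$\begin{aligned}&\tfrac1{2\tau}(\boldsymbol u_h^{m+1},\boldsymbol v)_{\Omega_h^m}+\tfrac1{2\tau}(\boldsymbol u_h^{m+1}\circ\psi_h^m,\boldsymbol v\circ\psi_h^m)_{\Omega_h^{m-1}}+b(\boldsymbol u_h^m-\boldsymbol w_h^m;\boldsymbol u_h^{m+1}\circ\psi_h^m,\boldsymbol v\circ\psi_h^m)_{\Omega_h^{m-1}}\\&+\big(\tfrac2{Re}D(\boldsymbol u_h^{m+1}),D(\boldsymbol v)\big)_{\Omega_h^m}-(\tilde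 p_h^{m+1},\nabla\cdot\boldsymbol v)_{\Omega_h^m}+(q,\nabla\cdot\boldsymbol u_h^{m+1})_{\Omega_h^m}+\langle\tilde H_h^{m+1}\boldsymbol n_{F,h}^m,\boldsymbol v\rangle_{\Gamma_{F,h}^m}\\&-\langle\kappa_{s,h}^{m+1}\boldsymbol n_s,\boldsymbol v\rangle_{\Gamma_{s,h}^m}^{s,h}+\langle\lambda_s\boldsymbol n_s,\boldsymbol u_h^{m+1}\rangle_{\Gamma_{s,h}^m}^{s,h}+\beta_s\langle\mathbb P_s\boldsymbol u_h^{m+1},\mathbb P_s\boldsymbol v\rangle_{\Gamma_{s,h}^m}\\&+\tfrac1{We}\langle\widetilde{\boldsymbol w}_h^{m+1},\phi_c\boldsymbol n_s\rangle_{\Gamma_{c,h}^m}^h+\tfrac1{We}\langle\widetilde{\boldsymbol w}_h^{m+1},\chi_c\boldsymbol\xi_{c,h}^m\rangle_{\Gamma_{c,h}^m}^h=\tfrac1\tau(\boldsymbol u_h^m,\boldsymbol v\circ\psi_h^m)_{\Omega_h^{m-1}},\end{aligned}$$ (3D-b) $$\begin{aligned}-\langle\tilde H_h^{m+1}\tilde{\boldsymbol n}_{F,h}^{m+1/2},\boldsymbol\eta\rangle_{\Gamma_{F,h}^m}^h=&-\tfrac1{We}\langle\nabla_\Gamma(\mathrm{id}+\tau\widetilde{\boldsymbol w}_h^{m+1}),\nabla_\Gamma\boldsymbol\eta\rangle_{\Gamma_{F,h}^m}+\tfrac1{We}\langle\varphi_{c,h}^{m+1}\boldsymbol n_s,\boldsymbol\eta\rangle_{\Gamma_{c,h}^m}^h\\&+\tfrac1{We}\int_{\Gamma_{c,h}^m}\big[\cos\theta_Y\boldsymbol\mu_{s,h}^{m+1/2}-We\,\beta_c(\widetilde{\boldsymbol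 w}_h^{m+1}\cdot\boldsymbol\mu_{s,h}^m)\boldsymbol\mu_{s,h}^m+\sin\theta_{c,h}^m\boldsymbol n_s\big]\cdot\boldsymbol\eta\,\mathrm ds\\&+\tfrac1{We}\langle\psi_{c,h}^{m+1}\boldsymbol\xi_{c,h}^m,\boldsymbol\eta\rangle_{\Gamma_{c,h}^m}^h-g\langle\mathcal G(\widetilde{\boldsymbol w}_h^{m+1}),\boldsymbol\eta\rangle_{\Gamma_{F,h}^m},\end{aligned}$$ (3D-c) $\langle\widetilde{\boldsymbol w}_h^{m+1}\cdot\tilde{\boldsymbol n}_{F,h}^{m+1/2},\phi_F\rangle_{\Gamma_{F,h}^m}^h=\langle\boldsymbol u_h^{m+1}\cdot\boldsymbol n_{F,h}^m,\phi_F\rangle_{\Gamma_{F,h}^m}$. **Bulk mesh velocity.** Let $\mathring{\mathcal W}_h^m$ be the subspace of $\mathcal W_h^m$ of functions vanishing at the vertices of $\Gamma_{F,h}^m$. Given $\widetilde{\boldsymbol w}_h^{m+1}$, the bulk velocity $\boldsymbol w_h^{m+1}\in\mathcal W_h^m$ with $\boldsymbol w_h^{m+1}=\widetilde{\boldsymbol w}_h^{m+1}$ on $\Gamma_{F,h}^m$, together with $\varphi_{s,h}^{m+1}\in S_h(\Gamma_{s,h}^m)$, solves $$(D(\boldsymbol w_h^{m+1}),D(\boldsymbol\zeta))_{\Omega_h^m}+\langle\nabla_\Gamma\boldsymbol w_h^{m+1},\nabla_\Gamma\boldsymbol\zeta\rangle_{\Gamma_{s,h}^m}=\langle\varphi_{s,h}^{m+1}\boldsymbol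 n_s,\boldsymbol\zeta\rangle_{\Gamma_{s,h}^m}^h,\qquad\langle\boldsymbol w_h^{m+1}\cdot\boldsymbol n_s,\phi_s\rangle_{\Gamma_{s,h}^m}^h=0$$ for all $\boldsymbol\zeta\in\mathring{\mathcal W}_h^m$, $\phi_s\in S_h(\Gamma_{s,h}^m)$. *)

theory Defs
  imports "HOL-Analysis.Analysis"
begin

unbundle no cross3_syntax

type_synonym pt = "real^3"

section \<open>Simplicial meshes of moving polyhedral domains\<close>

text \<open>A simplex is represented by its set of vertices: tetrahedra have four, boundary triangles
  three, contact-line edges two. A mesh consists of its tetrahedra and of the boundary triangles
  forming the free surface and the wetted part of the solid.\<close>

record mesh =
  tets :: "pt set set"
  free :: "pt set set"
  solid :: "pt set set"

definition carrier :: "pt set set \<Rightarrow> pt set" where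
  "carrier C = (\<Union>V\<in>C. convex hull V)"

definition domain :: "mesh \<Rightarrow> pt set" where
  "domain M = interior (carrier (tets M))"

definition boundary_faces :: "mesh \<Rightarrow> pt set set" where
  "boundary_faces M = {\<sigma>. card \<sigma> = 3 \<and> card {T \<in> tets M. \<sigma> \<subseteq> T} = 1}"

text \<open>Conforming triangulation of a bounded polyhedral domain whose boundary is a closed
  triangulated surface, split into free surface and wetted boundary.\<close>

definition valid_mesh :: "mesh \<Rightarrow> bool" where
  "valid_mesh M \<longleftrightarrow>
     finite (tets M) \<and> tets M \<noteq> {} \<and>
     (\<forall>T\<in>tets M. card T = 4 \<and> \<not> affine_dependent T) \<and>
     (\<forall>S\<in>tets M. \<forall>T\<in>tets M. convex hull S \<inter> convex hull T = convex hull (S \<inter> T)) \<and>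
     connected (domain M) \<and>
     (\<forall>\<sigma>\<in>boundary_faces M. \<forall>e. e \<subseteq> \<sigma> \<and> card e = 2 \<longrightarrow>
        card {\<sigma>'\<in>boundary_faces M. e \<subseteq> \<sigma>'} = 2) \<and>
     free M \<union> solid M = boundary_faces M \<and> free M \<inter> solid M = {}"

definition shape_regular :: "real \<Rightarrow> mesh \<Rightarrow> bool" where
  "shape_regular C M \<longleftrightarrow> (\<forall>T\<in>tets M. \<exists>x r. r > 0 \<and> cball x r \<subseteq> convex hull T \<and>
     diameter (convex hull T) \<le> C * r)"

definition quasi_uniform :: "real \<Rightarrow> mesh \<Rightarrow> bool" where
  "quasi_uniform C M \<longleftrightarrow> (\<forall>S\<in>tets M. \<forall>T\<in>tets M.
     diameter (convex hull S) \<le> C * diameter (convex hull T))"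

definition outward_normal :: "mesh \<Rightarrow> pt set \<Rightarrow> pt" where
  "outward_normal M \<sigma> = (THE n. norm n = 1 \<and> (\<forall>a\<in>\<sigma>. \<forall>b\<in>\<sigma>. n \<bullet> (b - a) = 0) \<and>
     (\<forall>T\<in>tets M. \<sigma> \<subseteq> T \<longrightarrow> (\<forall>d\<in>T - \<sigma>. \<forall>a\<in>\<sigma>. n \<bullet> (d - a) < 0)))"

definition flat_substrate :: "pt \<Rightarrow> real \<Rightarrow> mesh \<Rightarrow> bool" where
  "flat_substrate n c M \<longleftrightarrow>
     (\<forall>\<sigma>\<in>solid M. (\<forall>x\<in>\<sigma>. n \<bullet> x = c) \<and> outward_normal M \<sigma> = n)"

definition contact_edges :: "mesh \<Rightarrow> pt set set" where
  "contact_edges M = {e. card e = 2 \<and> (\<exists>\<sigma>\<in>free M. e \<subseteq> \<sigma>) \<and> (\<exists>\<sigma>\<in>solid M. e \<subseteq> \<sigma>)}"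

text \<open>The contact line, i.e. the intersection of free surface and wetted boundary, is a simple
  closed polygon.\<close>

definition closed_contact_line :: "mesh \<Rightarrow> bool" where
  "closed_contact_line M \<longleftrightarrow>
     carrier (free M) \<inter> carrier (solid M) = carrier (contact_edges M) \<and>
     (\<exists>ps. distinct ps \<and> length ps \<ge> 3 \<and>
        contact_edges M = (\<lambda>i. {ps ! i, ps ! (Suc i mod length ps)}) ` {..<length ps})"

text \<open>The contact edges as pairs (start, end), directed such that tangent \<open>\<times>\<close> solid normal points
  away from the wetted triangle at the edge. Each edge occurs in exactly one direction.\<close>

definition directed_contact :: "pt \<Rightarrow> mesh \<Rightarrow> (pt \<times> pt) set" where
  "directed_contact n M = {(a, b). {a, b} \<in> contact_edges M \<and>
     (\<exists>c. c \<notin> {a, b} \<and> {a, b, c} \<in> solid M \<and> cross3 (b - a) n \<bullet> (c - a) < 0)}"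

definition mesh_map :: "real \<Rightarrow> (pt \<Rightarrow> pt) \<Rightarrow> pt \<Rightarrow> pt" where
  "mesh_map \<tau> w = (\<lambda>x. x + \<tau> *\<^sub>R w x)"

definition moved :: "(pt \<Rightarrow> pt) \<Rightarrow> mesh \<Rightarrow> mesh" where
  "moved \<psi> M = \<lparr>tets = image \<psi> ` tets M, free = image \<psi> ` free M, solid = image \<psi> ` solid M\<rparr>"

definition nondegenerate_map :: "mesh \<Rightarrow> (pt \<Rightarrow> pt) \<Rightarrow> bool" where
  "nondegenerate_map M \<psi> \<longleftrightarrow> inj_on \<psi> (carrier (tets M)) \<and>
     (\<forall>T\<in>tets M. \<forall>x\<in>interior (convex hull T). det (jacobian \<psi> (at x)) > 0)"

section \<open>Finite element spaces\<close>

text \<open>Functions are total on space; only their values on the carrier of the respective complex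
  matter.\<close>

definition P1 :: "pt set set \<Rightarrow> (pt \<Rightarrow> 'b::euclidean_space) set" where
  "P1 C = {f. continuous_on (carrier C) f \<and>
     (\<forall>V\<in>C. \<exists>c L. linear L \<and> (\<forall>x\<in>convex hull V. f x = c + L x))}"

definition P2 :: "pt set set \<Rightarrow> (pt \<Rightarrow> 'b::euclidean_space) set" where
  "P2 C = {f. continuous_on (carrier C) f \<and>
     (\<forall>V\<in>C. \<exists>c L B. linear L \<and> bilinear B \<and> (\<forall>x\<in>convex hull V. f x = c + L x + B x x))}"

definition nodes2 :: "pt set \<Rightarrow> pt set" where
  "nodes2 V = {midpoint a b | a b. a \<in> V \<and> b \<in> V}"

definition P2_interpolant :: "pt set set \<Rightarrow> (pt \<Rightarrow> 'b::euclidean_space) \<Rightarrow> (pt \<Rightarrow> 'b) \<Rightarrow> bool" where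
  "P2_interpolant C f g \<longleftrightarrow> g \<in> P2 C \<and> (\<forall>V\<in>C. \<forall>P\<in>nodes2 V. g P = f P)"

section \<open>Integrals and pairings\<close>

definition vol_int :: "pt set \<Rightarrow> (pt \<Rightarrow> real) \<Rightarrow> real" where
  "vol_int \<Omega> f = integral\<^sup>L (lebesgue_on \<Omega>) f"

definition vol_ip :: "pt set \<Rightarrow> (pt \<Rightarrow> 'b::euclidean_space) \<Rightarrow> (pt \<Rightarrow> 'b) \<Rightarrow> real" where
  "vol_ip \<Omega> f g = vol_int \<Omega> (\<lambda>x. f x \<bullet> g x)"

definition ref_triangle :: "(real \<times> real) set" where
  "ref_triangle = {(s, t). 0 \<le> s \<and> 0 \<le> t \<and> s + t \<le> 1}"

text \<open>Area and surface integral do not depend on the enumeration of the vertices.\<close>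

definition tri_vertices :: "pt set \<Rightarrow> pt \<times> pt \<times> pt" where
  "tri_vertices \<sigma> = (SOME (a, b, c). \<sigma> = {a, b, c})"

definition tri_chart :: "pt set \<Rightarrow> real \<times> real \<Rightarrow> pt" where
  "tri_chart \<sigma> = (case tri_vertices \<sigma> of (a, b, c) \<Rightarrow>
     (\<lambda>(s, t). a + s *\<^sub>R (b - a) + t *\<^sub>R (c - a)))"

definition tri_area :: "pt set \<Rightarrow> real" where
  "tri_area \<sigma> = (case tri_vertices \<sigma> of (a, b, c) \<Rightarrow> norm (cross3 (b - a) (c - a)) / 2)"

definition surface_area :: "pt set set \<Rightarrow> real" where
  "surface_area \<Gamma> = (\<Sum>\<sigma>\<in>\<Gamma>. tri_area \<sigma>)"

text \<open>Integrands on surfaces and curves get the element as an additional argument, since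
  elementwise quantities (normals, gradients) jump across element boundaries.\<close>

definition surf_int :: "pt set set \<Rightarrow> (pt set \<Rightarrow> pt \<Rightarrow> real) \<Rightarrow> real" where
  "surf_int \<Gamma> f = (\<Sum>\<sigma>\<in>\<Gamma>. 2 * tri_area \<sigma> *
     integral\<^sup>L (lebesgue_on ref_triangle) (\<lambda>p. f \<sigma> (tri_chart \<sigma> p)))"

definition curve_int :: "(pt \<times> pt) set \<Rightarrow> (pt \<times> pt \<Rightarrow> pt \<Rightarrow> real) \<Rightarrow> real" where
  "curve_int \<Gamma> f = (\<Sum>(a, b)\<in>\<Gamma>. norm (b - a) *
     integral\<^sup>L (lebesgue_on {0..1}) (\<lambda>s. f (a, b) (a + s *\<^sub>R (b - a))))"

text \<open>Mass-lumped products; vertex values are one-sided limits from the element.\<close>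

definition one_sided :: "pt set \<Rightarrow> (pt \<Rightarrow> real) \<Rightarrow> pt \<Rightarrow> real" where
  "one_sided V f P = Lim (at P within rel_interior (convex hull V)) f"

definition surf_lump :: "pt set set \<Rightarrow> (pt set \<Rightarrow> pt \<Rightarrow> real) \<Rightarrow> real" where
  "surf_lump \<Gamma> f = (\<Sum>\<sigma>\<in>\<Gamma>. tri_area \<sigma> / 3 * (\<Sum>P\<in>\<sigma>. one_sided \<sigma> (f \<sigma>) P))"

definition curve_lump :: "(pt \<times> pt) set \<Rightarrow> (pt \<times> pt \<Rightarrow> pt \<Rightarrow> real) \<Rightarrow> real" where
  "curve_lump \<Gamma> f = (\<Sum>(a, b)\<in>\<Gamma>. norm (b - a) / 2 * (\<Sum>P\<in>{a, b}. one_sided {a, b} (f (a, b)) P))"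

text \<open>The pairing of \<open>lam n\<close> with \<open>u\<close> over the quadratic nodes; the weight 6 is the dimension of
  the quadratic polynomials on a triangle.\<close>

definition solid_pairing :: "pt set set \<Rightarrow> pt \<Rightarrow> (pt \<Rightarrow> real) \<Rightarrow> (pt \<Rightarrow> pt) \<Rightarrow> real" where
  "solid_pairing \<Gamma> n lam u =
     (\<Sum>\<sigma>\<in>\<Gamma>. tri_area \<sigma> / 6 * (\<Sum>P\<in>nodes2 \<sigma>. lam P * (n \<bullet> u P)))"

section \<open>Derivatives\<close>

text \<open>Bulk derivatives of finite element functions exist in the interior of each tetrahedron,
  hence almost everywhere in the domain. The Jacobian has \<open>\<partial>\<^sub>j u\<^sub>i\<close> in row \<open>i\<close>, column \<open>j\<close>.\<close>

definition sym_part :: "real^3^3 \<Rightarrow> real^3^3" where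
  "sym_part A = (1/2) *\<^sub>R (A + transpose A)"

definition D :: "(pt \<Rightarrow> pt) \<Rightarrow> pt \<Rightarrow> real^3^3" where
  "D u x = sym_part (jacobian u (at x))"

definition divergence :: "(pt \<Rightarrow> pt) \<Rightarrow> pt \<Rightarrow> real" where
  "divergence u x = trace (jacobian u (at x))"

definition convection :: "pt set \<Rightarrow> (pt \<Rightarrow> pt) \<Rightarrow> (pt \<Rightarrow> pt) \<Rightarrow> (pt \<Rightarrow> pt) \<Rightarrow> real" where
  "convection \<Omega> z u v =
     1/2 * vol_ip \<Omega> (\<lambda>x. jacobian u (at x) *v z x) v - 1/2 * vol_ip \<Omega> (\<lambda>x. jacobian v (at x) *v z x) u"

text \<open>Tangential derivatives are taken along straight lines, so that they only involve values on
  the element when \<open>x\<close> is in its relative interior and \<open>t\<close> is tangential.\<close>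

definition dir_deriv :: "pt \<Rightarrow> (pt \<Rightarrow> pt) \<Rightarrow> pt \<Rightarrow> pt" where
  "dir_deriv t f x = vector_derivative (\<lambda>r. f (x + r *\<^sub>R t)) (at 0)"

definition tang_proj :: "pt \<Rightarrow> pt \<Rightarrow> pt" where
  "tang_proj n v = v - (n \<bullet> v) *\<^sub>R n"

definition surf_grad :: "pt \<Rightarrow> (pt \<Rightarrow> pt) \<Rightarrow> pt \<Rightarrow> real^3^3" where
  "surf_grad n f x = matrix (\<lambda>v. dir_deriv (tang_proj n v) f x)"

definition surf_grad_ip :: "mesh \<Rightarrow> pt set set \<Rightarrow> (pt \<Rightarrow> pt) \<Rightarrow> (pt \<Rightarrow> pt) \<Rightarrow> real" where
  "surf_grad_ip M \<Gamma> f g = surf_int \<Gamma> (\<lambda>\<sigma> x.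
     surf_grad (outward_normal M \<sigma>) f x \<bullet> surf_grad (outward_normal M \<sigma>) g x)"

section \<open>Contact line and intermediate geometry\<close>

definition tangent :: "pt \<times> pt \<Rightarrow> pt" where
  "tangent e = (1 / norm (snd e - fst e)) *\<^sub>R (snd e - fst e)"

definition conormal :: "pt \<Rightarrow> pt \<times> pt \<Rightarrow> pt" where
  "conormal n e = cross3 (tangent e) n"

definition conormal_half :: "real \<Rightarrow> pt \<Rightarrow> (pt \<Rightarrow> pt) \<Rightarrow> pt \<times> pt \<Rightarrow> pt \<Rightarrow> pt" where
  "conormal_half \<tau> n wt e x =
     cross3 ((1/2) *\<^sub>R (dir_deriv (tangent e) (\<lambda>y. y) x +
                       dir_deriv (tangent e) (\<lambda>y. y + \<tau> *\<^sub>R wt y) x)) n"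

definition clamp1 :: "real \<Rightarrow> real" where
  "clamp1 r = min 1 (max (-1) r)"

text \<open>\<open>transported \<tau> M w f\<close> carries \<open>f\<close>, given on the mesh \<open>M\<close>, to the image of \<open>M\<close> under the mesh
  map with velocity \<open>w\<close>.\<close>

definition transported :: "real \<Rightarrow> mesh \<Rightarrow> (pt \<Rightarrow> pt) \<Rightarrow> (pt \<Rightarrow> pt) \<Rightarrow> pt \<Rightarrow> pt" where
  "transported \<tau> M w f x = f (inv_into (carrier (tets M)) (mesh_map \<tau> w) x)"

definition contact_angle :: "real \<Rightarrow> real \<Rightarrow> real \<Rightarrow> pt \<Rightarrow> (pt \<Rightarrow> pt) \<Rightarrow> pt \<times> pt \<Rightarrow> real" where
  "contact_angle We \<beta>\<^sub>c \<theta>\<^sub>Y n wt e = arccos (clamp1 (cos \<theta>\<^sub>Y -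
     We * \<beta>\<^sub>c * (wt (midpoint (fst e) (snd e)) \<bullet> conormal n e)))"

definition inter_pos :: "real \<Rightarrow> (pt \<Rightarrow> pt) \<Rightarrow> real \<Rightarrow> pt \<Rightarrow> pt" where
  "inter_pos \<tau> wt \<theta> x = x + (\<tau> * \<theta>) *\<^sub>R wt x"

text \<open>Any tangential pair with cross product \<open>n\<close> gives the same \<open>inter_normal\<close> below.\<close>

definition tangent_frame :: "pt \<Rightarrow> pt \<times> pt" where
  "tangent_frame n = (SOME (t1, t2). t1 \<bullet> n = 0 \<and> t2 \<bullet> n = 0 \<and> cross3 t1 t2 = n)"

definition inter_normal :: "mesh \<Rightarrow> real \<Rightarrow> (pt \<Rightarrow> pt) \<Rightarrow> real \<Rightarrow> pt set \<Rightarrow> pt \<Rightarrow> pt" where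
  "inter_normal M \<tau> wt \<theta> \<sigma> x = (case tangent_frame (outward_normal M \<sigma>) of (t1, t2) \<Rightarrow>
     cross3 (dir_deriv t1 (inter_pos \<tau> wt \<theta>) x) (dir_deriv t2 (inter_pos \<tau> wt \<theta>) x))"

definition gravity_vec :: "mesh \<Rightarrow> real \<Rightarrow> pt \<Rightarrow> (pt \<Rightarrow> pt) \<Rightarrow> pt set \<Rightarrow> pt \<Rightarrow> pt" where
  "gravity_vec M \<tau> ez wt \<sigma> x = integral\<^sup>L (lebesgue_on {0..1})
     (\<lambda>\<theta>. (inter_pos \<tau> wt \<theta> x \<bullet> ez) *\<^sub>R inter_normal M \<tau> wt \<theta> \<sigma> x)"

definition normal_half :: "mesh \<Rightarrow> real \<Rightarrow> (pt \<Rightarrow> pt) \<Rightarrow> pt set \<Rightarrow> pt \<Rightarrow> pt" where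
  "normal_half M \<tau> wt \<sigma> x = integral\<^sup>L (lebesgue_on {0..1}) (\<lambda>\<theta>. inter_normal M \<tau> wt \<theta> \<sigma> x)"

section \<open>The scheme\<close>

text \<open>In the following, \<open>M'\<close> is the mesh of the previous time level, on which \<open>u\<^sub>0\<close>, \<open>w\<^sub>0\<close> (old fluid
  and mesh velocity) live, and \<open>M\<close> is its image under \<open>\<psi> = mesh_map \<tau> w\<^sub>0\<close>. At the initial step
  \<open>w\<^sub>0 = 0\<close> and \<open>M' = M\<close>; indexing the previous mesh by \<open>m - 1\<close> on the natural numbers yields this
  convention by truncation.\<close>

definition eq_momentum ::
  "real \<Rightarrow> real \<Rightarrow> real \<Rightarrow> real \<Rightarrow> pt \<Rightarrow> mesh \<Rightarrow> mesh \<Rightarrow> (pt \<Rightarrow> pt) \<Rightarrow> (pt \<Rightarrow> pt) \<Rightarrow>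
   (pt \<Rightarrow> pt) \<Rightarrow> (pt \<Rightarrow> real) \<Rightarrow> (pt \<Rightarrow> real) \<Rightarrow> (pt \<Rightarrow> real) \<Rightarrow> (pt \<Rightarrow> pt) \<Rightarrow>
   (pt \<Rightarrow> pt) \<Rightarrow> (pt \<Rightarrow> real) \<Rightarrow> (pt \<Rightarrow> real) \<Rightarrow> (pt \<Rightarrow> real) \<Rightarrow> (pt \<Rightarrow> real) \<Rightarrow> bool" where
  "eq_momentum Rey We \<beta>\<^sub>s \<tau> n M' M u\<^sub>0 w\<^sub>0 u p \<kappa> H wt v q lam \<phi>\<^sub>c \<chi>\<^sub>c \<longleftrightarrow>
     (let \<psi> = mesh_map \<tau> w\<^sub>0; \<Omega>' = domain M'; \<Omega> = domain M; C = directed_contact n M in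
       1 / (2 * \<tau>) * vol_ip \<Omega> u v
     + 1 / (2 * \<tau>) * vol_ip \<Omega>' (u \<circ> \<psi>) (v \<circ> \<psi>)
     + convection \<Omega>' (\<lambda>x. u\<^sub>0 x - w\<^sub>0 x) (u \<circ> \<psi>) (v \<circ> \<psi>)
     + vol_ip \<Omega> (\<lambda>x. (2 / Rey) *\<^sub>R D u x) (D v)
     - vol_ip \<Omega> p (divergence v)
     + vol_ip \<Omega> q (divergence u)
     + surf_int (free M) (\<lambda>\<sigma> x. (H x *\<^sub>R outward_normal M \<sigma>) \<bullet> v x)
     - solid_pairing (solid M) n \<kappa> v
     + solid_pairing (solid M) n lam u
     + \<beta>\<^sub>s * surf_int (solid M) (\<lambda>\<sigma> x. tang_proj n (u x) \<bullet> tang_proj n (v x))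
     + 1 / We * curve_lump C (\<lambda>e x. wt x \<bullet> (\<phi>\<^sub>c x *\<^sub>R n))
     + 1 / We * curve_lump C (\<lambda>e x. wt x \<bullet> (\<chi>\<^sub>c x *\<^sub>R tangent e))
     = 1 / \<tau> * vol_ip \<Omega>' u\<^sub>0 (v \<circ> \<psi>))"

text \<open>The argument \<open>wt\<^sub>0\<close> is the old free-boundary mesh velocity, already transported to \<open>M\<close>.\<close>

definition eq_curvature ::
  "real \<Rightarrow> real \<Rightarrow> real \<Rightarrow> real \<Rightarrow> real \<Rightarrow> pt \<Rightarrow> pt \<Rightarrow> mesh \<Rightarrow> (pt \<Rightarrow> pt) \<Rightarrow>
   (pt \<Rightarrow> real) \<Rightarrow> (pt \<Rightarrow> pt) \<Rightarrow> (pt \<Rightarrow> real) \<Rightarrow> (pt \<Rightarrow> real) \<Rightarrow> (pt \<Rightarrow> pt) \<Rightarrow> bool" where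
  "eq_curvature We \<beta>\<^sub>c g \<theta>\<^sub>Y \<tau> ez n M wt\<^sub>0 H wt \<phi> \<psi> \<eta> \<longleftrightarrow>
     (let C = directed_contact n M in
     - surf_lump (free M) (\<lambda>\<sigma> x. (H x *\<^sub>R normal_half M \<tau> wt \<sigma> x) \<bullet> \<eta> x)
     = - 1 / We * surf_grad_ip M (free M) (\<lambda>x. x + \<tau> *\<^sub>R wt x) \<eta>
     + 1 / We * curve_lump C (\<lambda>e x. (\<phi> x *\<^sub>R n) \<bullet> \<eta> x)
     + 1 / We * curve_int C (\<lambda>e x.
         (cos \<theta>\<^sub>Y *\<^sub>R conormal_half \<tau> n wt e x
          - (We * \<beta>\<^sub>c * (wt x \<bullet> conormal n e)) *\<^sub>R conormal n e
          + sin (contact_angle We \<beta>\<^sub>c \<theta>\<^sub>Y n wt\<^sub>0 e) *\<^sub>R n) \<bullet> \<eta> x)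
     + 1 / We * curve_lump C (\<lambda>e x. (\<psi> x *\<^sub>R tangent e) \<bullet> \<eta> x)
     - g * surf_int (free M) (\<lambda>\<sigma> x. gravity_vec M \<tau> ez wt \<sigma> x \<bullet> \<eta> x))"

definition eq_kinematic ::
  "real \<Rightarrow> mesh \<Rightarrow> (pt \<Rightarrow> pt) \<Rightarrow> (pt \<Rightarrow> pt) \<Rightarrow> (pt \<Rightarrow> real) \<Rightarrow> bool" where
  "eq_kinematic \<tau> M u wt \<phi>\<^sub>F \<longleftrightarrow>
     surf_lump (free M) (\<lambda>\<sigma> x. (wt x \<bullet> normal_half M \<tau> wt \<sigma> x) * \<phi>\<^sub>F x)
     = surf_int (free M) (\<lambda>\<sigma> x. (u x \<bullet> outward_normal M \<sigma>) * \<phi>\<^sub>F x)"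

definition scheme_solution ::
  "real \<Rightarrow> real \<Rightarrow> real \<Rightarrow> real \<Rightarrow> real \<Rightarrow> real \<Rightarrow> real \<Rightarrow> pt \<Rightarrow> pt \<Rightarrow> mesh \<Rightarrow> mesh \<Rightarrow>
   (pt \<Rightarrow> pt) \<Rightarrow> (pt \<Rightarrow> pt) \<Rightarrow> (pt \<Rightarrow> pt) \<Rightarrow>
   (pt \<Rightarrow> pt) \<Rightarrow> (pt \<Rightarrow> real) \<Rightarrow> (pt \<Rightarrow> real) \<Rightarrow> (pt \<Rightarrow> real) \<Rightarrow> (pt \<Rightarrow> pt) \<Rightarrow>
   (pt \<Rightarrow> real) \<Rightarrow> (pt \<Rightarrow> real) \<Rightarrow> bool" where
  "scheme_solution Rey We \<beta>\<^sub>s \<beta>\<^sub>c g \<theta>\<^sub>Y \<tau> ez n M' M u\<^sub>0 w\<^sub>0 wt\<^sub>0 u p \<kappa> H wt \<phi> \<psi> \<longleftrightarrow>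
     u \<in> P2 (tets M) \<and> p \<in> P1 (tets M) \<and> \<kappa> \<in> P2 (solid M) \<and> H \<in> P1 (free M) \<and>
     wt \<in> P1 (free M) \<and> \<phi> \<in> P1 (contact_edges M) \<and> \<psi> \<in> P1 (contact_edges M) \<and>
     (\<forall>v\<in>P2 (tets M). \<forall>q\<in>P1 (tets M). \<forall>lam\<in>P2 (solid M). \<forall>\<phi>\<^sub>F\<in>P1 (free M).
      \<forall>\<eta>\<in>P1 (free M). \<forall>\<phi>\<^sub>c\<in>P1 (contact_edges M). \<forall>\<chi>\<^sub>c\<in>P1 (contact_edges M).
        eq_momentum Rey We \<beta>\<^sub>s \<tau> n M' M u\<^sub>0 w\<^sub>0 u p \<kappa> H wt v q lam \<phi>\<^sub>c \<chi>\<^sub>c \<and>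
        eq_curvature We \<beta>\<^sub>c g \<theta>\<^sub>Y \<tau> ez n M (transported \<tau> M' w\<^sub>0 wt\<^sub>0) H wt \<phi> \<psi> \<eta> \<and>
        eq_kinematic \<tau> M u wt \<phi>\<^sub>F)"

definition bulk_mesh_velocity :: "pt \<Rightarrow> mesh \<Rightarrow> (pt \<Rightarrow> pt) \<Rightarrow> (pt \<Rightarrow> pt) \<Rightarrow> bool" where
  "bulk_mesh_velocity n M wt w \<longleftrightarrow>
     w \<in> P1 (tets M) \<and> (\<forall>x\<in>carrier (free M). w x = wt x) \<and>
     (\<exists>\<phi>\<^sub>s\<in>P1 (solid M).
        (\<forall>\<zeta>\<in>P1 (tets M). (\<forall>P\<in>\<Union>(free M). \<zeta> P = 0) \<longrightarrow>
           vol_ip (domain M) (D w) (D \<zeta>) + surf_grad_ip M (solid M) w \<zeta>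
           = surf_lump (solid M) (\<lambda>\<sigma> x. (\<phi>\<^sub>s x *\<^sub>R n) \<bullet> \<zeta> x))) \<and>
     (\<forall>\<phi>\<in>P1 (solid M). surf_lump (solid M) (\<lambda>\<sigma> x. (w x \<bullet> n) * \<phi> x) = 0)"

definition energy ::
  "real \<Rightarrow> real \<Rightarrow> real \<Rightarrow> pt \<Rightarrow> mesh \<Rightarrow> mesh \<Rightarrow> (pt \<Rightarrow> pt) \<Rightarrow> real" where
  "energy We g \<theta>\<^sub>Y ez M' M u =
     1/2 * vol_int (domain M') (\<lambda>x. (norm (u x))\<^sup>2)
     + 1 / We * surface_area (free M)
     - cos \<theta>\<^sub>Y / We * surface_area (solid M)
     + g * vol_int (domain M) (\<lambda>x. x \<bullet> ez)"

section \<open>The Sobolev space and Korn's inequality\<close>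

definition L2 :: "pt set \<Rightarrow> (pt \<Rightarrow> 'b::euclidean_space) \<Rightarrow> bool" where
  "L2 \<Omega> f \<longleftrightarrow> f \<in> borel_measurable (lebesgue_on \<Omega>) \<and>
     integrable (lebesgue_on \<Omega>) (\<lambda>x. (norm (f x))\<^sup>2)"

definition L2_norm_on :: "pt set \<Rightarrow> (pt \<Rightarrow> 'b::euclidean_space) \<Rightarrow> real" where
  "L2_norm_on \<Omega> f = sqrt (vol_int \<Omega> (\<lambda>x. (norm (f x))\<^sup>2))"

definition L2_surf :: "pt set set \<Rightarrow> (pt \<Rightarrow> pt) \<Rightarrow> bool" where
  "L2_surf \<Gamma> f \<longleftrightarrow> (\<forall>\<sigma>\<in>\<Gamma>.
     (\<lambda>p. f (tri_chart \<sigma> p)) \<in> borel_measurable (lebesgue_on ref_triangle) \<and>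
     integrable (lebesgue_on ref_triangle) (\<lambda>p. (norm (f (tri_chart \<sigma> p)))\<^sup>2))"

definition L2_norm_surf :: "pt set set \<Rightarrow> (pt \<Rightarrow> pt) \<Rightarrow> real" where
  "L2_norm_surf \<Gamma> f = sqrt (surf_int \<Gamma> (\<lambda>\<sigma> x. (norm (f x))\<^sup>2))"

definition partial_deriv :: "3 \<Rightarrow> (pt \<Rightarrow> real) \<Rightarrow> pt \<Rightarrow> real" where
  "partial_deriv i f x = frechet_derivative f (at x) (axis i 1)"

coinductive smooth :: "(pt \<Rightarrow> real) \<Rightarrow> bool" where
  "\<lbrakk>\<forall>x. f differentiable at x; \<forall>i. smooth (partial_deriv i f)\<rbrakk> \<Longrightarrow> smooth f"

definition test_function :: "pt set \<Rightarrow> (pt \<Rightarrow> real) \<Rightarrow> bool" where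
  "test_function \<Omega> \<phi> \<longleftrightarrow>
     smooth \<phi> \<and> compact (closure {x. \<phi> x \<noteq> 0}) \<and> closure {x. \<phi> x \<noteq> 0} \<subseteq> \<Omega>"

text \<open>\<open>H1 \<Omega> v G\<close>: the vector field \<open>v\<close> is in \<open>H\<^sup>1(\<Omega>)\<close> with weak gradient \<open>G\<close>.\<close>

definition H1 :: "pt set \<Rightarrow> (pt \<Rightarrow> pt) \<Rightarrow> (pt \<Rightarrow> real^3^3) \<Rightarrow> bool" where
  "H1 \<Omega> v G \<longleftrightarrow> L2 \<Omega> v \<and> L2 \<Omega> G \<and>
     (\<forall>\<phi> i j. test_function \<Omega> \<phi> \<longrightarrow>
        vol_int \<Omega> (\<lambda>x. v x $ i * partial_deriv j \<phi> x) = - vol_int \<Omega> (\<lambda>x. G x $ i $ j * \<phi> x))"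

text \<open>The trace operator is the continuous extension of \<open>v \<mapsto> v|\<Gamma>\<close> from \<open>H\<^sup>1(\<Omega>) \<inter> C(closure \<Omega>)\<close>
  to \<open>H\<^sup>1(\<Omega>)\<close> (with values in \<open>L\<^sup>2(\<Gamma>)\<close>); here \<open>g\<close> is the trace on \<open>\<Gamma>\<close> of \<open>v\<close> with weak gradient \<open>G\<close>.\<close>

definition has_trace ::
  "pt set \<Rightarrow> pt set set \<Rightarrow> (pt \<Rightarrow> pt) \<Rightarrow> (pt \<Rightarrow> real^3^3) \<Rightarrow> (pt \<Rightarrow> pt) \<Rightarrow> bool" where
  "has_trace \<Omega> \<Gamma> v G g \<longleftrightarrow> H1 \<Omega> v G \<and> L2_surf \<Gamma> g \<and>
     (\<exists>V W. (\<forall>k. H1 \<Omega> (V k) (W k) \<and> continuous_on (closure \<Omega>) (V k)) \<and>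
        (\<lambda>k. L2_norm_on \<Omega> (\<lambda>x. V k x - v x)) \<longlonglongrightarrow> 0 \<and>
        (\<lambda>k. L2_norm_on \<Omega> (\<lambda>x. W k x - G x)) \<longlonglongrightarrow> 0 \<and>
        (\<lambda>k. L2_norm_surf \<Gamma> (\<lambda>x. V k x - g x)) \<longlonglongrightarrow> 0)"

definition korn_inequality :: "real \<Rightarrow> mesh \<Rightarrow> bool" where
  "korn_inequality C M \<longleftrightarrow> (\<forall>v G g. has_trace (domain M) (solid M) v G g \<longrightarrow>
     (L2_norm_on (domain M) v)\<^sup>2 \<le>
       C * ((L2_norm_on (domain M) (\<lambda>x. sym_part (G x)))\<^sup>2 + (L2_norm_surf (solid M) g)\<^sup>2))"

end

theory Submission
  imports Defs
begin

text \<open>Testing the scheme with its own solution gives the energy law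
  \<open>E\<^sub>m\<^sub>+\<^sub>1 + \<tau> (2/Re \<parallel>D u\<parallel>\<^sup>2 + \<beta>\<^sub>s \<parallel>u\<parallel>\<^sup>2) \<le> E\<^sub>m\<close> with the norms over \<open>\<Omega>\<^sub>m\<close> and the wetted boundary:
  the multipliers, the pressure and the curvature drop out, the gravity term is exactly the increment of
  the potential energy, the conormal term dominates the increment of the wetted area, and the surface
  gradient term dominates that of the free surface since the area of a parallelogram is at most half
  the sum of the squares of its sides. The increments are sums over simplices in which the
  contributions of interior faces and edges cancel, because conforming simplices with a common face
  lie on opposite sides of it. As the energy is bounded below, the dissipation tends to zero. Since
  \<open>u \<bullet> n\<close> vanishes at all quadratic nodes of the wetted boundary, the tangential part is all of \<open>u\<close>
  there, and Korn's inequality bounds the velocity by the dissipation.\<close>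

section \<open>Signed volumes and oriented faces\<close>

text \<open>Two obstacles shape the proof. Finite element functions are total functions known only
  on the carrier of their complex, and triangles are enumerated by a choice operator. So derivatives
  and elementwise normals are evaluated only at relative interior points, integrals are compared up
  to null sets, and a signed quantity on a face is a product of two factors that both change sign
  when vertices are exchanged. Conformity is given for tetrahedra only: that neighbours lie on
  opposite sides of a common face, or of a common edge in the substrate, has to be derived. The
  increments can be exact because positions are affine in the intermediate time \<theta>: volume
  moments and wetted areas are polynomials in \<theta>, and the gravity vector and half-step
  conormal of the scheme average their rates of change. Inequalities enter only through Young's
  inequality for the kinetic term, the bound of the free area and the sign of the contact line
  friction. As \<tau> is fixed, the dissipation controls the velocity with a constant independent of
  the step.\<close>

definition vol4 :: "pt \<Rightarrow> pt \<Rightarrow> pt \<Rightarrow> pt \<Rightarrow> real" where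
  "vol4 a b c d = cross3 (b - a) (c - a) \<bullet> (d - a)"

text \<open>\<open>vol4\<close> is six times the signed volume of the tetrahedron, a determinant of
  edge vectors, so it alternates in its points. Its sign tells on which side of the plane through
  the first three points the fourth one lies.\<close>

lemma vol4_swap:
  "vol4 b a c d = - vol4 a b c d" "vol4 a c b d = - vol4 a b c d" "vol4 a b d c = - vol4 a b c d"
  by (simp_all add: vol4_def cross3_simps)

lemma vol4_perm_face:
  "vol4 b c a d = vol4 a b c d" "vol4 c a b d = vol4 a b c d" "vol4 c b a d = - vol4 a b c d"
  by (simp_all add: vol4_def cross3_simps)

lemma vol4_affine:
  "vol4 a b c (a + x *\<^sub>R (b - a) + y *\<^sub>R (c - a) + z *\<^sub>R (d - a)) = z * vol4 a b c d"
  by (simp add: vol4_def inner_add_right dot_cross_self)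

text \<open>Cramer's rule without division: each coefficient is the triple product with one vector
  replaced by \<open>V\<close>. In this form it also covers dependent vectors, as they may occur for
  a moving tetrahedron.\<close>

lemma cross3_cramer:
  fixes B C E V :: pt
  shows "(cross3 B C \<bullet> E) *\<^sub>R V =
     (V \<bullet> cross3 C E) *\<^sub>R B + (V \<bullet> cross3 E B) *\<^sub>R C + (V \<bullet> cross3 B C) *\<^sub>R E"
  by (simp add: cross3_simps forall_3)

text \<open>Cramer's rule divided by the determinant. Only the coefficient of \<open>e - a\<close>
  is kept explicit: its sign decides whether \<open>d\<close> and \<open>e\<close> lie on the same
  side of the face.\<close>

lemma vol4_coordinates:
  assumes "vol4 a b c e \<noteq> 0"
  obtains x y where
    "d = a + x *\<^sub>R (b - a) + y *\<^sub>R (c - a) + (vol4 a b c d / vol4 a b c e) *\<^sub>R (e - a)"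
proof -
  define V where "V = vol4 a b c e"
  let ?B = "b - a" and ?C = "c - a" and ?E = "e - a" and ?D = "d - a"
  have "V *\<^sub>R ?D = (?D \<bullet> cross3 ?C ?E) *\<^sub>R ?B + (?D \<bullet> cross3 ?E ?B) *\<^sub>R ?C + vol4 a b c d *\<^sub>R ?E"
    unfolding V_def using cross3_cramer[of ?B ?C ?E ?D] by (simp add: vol4_def inner_commute)
  then have "(1/V) *\<^sub>R (V *\<^sub>R ?D) = ((?D \<bullet> cross3 ?C ?E)/V) *\<^sub>R ?B + ((?D \<bullet> cross3 ?E ?B)/V) *\<^sub>R ?C
     + (vol4 a b c d/V) *\<^sub>R ?E"
    by (simp add: scaleR_add_right)
  then have "?D = ((?D \<bullet> cross3 ?C ?E)/V) *\<^sub>R ?B + ((?D \<bullet> cross3 ?E ?B)/V) *\<^sub>R ?C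
     + (vol4 a b c d/V) *\<^sub>R ?E"
    using assms by (simp add: V_def)
  then have "d = a + ((?D \<bullet> cross3 ?C ?E)/V) *\<^sub>R ?B + ((?D \<bullet> cross3 ?E ?B)/V) *\<^sub>R ?C
     + (vol4 a b c d/V) *\<^sub>R ?E"
    by (simp add: algebra_simps)
  then show thesis unfolding V_def by (rule that)
qed

text \<open>A vanishing determinant yields a linear relation between the edge vectors at
  \<open>a\<close>. Giving \<open>a\<close> minus the sum of the other coefficients turns it into an
  affine dependence.\<close>

lemma vol4_nonzero:
  assumes "distinct [a, b, c, d]" "\<not> affine_dependent {a, b, c, d}"
  shows "vol4 a b c d \<noteq> 0"
proof
  assume "vol4 a b c d = 0"
  then have "det (vector [d - a, b - a, c - a] :: real^3^3) = 0"
    unfolding vol4_def by (metis dot_cross_det inner_commute)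
  then have "\<not> invertible (vector [d - a, b - a, c - a] :: real^3^3)"
    by (simp add: invertible_det_nz)
  then obtain k i where k: "(\<Sum>i\<in>UNIV. k i *s row i (vector [d - a, b - a, c - a] :: real^3^3)) = 0"
      "k i \<noteq> 0"
    using invertible_right_inverse matrix_right_invertible_independent_rows by blast
  have row: "row i A = A $ i" for i and A :: "real^3^3" by (simp add: row_def vec_eq_iff)
  have eq: "k 1 *\<^sub>R (d - a) + k 2 *\<^sub>R (b - a) + k 3 *\<^sub>R (c - a) = 0"
    using k(1) by (simp add: sum_3 row scalar_mult_eq_scaleR)
  have nz: "k 1 \<noteq> 0 \<or> k 2 \<noteq> 0 \<or> k 3 \<noteq> 0"
    using k(2) by (metis exhaust_3)
  define u where "u = (\<lambda>x. if x = d then k 1 else if x = b then k 2 else if x = c then k 3 else - k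
      1 - k 2 - k 3)"
  have "sum u {a, b, c, d} = 0" "(\<exists>v\<in>{a, b, c, d}. u v \<noteq> 0)" "(\<Sum>v\<in>{a, b, c, d}. u v *\<^sub>R v) = 0"
    using assms(1) eq nz by (auto simp: u_def algebra_simps)
  then have "affine_dependent {a, b, c, d}"
    by (subst affine_dependent_explicit_finite) auto
  with assms(2) show False by simp
qed

lemma convex_combination_4:
  assumes "0 \<le> x" "0 \<le> y" "0 \<le> z" "x + y + z \<le> (1::real)"
  shows "a + x *\<^sub>R (b - a) + y *\<^sub>R (c - a) + z *\<^sub>R (d - a) \<in> convex hull {a, b, c, d}"
proof -
  define l where "l = (\<lambda>i::nat. [1 - x - y - z, x, y, z] ! i)"
  define p where "p = (\<lambda>i::nat. [a, b, c, d] ! i)"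
  have s: "{..<4::nat} = {0, 1, 2, 3}" by auto
  have "(\<Sum>i<4. l i *\<^sub>R p i) \<in> convex hull {a, b, c, d}"
    by (rule convex_sum) (use assms in \<open>auto simp: s l_def p_def hull_inc\<close>)
  also have "(\<Sum>i<4. l i *\<^sub>R p i) = a + x *\<^sub>R (b - a) + y *\<^sub>R (c - a) + z *\<^sub>R (d - a)"
    by (simp add: s l_def p_def algebra_simps)
  finally show ?thesis .
qed

lemma convex_combination_3:
  assumes "0 \<le> x" "0 \<le> y" "x + y \<le> (1::real)"
  shows "a + x *\<^sub>R (b - a) + y *\<^sub>R (c - a) \<in> convex hull {a, b, c}"
  using convex_combination_4[of x y 0 a b c c] assms by simp

lemma mesh_conforming:
  "valid_mesh M \<Longrightarrow> S \<in> tets M \<Longrightarrow> T \<in> tets M \<Longrightarrow>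
    convex hull S \<inter> convex hull T = convex hull (S \<inter> T)"
  by (simp add: valid_mesh_def)

text \<open>Near the centroid of a common face two tetrahedra on the same side of it overlap.\<close>

lemma tets_on_opposite_sides:
  assumes M: "valid_mesh M" and T: "insert d {a, b, c} \<in> tets M" "insert e {a, b, c} \<in> tets M"
    and dist: "distinct [a, b, c]" "d \<notin> {a, b, c}" "e \<notin> {a, b, c}" "d \<noteq> e"
  shows "vol4 a b c d * vol4 a b c e < 0"
proof -
  have ind: "vol4 a b c x \<noteq> 0" if "insert x {a, b, c} \<in> tets M" "x \<notin> {a, b, c}" for x
    using M that dist unfolding valid_mesh_def
    by (intro vol4_nonzero) (auto simp: insert_commute)
  have inter: "convex hull {a, b, c, d} \<inter> convex hull {a, b, c, e} = convex hull {a, b, c}"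
  proof -
    have "insert d {a, b, c} \<inter> insert e {a, b, c} = {a, b, c}" using dist by auto
    moreover have "{a, b, c, d} = insert d {a, b, c}" "{a, b, c, e} = insert e {a, b, c}" by auto
    ultimately show ?thesis using mesh_conforming[OF M T] by simp
  qed
  have "vol4 a b c d * vol4 a b c e \<noteq> 0" using ind T dist by auto
  moreover have "\<not> vol4 a b c d * vol4 a b c e > 0"
  proof
    assume pos: "vol4 a b c d * vol4 a b c e > 0"
    define r where "r = vol4 a b c d / vol4 a b c e"
    have r: "r > 0" using pos unfolding r_def by (metis zero_less_divide_iff zero_less_mult_iff)
    obtain x y where d: "d = a + x *\<^sub>R (b - a) + y *\<^sub>R (c - a) + r *\<^sub>R (e - a)"
      using vol4_coordinates[of a b c e d] pos unfolding r_def by fastforce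
    have dd: "d - a = x *\<^sub>R (b - a) + y *\<^sub>R (c - a) + r *\<^sub>R (e - a)"
      by (subst d) simp
    \<comment> \<open>The point \<open>p\<close> below lies on the segment from the centroid of the
      face to \<open>d\<close>. With this \<open>h\<close> its weights at \<open>b\<close>,
      \<open>c\<close> and \<open>e\<close> differ from those of the centroid by at most 1/6 in
      total, so it belongs to the other tetrahedron as well.\<close>
    define h where "h = 1 / (6 * (1 + \<bar>x\<bar> + \<bar>y\<bar> + r))"
    have h: "h > 0" using r by (auto simp: h_def)
    have hb: "h * (1 + \<bar>x\<bar> + \<bar>y\<bar> + r) = 1/6" using r by (simp add: h_def field_simps)
    have hx: "\<bar>h * x\<bar> + \<bar>h * y\<bar> + h * r + h = 1/6"
      using hb h by (simp add: abs_mult algebra_simps)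
    have hp: "0 < h * r" using h r by simp
    have hle: "h \<le> 1" using hx hp abs_ge_zero[of "h*x"] abs_ge_zero[of "h*y"] by linarith
    define p where "p = a + ((1 - h)/3) *\<^sub>R (b - a) + ((1 - h)/3) *\<^sub>R (c - a) + h *\<^sub>R (d - a)"
    have "p \<in> convex hull {a, b, c, d}" unfolding p_def
      using h hle by (intro convex_combination_4) (auto simp: field_simps)
    moreover have "p \<in> convex hull {a, b, c, e}"
    proof -
      have "p = a + ((1 - h)/3 + h * x) *\<^sub>R (b - a) + ((1 - h)/3 + h * y) *\<^sub>R (c - a) + (h * r) *\<^sub>R
          (e - a)"
        unfolding p_def dd by (simp add: scaleR_add_left scaleR_add_right)
      moreover have "0 \<le> (1 - h)/3 + h * x" "0 \<le> (1 - h)/3 + h * y" using hx h hp by (auto simp: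
          field_simps abs_le_iff)
      moreover have "(1 - h)/3 + h * x + ((1 - h)/3 + h * y) + h * r \<le> 1"
      proof -
        have "h * x \<le> \<bar>h * x\<bar>" "h * y \<le> \<bar>h * y\<bar>" by simp_all
        moreover have "(1 - h)/3 \<le> 1/3" using h by simp
        ultimately show ?thesis using hx h by linarith
      qed
      ultimately show ?thesis using hp by (auto intro!: convex_combination_4)
    qed
    ultimately have "p \<in> convex hull {a, b, c}" using inter by blast
    then obtain s t where "p = a + s *\<^sub>R (b - a) + t *\<^sub>R (c - a)"
      unfolding convex_hull_3_alt by auto
    then have "vol4 a b c p = 0" using vol4_affine[of a b c s t 0 a] by simp
    moreover have "vol4 a b c p = h * vol4 a b c d" unfolding p_def by (rule vol4_affine)
    ultimately show False using h pos by auto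
  qed
  ultimately show ?thesis by linarith
qed

section \<open>Faces of tetrahedra, their signs, and the cancellation of interior faces\<close>

definition tet_faces :: "pt set \<Rightarrow> pt set set" where
  "tet_faces T = {\<sigma>. \<sigma> \<subseteq> T \<and> card \<sigma> = 3}"

definition normal_vec :: "pt set \<Rightarrow> pt" where
  "normal_vec \<sigma> = (case tri_vertices \<sigma> of (a, b, c) \<Rightarrow> cross3 (b - a) (c - a))"

text \<open>The sign by which the enumeration of the vertices of \<open>\<sigma>\<close> has to be corrected for
  \<open>normal_vec \<sigma>\<close> to point out of the tetrahedron \<open>T\<close>.\<close>

definition face_sign :: "pt set \<Rightarrow> pt set \<Rightarrow> real" where
  "face_sign \<sigma> T = (case tri_vertices \<sigma> of (a, b, c) \<Rightarrow> - sgn (vol4 a b c (the_elem (T - \<sigma>))))"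

text \<open>Summing over all adjacent tetrahedra makes the sign meaningful for every triangle:
  interior faces get 0 and boundary faces the sign of their only tetrahedron, so sums over
  tetrahedra reduce to the boundary.\<close>

definition boundary_sign :: "mesh \<Rightarrow> pt set \<Rightarrow> real" where
  "boundary_sign M \<sigma> = (\<Sum>T | T \<in> tets M \<and> \<sigma> \<subseteq> T. face_sign \<sigma> T)"

lemma tri_verticesE:
  assumes "card \<sigma> = 3"
  obtains a b c where "tri_vertices \<sigma> = (a, b, c)" "\<sigma> = {a, b, c}" "distinct [a, b, c]"
proof -
  obtain x y z where xyz: "\<sigma> = {x, y, z}" using assms by (auto simp: card_3_iff)
  have "case tri_vertices \<sigma> of (a, b, c) \<Rightarrow> \<sigma> = {a, b, c}"
    unfolding tri_vertices_def by (rule someI[of _ "(x, y, z)"]) (use xyz in auto)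
  then obtain a b c where abc: "tri_vertices \<sigma> = (a, b, c)" "\<sigma> = {a, b, c}"
    by (cases "tri_vertices \<sigma>") auto
  moreover have "distinct [a, b, c]" using assms abc by (auto simp: card_insert_if split: if_splits)
  ultimately show thesis by (rule that)
qed

text \<open>The enumeration returned by \<open>tri_vertices\<close> is unknown, so identities about
  it are checked in all six orders of the vertices.\<close>

lemma triangle_vertex_cases:
  assumes "{a, b, c} = {x, y, z}" "distinct [x, y, z]" "distinct [a, b, c]"
  shows "(x, y, z) \<in> {(a, b, c), (a, c, b), (b, a, c), (b, c, a), (c, a, b), (c, b, a)}"
proof -
  from assms(1) have "x \<in> {a, b, c}" "y \<in> {a, b, c}" "z \<in> {a, b, c}" by blast+
  then show ?thesis using assms(2,3) by auto
qed

lemma opposite_vertexE: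
  assumes "card \<sigma> = 3" "\<sigma> \<subseteq> T" "card T = 4"
  obtains d where "T = insert d \<sigma>" "d \<notin> \<sigma>" "the_elem (T - \<sigma>) = d"
proof -
  have "finite \<sigma>" "finite T" using assms by (auto intro: card_ge_0_finite)
  then have "card (T - \<sigma>) = 1" using assms by (simp add: card_Diff_subset)
  then obtain d where "T - \<sigma> = {d}" by (auto simp: card_1_singleton_iff)
  then have "T = insert d \<sigma>" "d \<notin> \<sigma>" using assms by auto
  then show thesis using that[of d] \<open>T - \<sigma> = {d}\<close> by simp
qed

lemma finite_tets: "valid_mesh M \<Longrightarrow> finite (tets M)"
  by (simp add: valid_mesh_def)

lemma card_tet: "valid_mesh M \<Longrightarrow> T \<in> tets M \<Longrightarrow> card T = 4"
  by (simp add: valid_mesh_def)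

lemma face_sign_nonzero:
  assumes M: "valid_mesh M" and "T \<in> tets M" "\<sigma> \<subseteq> T" "card \<sigma> = 3"
  shows "\<bar>face_sign \<sigma> T\<bar> = 1"
proof -
  obtain a b c where abc: "tri_vertices \<sigma> = (a, b, c)" "\<sigma> = {a, b, c}" "distinct [a, b, c]"
    using tri_verticesE assms by blast
  obtain d where d: "T = insert d \<sigma>" "d \<notin> \<sigma>" "the_elem (T - \<sigma>) = d"
    using opposite_vertexE assms card_tet by metis
  have "vol4 a b c d \<noteq> 0"
    using M assms(2) abc d unfolding valid_mesh_def
    by (intro vol4_nonzero) (auto simp: insert_commute)
  then show ?thesis by (simp add: face_sign_def abc(1) d(3) abs_sgn_eq)
qed

lemma face_sign_opposite:
  assumes M: "valid_mesh M" and "S \<in> tets M" "T \<in> tets M" "S \<noteq> T" "\<sigma> \<subseteq> S" "\<sigma> \<subseteq> T" "card \<sigma> = 3"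
  shows "face_sign \<sigma> S = - face_sign \<sigma> T"
proof -
  obtain a b c where abc: "tri_vertices \<sigma> = (a, b, c)" "\<sigma> = {a, b, c}" "distinct [a, b, c]"
    using tri_verticesE assms by blast
  obtain d where d: "S = insert d \<sigma>" "d \<notin> \<sigma>" "the_elem (S - \<sigma>) = d"
    using opposite_vertexE assms card_tet by metis
  obtain e where e: "T = insert e \<sigma>" "e \<notin> \<sigma>" "the_elem (T - \<sigma>) = e"
    using opposite_vertexE assms card_tet by metis
  have "vol4 a b c d * vol4 a b c e < 0"
  proof (rule tets_on_opposite_sides[OF M])
    show "insert d {a, b, c} \<in> tets M" "insert e {a, b, c} \<in> tets M"
      using assms(2,3) d(1) e(1) abc(2) by simp_all
    show "d \<noteq> e" using assms(4) d(1) e(1) by blast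
  qed (use abc d(2) e(2) in simp_all)
  then show ?thesis
    by (auto simp: face_sign_def abc(1) d(3) e(3) mult_less_0_iff)
qed

text \<open>The number of tetrahedra at a face is not bounded by definition. Distinct ones carry
  opposite signs, and three pairwise opposite signs would all vanish; hence a triangle that is no
  boundary face has either no neighbour or exactly two.\<close>

lemma sum_face_sign_interior:
  assumes M: "valid_mesh M" and s: "card \<sigma> = 3" "\<sigma> \<notin> boundary_faces M"
  shows "boundary_sign M \<sigma> = 0"
proof (cases "{T \<in> tets M. \<sigma> \<subseteq> T} = {}")
  case True
  then show ?thesis by (simp only: boundary_sign_def) simp
next
  case False
  let ?A = "{T \<in> tets M. \<sigma> \<subseteq> T}"
  obtain S where S: "S \<in> ?A" using False by blast
  have "card ?A \<noteq> 1" using s by (simp add: boundary_faces_def)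
  then have "?A \<noteq> {S}" by (metis card_1_singleton_iff One_nat_def)
  then obtain T where T: "T \<in> ?A" "T \<noteq> S" using S by blast
  have "U = S \<or> U = T" if "U \<in> ?A" for U
  proof (rule ccontr)
    assume "\<not> (U = S \<or> U = T)"
    then have "face_sign \<sigma> U = - face_sign \<sigma> S" "face_sign \<sigma> U = - face_sign \<sigma> T"
      "face_sign \<sigma> S = - face_sign \<sigma> T"
      using face_sign_opposite[OF M, of U S \<sigma>] face_sign_opposite[OF M, of U T \<sigma>]
        face_sign_opposite[OF M, of S T \<sigma>] S T that s by simp_all
    then have "face_sign \<sigma> S = 0" by linarith
    then show False using face_sign_nonzero[OF M, of S \<sigma>] S s by simp
  qed
  then have "?A = {S, T}" using S T by auto
  moreover have "face_sign \<sigma> S = - face_sign \<sigma> T"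
    using face_sign_opposite[OF M, of S T \<sigma>] S T s by simp
  ultimately show ?thesis using T(2) by (simp add: boundary_sign_def)
qed

lemma boundary_face_in_tet:
  assumes "\<sigma> \<in> boundary_faces M"
  shows "\<exists>T\<in>tets M. \<sigma> \<subseteq> T"
proof -
  have "card {T \<in> tets M. \<sigma> \<subseteq> T} = 1" using assms by (simp add: boundary_faces_def)
  then obtain T where "{T \<in> tets M. \<sigma> \<subseteq> T} = {T}" by (auto simp: card_1_singleton_iff)
  then show ?thesis by blast
qed

lemma finite_tet: "valid_mesh M \<Longrightarrow> T \<in> tets M \<Longrightarrow> finite T"
  using card_tet by (fastforce intro: card_ge_0_finite)

lemma finite_tet_faces: "valid_mesh M \<Longrightarrow> T \<in> tets M \<Longrightarrow> finite (tet_faces T)"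
  using finite_tet by (simp add: tet_faces_def)

lemma finite_boundary_faces: "valid_mesh M \<Longrightarrow> finite (boundary_faces M)"
proof -
  assume M: "valid_mesh M"
  have "boundary_faces M \<subseteq> (\<Union>T\<in>tets M. Pow T)"
  proof
    fix \<sigma> assume "\<sigma> \<in> boundary_faces M"
    then show "\<sigma> \<in> (\<Union>T\<in>tets M. Pow T)" using boundary_face_in_tet by auto
  qed
  moreover have "finite (\<Union>T\<in>tets M. Pow T)"
    using M finite_tet finite_tets by auto
  ultimately show ?thesis by (rule finite_subset)
qed

text \<open>After exchanging the two sums, the coefficient of \<open>F \<sigma>\<close> is
  \<open>boundary_sign M \<sigma>\<close>, which vanishes inside. The cancellation relies on
  \<open>F \<sigma>\<close> depending on the face but not on the tetrahedron it is seen from, as in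
  the divergence theorem.\<close>

lemma sum_over_faces:
  fixes F :: "pt set \<Rightarrow> real"
  assumes M: "valid_mesh M"
  shows "(\<Sum>T\<in>tets M. \<Sum>\<sigma>\<in>tet_faces T. face_sign \<sigma> T * F \<sigma>) =
    (\<Sum>\<sigma>\<in>boundary_faces M. boundary_sign M \<sigma> * F \<sigma>)"
proof -
  let ?A = "\<Union>T\<in>tets M. tet_faces T"
  have fin: "finite ?A"
    using M finite_tet_faces finite_tets by auto
  have "(\<Sum>T\<in>tets M. \<Sum>\<sigma>\<in>tet_faces T. face_sign \<sigma> T * F \<sigma>)
      = (\<Sum>T\<in>tets M. \<Sum>\<sigma> | \<sigma> \<in> ?A \<and> \<sigma> \<subseteq> T. face_sign \<sigma> T * F \<sigma>)"
    by (intro sum.cong) (auto simp: tet_faces_def)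
  also have "\<dots> = (\<Sum>\<sigma>\<in>?A. \<Sum>T | T \<in> tets M \<and> \<sigma> \<subseteq> T. face_sign \<sigma> T * F \<sigma>)"
    by (rule sum.swap_restrict[OF finite_tets[OF M] fin])
  also have "\<dots> = (\<Sum>\<sigma>\<in>?A. boundary_sign M \<sigma> * F \<sigma>)"
    by (simp add: boundary_sign_def sum_distrib_right)
  also have "\<dots> = (\<Sum>\<sigma>\<in>boundary_faces M. boundary_sign M \<sigma> * F \<sigma>)"
  proof (rule sum.mono_neutral_right[OF fin])
    show "boundary_faces M \<subseteq> ?A"
    proof
      fix \<sigma> assume s: "\<sigma> \<in> boundary_faces M"
      then show "\<sigma> \<in> ?A" using boundary_face_in_tet[OF s] by (auto simp: tet_faces_def
          boundary_faces_def)
    qed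
    show "\<forall>\<sigma>\<in>?A - boundary_faces M. boundary_sign M \<sigma> * F \<sigma> = 0"
      using sum_face_sign_interior[OF M] by (auto simp: tet_faces_def)
  qed
  finally show ?thesis .
qed

lemma boundary_faceE:
  assumes M: "valid_mesh M" and s: "\<sigma> \<in> boundary_faces M"
  obtains a b c d where "tri_vertices \<sigma> = (a, b, c)" "\<sigma> = {a, b, c}" "distinct [a, b, c]"
    "d \<notin> \<sigma>" "insert d \<sigma> \<in> tets M" "{T \<in> tets M. \<sigma> \<subseteq> T} = {insert d \<sigma>}"
    "vol4 a b c d \<noteq> 0" "boundary_sign M \<sigma> = - sgn (vol4 a b c d)"
proof -
  have c3: "card \<sigma> = 3" and "card {T \<in> tets M. \<sigma> \<subseteq> T} = 1"
    using s by (auto simp: boundary_faces_def)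
  then obtain T where T: "{T \<in> tets M. \<sigma> \<subseteq> T} = {T}" by (auto simp: card_1_singleton_iff)
  then have TM: "T \<in> tets M" "\<sigma> \<subseteq> T" by auto
  obtain a b c where abc: "tri_vertices \<sigma> = (a, b, c)" "\<sigma> = {a, b, c}" "distinct [a, b, c]"
    using tri_verticesE c3 by blast
  obtain d where d: "T = insert d \<sigma>" "d \<notin> \<sigma>" "the_elem (T - \<sigma>) = d"
    using opposite_vertexE TM c3 card_tet[OF M] by metis
  have "vol4 a b c d \<noteq> 0"
    using M TM abc d unfolding valid_mesh_def
    by (intro vol4_nonzero) (auto simp: insert_commute)
  moreover have "boundary_sign M \<sigma> = - sgn (vol4 a b c d)"
    using T by (simp add: boundary_sign_def face_sign_def abc(1) d(3))
  ultimately show thesis using that abc d TM T by blast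
qed

section \<open>Outward normals and areas of boundary triangles\<close>

lemma cross3_normal_unique:
  assumes "n \<bullet> u = 0" "n \<bullet> v = 0" "norm n = 1"
  shows "cross3 u v = (n \<bullet> cross3 u v) *\<^sub>R n"
proof -
  have "cross3 n (cross3 u v) = 0" using assms by (simp add: Lagrange)
  then have "cross3 n (cross3 n (cross3 u v)) = 0" by (metis cross_zero_right)
  then show ?thesis using assms(3) unfolding Lagrange[of n n] by (simp add: norm_eq_1)
qed

text \<open>The description operator is resolved by an explicit vector: the sign-corrected unit
  normal satisfies the conditions, and any other candidate is parallel to it, with its sign fixed by
  the fourth vertex of the only adjacent tetrahedron. The last three facts recover the defining
  properties.\<close>

lemma outward_normal_eq:
  assumes M: "valid_mesh M" and s: "\<sigma> \<in> boundary_faces M"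
  shows "outward_normal M \<sigma> = (boundary_sign M \<sigma> / norm (normal_vec \<sigma>)) *\<^sub>R normal_vec \<sigma>"
    and "normal_vec \<sigma> \<noteq> 0" and "norm (outward_normal M \<sigma>) = 1"
    and "\<And>x y. x \<in> \<sigma> \<Longrightarrow> y \<in> \<sigma> \<Longrightarrow> outward_normal M \<sigma> \<bullet> (y - x) = 0"
    and "\<And>T d a. T \<in> tets M \<Longrightarrow> \<sigma> \<subseteq> T \<Longrightarrow> d \<in> T - \<sigma> \<Longrightarrow> a \<in> \<sigma> \<Longrightarrow> outward_normal M \<sigma> \<bullet> (d - a) < 0"
proof -
  obtain a b c d where abc: "tri_vertices \<sigma> = (a, b, c)" "\<sigma> = {a, b, c}" "distinct [a, b, c]"
    and d: "d \<notin> \<sigma>" "insert d \<sigma> \<in> tets M" "{T \<in> tets M. \<sigma> \<subseteq> T} = {insert d \<sigma>}"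
    and v: "vol4 a b c d \<noteq> 0" "boundary_sign M \<sigma> = - sgn (vol4 a b c d)"
    by (rule boundary_faceE[OF M s])
  define N where "N = cross3 (b - a) (c - a)"
  have N: "normal_vec \<sigma> = N" by (simp add: normal_vec_def abc(1) N_def)
  have vN: "vol4 a b c d = N \<bullet> (d - a)" by (simp add: vol4_def N_def)
  have N0: "N \<noteq> 0" using v(1) vN by auto
  define n where "n = (- sgn (N \<bullet> (d - a)) / norm N) *\<^sub>R N"
  have perp: "N \<bullet> (b - a) = 0" "N \<bullet> (c - a) = 0" unfolding N_def by (simp_all add: dot_cross_self)
  have tang: "m \<bullet> (y - x) = 0" if "x \<in> \<sigma>" "y \<in> \<sigma>" "m \<bullet> (b - a) = 0" "m \<bullet> (c - a) = 0" for m x y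
    using that by (auto simp: abc(2) inner_diff_right)
  have n1: "norm n = 1" using N0 v(1) vN by (simp add: n_def abs_sgn_eq)
  have nd: "n \<bullet> (d - a) < 0"
    using N0 v(1) unfolding vN by (auto simp: n_def mult_less_0_iff divide_less_0_iff sgn_if)
  have unT: "T = insert d \<sigma>" if "T \<in> tets M" "\<sigma> \<subseteq> T" for T using d(3) that by blast
  have tn: "n \<bullet> (y - x) = 0" if "x \<in> \<sigma>" "y \<in> \<sigma>" for x y
    by (rule tang[OF that]) (simp_all add: n_def perp)
  have neg: "n \<bullet> (e - x) < 0" if "T \<in> tets M" "\<sigma> \<subseteq> T" "e \<in> T - \<sigma>" "x \<in> \<sigma>" for T e x
  proof -
    have "e = d" using unT that by auto
    moreover have "n \<bullet> (d - x) = n \<bullet> (d - a) + n \<bullet> (a - x)" by (simp add: inner_diff_right)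
    ultimately show ?thesis using nd tn[of x a] that abc(2) by auto
  qed
  have *: "outward_normal M \<sigma> = n"
    unfolding outward_normal_def
  proof (rule the_equality)
    show "norm n = 1 \<and> (\<forall>a\<in>\<sigma>. \<forall>b\<in>\<sigma>. n \<bullet> (b - a) = 0) \<and>
     (\<forall>T\<in>tets M. \<sigma> \<subseteq> T \<longrightarrow> (\<forall>d\<in>T - \<sigma>. \<forall>a\<in>\<sigma>. n \<bullet> (d - a) < 0))"
      using n1 tn neg by blast
  next
    fix m assume m: "norm m = 1 \<and> (\<forall>a\<in>\<sigma>. \<forall>b\<in>\<sigma>. m \<bullet> (b - a) = 0) \<and>
     (\<forall>T\<in>tets M. \<sigma> \<subseteq> T \<longrightarrow> (\<forall>d\<in>T - \<sigma>. \<forall>a\<in>\<sigma>. m \<bullet> (d - a) < 0))"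
    define k where "k = m \<bullet> N"
    have Nm: "N = k *\<^sub>R m"
      unfolding k_def N_def by (rule cross3_normal_unique) (use m abc(2) in auto)
    have md: "m \<bullet> (d - a) < 0" using m d abc(2) by auto
    have "k \<noteq> 0" using N0 Nm by auto
    then show "m = n" using m md
      by (auto simp: n_def Nm abs_mult sgn_if zero_less_mult_iff mult_less_0_iff)
  qed
  show "outward_normal M \<sigma> = (boundary_sign M \<sigma> / norm (normal_vec \<sigma>)) *\<^sub>R normal_vec \<sigma>"
    unfolding * N v(2) vN n_def by simp
  show "normal_vec \<sigma> \<noteq> 0" using N N0 by simp
  show "norm (outward_normal M \<sigma>) = 1" using * n1 by simp
  show "\<And>x y. x \<in> \<sigma> \<Longrightarrow> y \<in> \<sigma> \<Longrightarrow> outward_normal M \<sigma> \<bullet> (y - x) = 0" using * tn by simp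
  show "\<And>T d a. T \<in> tets M \<Longrightarrow> \<sigma> \<subseteq> T \<Longrightarrow> d \<in> T - \<sigma> \<Longrightarrow> a \<in> \<sigma> \<Longrightarrow> outward_normal M \<sigma> \<bullet> (d - a) < 0"
    using * neg by simp
qed

lemma tri_area_eq_normal_vec: "tri_area \<sigma> = norm (normal_vec \<sigma>) / 2"
  by (simp add: tri_area_def normal_vec_def split: prod.split)

text \<open>The two transpositions in \<open>sw\<close> generate all reorderings and preserve the
  norm of the cross product, so the chosen enumeration does not matter.\<close>

lemma tri_area_eq:
  assumes "distinct [a, b, c]"
  shows "tri_area {a, b, c} = norm (cross3 (b - a) (c - a)) / 2"
proof -
  have "card {a, b, c} = 3" using assms by auto
  then obtain x y z where xyz: "tri_vertices {a, b, c} = (x, y, z)" "{a, b, c} = {x, y, z}"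
      "distinct [x, y, z]"
    by (rule tri_verticesE)
  note perm = triangle_vertex_cases[OF xyz(2,3) assms]
  define N where "N = (\<lambda>x y z. norm (cross3 (y - x) (z - x) :: pt))"
  moreover have sw: "N x z y = N x y z" "N y x z = N x y z" for x y z
  proof -
    have "cross3 (z - x) (y - x) = - cross3 (y - x) (z - x)"
      "cross3 (x - y) (z - y) = - cross3 (y - x) (z - x)" by (simp_all add: cross3_simps)
    then show "N x z y = N x y z" "N y x z = N x y z" unfolding N_def by (metis norm_minus_cancel)+
  qed
  have "N x y z = N a b c"
    using perm by (elim insertE emptyE) (simp_all add: sw)
  then show ?thesis by (simp add: tri_area_def xyz(1) N_def)
qed

lemma tri_area_pos:
  assumes "valid_mesh M" "\<sigma> \<in> boundary_faces M"
  shows "tri_area \<sigma> > 0"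
  using outward_normal_eq(2)[OF assms] by (simp add: tri_area_eq_normal_vec)

section \<open>Cancellation along the wetted boundary\<close>

lemma mesh_faces:
  assumes "valid_mesh M"
  shows "solid M \<subseteq> boundary_faces M" "free M \<subseteq> boundary_faces M"
    "free M \<union> solid M = boundary_faces M" "free M \<inter> solid M = {}"
  using assms by (auto simp: valid_mesh_def)

lemma mesh_edge_card:
  assumes "valid_mesh M" "\<sigma> \<in> boundary_faces M" "e \<subseteq> \<sigma>" "card e = 2"
  shows "card {\<sigma>'\<in>boundary_faces M. e \<subseteq> \<sigma>'} = 2"
  using assms unfolding valid_mesh_def by blast

text \<open>Conformity of \<open>S\<close> and \<open>T\<close> places a common point in the hull of
  \<open>S \<inter> T\<close>. Affine independence of \<open>S\<close>, and then of
  \<open>T\<close>, cuts this vertex set down, first to its part in \<open>\<sigma>\<close>, then to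
  its part in \<open>\<sigma>'\<close>.\<close>

lemma faces_conforming:
  assumes M: "valid_mesh M" and s: "\<sigma> \<in> boundary_faces M" "\<sigma>' \<in> boundary_faces M"
  shows "convex hull \<sigma> \<inter> convex hull \<sigma>' \<subseteq> convex hull (\<sigma> \<inter> \<sigma>')"
proof
  obtain S T where S: "S \<in> tets M" "\<sigma> \<subseteq> S" and T: "T \<in> tets M" "\<sigma>' \<subseteq> T"
    using s boundary_face_in_tet by metis
  have ind: "\<not> affine_dependent S" "\<not> affine_dependent T"
    using M S T by (auto simp: valid_mesh_def)
  fix y assume y: "y \<in> convex hull \<sigma> \<inter> convex hull \<sigma>'"
  have "y \<in> convex hull S \<inter> convex hull T"
    using y S T hull_mono[of \<sigma> S] hull_mono[of \<sigma>' T] by blast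
  then have "y \<in> convex hull \<sigma> \<inter> convex hull (S \<inter> T)"
    using mesh_conforming[OF M S(1) T(1)] y by blast
  moreover have "\<not> affine_dependent (\<sigma> \<union> (S \<inter> T))"
    using ind(1) S(2) affine_dependent_subset[of "\<sigma> \<union> (S \<inter> T)" S] by blast
  ultimately have y2: "y \<in> convex hull (\<sigma> \<inter> (S \<inter> T))"
    using convex_hull_Int_subset by blast
  moreover have "\<not> affine_dependent ((\<sigma> \<inter> (S \<inter> T)) \<union> \<sigma>')"
    using ind(2) T(2) affine_dependent_subset[of "(\<sigma> \<inter> (S \<inter> T)) \<union> \<sigma>'" T] by blast
  ultimately have "y \<in> convex hull ((\<sigma> \<inter> (S \<inter> T)) \<inter> \<sigma>')"
    using y y2 convex_hull_Int_subset by blast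
  then show "y \<in> convex hull (\<sigma> \<inter> \<sigma>')"
    using hull_mono[of "(\<sigma> \<inter> (S \<inter> T)) \<inter> \<sigma>'" "\<sigma> \<inter> \<sigma>'"] by blast
qed

text \<open>Boundary edges of a wetted triangle, directed such that the triangle is run through
  counterclockwise when seen from outside the fluid.\<close>

definition directed_edges :: "pt \<Rightarrow> pt set \<Rightarrow> (pt \<times> pt) set" where
  "directed_edges n \<sigma> = {(a, b). \<exists>c. \<sigma> = {a, b, c} \<and> distinct [a, b, c] \<and> n \<bullet> cross3 (b - a) (c - a)
      > 0}"

lemma cross3_dot_rotate: "cross3 u n \<bullet> v = - (n \<bullet> cross3 u v)"
  by (simp add: cross3_simps)

lemma directed_edges_triangle:
  assumes "distinct [a, b, c]" "n \<bullet> cross3 (b - a) (c - a) > 0"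
  shows "directed_edges n {a, b, c} = {(a, b), (b, c), (c, a)}"
proof -
  define P where "P = (\<lambda>a b c. n \<bullet> cross3 (b - a) (c - a))"
  have pos: "P a b c > 0" using assms(2) by (simp add: P_def)
  have rot: "P b c a = P a b c" "P c a b = P a b c" "P c b a = - P a b c"
     "P a c b = - P a b c" "P b a c = - P a b c" by (simp_all add: P_def cross3_simps)
  have "(x, y) \<in> directed_edges n {a, b, c} \<longleftrightarrow> (x, y) \<in> {(a, b), (b, c), (c, a)}" for x y
  proof
    assume "(x, y) \<in> directed_edges n {a, b, c}"
    then obtain z where z: "{a, b, c} = {x, y, z}" "distinct [x, y, z]" "P x y z > 0"
      by (auto simp: directed_edges_def P_def)
    show "(x, y) \<in> {(a, b), (b, c), (c, a)}"
      using triangle_vertex_cases[OF z(1,2) assms(1)] z(3) pos by (elim insertE emptyE) (simp_all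
          add: rot)
  next
    assume "(x, y) \<in> {(a, b), (b, c), (c, a)}"
    then obtain z where "(x, y, z) \<in> {(a, b, c), (b, c, a), (c, a, b)}" by blast
    then show "(x, y) \<in> directed_edges n {a, b, c}"
      unfolding directed_edges_def mem_Collect_eq prod.case
      using assms(1) pos rot(1,2) by (intro exI[of _ z]) (auto simp: P_def)
  qed
  then show ?thesis unfolding set_eq_iff split_paired_All by blast
qed

lemma solid_triangleE:
  assumes M: "valid_mesh M" and n: "norm n = 1" and fl: "flat_substrate n k M" and s: "\<sigma> \<in> solid M"
  obtains a b c where "\<sigma> = {a, b, c}" "distinct [a, b, c]" "n \<bullet> cross3 (b - a) (c - a) > 0"
    "cross3 (b - a) (c - a) = (n \<bullet> cross3 (b - a) (c - a)) *\<^sub>R n"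
proof -
  have sb: "\<sigma> \<in> boundary_faces M" using mesh_faces(1)[OF M] s by blast
  obtain a b c d where abc: "tri_vertices \<sigma> = (a, b, c)" "\<sigma> = {a, b, c}" "distinct [a, b, c]"
    and d: "d \<notin> \<sigma>" "insert d \<sigma> \<in> tets M" "{T \<in> tets M. \<sigma> \<subseteq> T} = {insert d \<sigma>}"
    and v: "vol4 a b c d \<noteq> 0" "boundary_sign M \<sigma> = - sgn (vol4 a b c d)"
    by (rule boundary_faceE[OF M sb])
  have flat: "n \<bullet> a = k" "n \<bullet> b = k" "n \<bullet> c = k"
    using fl s abc(2) by (auto simp: flat_substrate_def)
  have par: "cross3 (y - x) (z - x) = (n \<bullet> cross3 (y - x) (z - x)) *\<^sub>R n"
    if "n \<bullet> x = k" "n \<bullet> y = k" "n \<bullet> z = k" for x y z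
    by (rule cross3_normal_unique) (use that n in \<open>auto simp: inner_diff_right\<close>)
  have "cross3 (b - a) (c - a) \<noteq> 0" using v(1) by (auto simp: vol4_def)
  then have nz: "n \<bullet> cross3 (b - a) (c - a) \<noteq> 0" using par[OF flat] by auto
  show thesis
  proof (cases "n \<bullet> cross3 (b - a) (c - a) > 0")
    case True
    then show thesis using that[OF abc(2,3)] par[OF flat] by simp
  next
    case False
    moreover have "n \<bullet> cross3 (c - a) (b - a) = - (n \<bullet> cross3 (b - a) (c - a))"
      by (simp add: cross3_simps)
    ultimately have "n \<bullet> cross3 (c - a) (b - a) > 0" using nz by linarith
    moreover have "\<sigma> = {a, c, b}" "distinct [a, c, b]" using abc by auto
    ultimately show thesis using that par[OF flat(1,3,2)] by simp
  qed
qed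

text \<open>Two wetted triangles on the same side of a common edge would overlap near its midpoint,
  against conformity. This is the planar version of the argument for tetrahedra.\<close>

lemma solid_third_vertex:
  assumes M: "valid_mesh M" and n: "norm n = 1" and fl: "flat_substrate n k M"
    and s: "{p, q, c} \<in> solid M" "{p, q, c'} \<in> solid M" and d: "distinct [p, q, c]" "distinct [p, q, c']"
    and pos: "n \<bullet> cross3 (q - p) (c - p) > 0" "n \<bullet> cross3 (q - p) (c' - p) > 0"
  shows "c = c'"
proof (rule ccontr)
  assume ne: "c \<noteq> c'"
  have flat: "n \<bullet> p = k" "n \<bullet> q = k" "n \<bullet> c = k" "n \<bullet> c' = k"
    using fl s by (auto simp: flat_substrate_def)
  have sb: "{p, q, c} \<in> boundary_faces M" "{p, q, c'} \<in> boundary_faces M"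
    using mesh_faces(1)[OF M] s by blast+
  have inter: "{p, q, c} \<inter> {p, q, c'} = {p, q}" using d ne by auto
  define \<alpha> where "\<alpha> = n \<bullet> cross3 (q - p) (c - p)"
  define \<alpha>' where "\<alpha>' = n \<bullet> cross3 (q - p) (c' - p)"
  define r where "r = \<alpha> / \<alpha>'"
  have r: "r > 0" using pos by (simp add: r_def \<alpha>_def \<alpha>'_def)
  \<comment> \<open>\<open>p + n\<close> is an artificial fourth point that makes the spatial
    coordinates available for \<open>c\<close>. The coefficient of \<open>n\<close> vanishes below
    because all vertices lie in the plane of the substrate.\<close>
  have tv: "vol4 p q c' (p + n) = \<alpha>'" "vol4 p q (p + n) c = - \<alpha>"
    by (simp_all add: vol4_def \<alpha>'_def \<alpha>_def cross3_simps)
  obtain x y where co: "c = p + x *\<^sub>R (q - p) + y *\<^sub>R (c' - p) + (vol4 p q c' c / \<alpha>') *\<^sub>R ((p + n) - p)"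
    using vol4_coordinates[of p q c' "p + n" c] tv pos(2) unfolding \<alpha>'_def[symmetric] by (metis
        less_irrefl)
  have "vol4 p q c' c = 0"
  proof -
    have "cross3 (q - p) (c' - p) = \<alpha>' *\<^sub>R n" unfolding \<alpha>'_def
      by (rule cross3_normal_unique) (use flat n in \<open>auto simp: inner_diff_right\<close>)
    then show ?thesis using flat by (simp add: vol4_def inner_diff_right)
  qed
  then have co: "c - p = x *\<^sub>R (q - p) + y *\<^sub>R (c' - p)" using co by simp
  have "\<alpha> = y * \<alpha>'" unfolding \<alpha>_def \<alpha>'_def co
    by (simp add: cross_add_right cross_mult_right)
  then have y: "y = r" using pos(2) by (simp add: r_def \<alpha>'_def)
  \<comment> \<open>The point \<open>z\<close> below lies on the segment from the midpoint of the
    edge to \<open>c\<close>. With this \<open>h\<close> its coordinates along the edge and towards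
    \<open>c'\<close> differ from those of the midpoint by at most 1/4 in total, so \<open>z\<close>
    also belongs to the other triangle.\<close>
  define h where "h = 1 / (4 * (1 + \<bar>x\<bar> + r))"
  have h: "h > 0" using r by (simp add: h_def add_pos_pos add_nonneg_pos)
  have hb: "h * (1 + \<bar>x\<bar> + r) = 1/4" using r by (simp add: h_def field_simps)
  have hx: "h + \<bar>h * x\<bar> + h * r = 1/4" using hb h by (simp add: abs_mult algebra_simps)
  have hr: "h * r > 0" using h r by simp
  define z where "z = p + ((1 - h)/2) *\<^sub>R (q - p) + h *\<^sub>R (c - p)"
  have hle: "h \<le> 1" and ax: "- (1/4) \<le> h * x" "h * x + h + h * r \<le> 1/4" using hx hr h by linarith+
  have "z \<in> convex hull {p, q, c}" unfolding z_def
    using h hle by (intro convex_combination_3) (auto simp: field_simps)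
  moreover have "z = p + ((1 - h)/2 + h * x) *\<^sub>R (q - p) + (h * r) *\<^sub>R (c' - p)"
    unfolding z_def co y by (simp add: scaleR_add_left scaleR_add_right)
  moreover have "p + ((1 - h)/2 + h * x) *\<^sub>R (q - p) + (h * r) *\<^sub>R (c' - p) \<in> convex hull {p, q, c'}"
  proof (rule convex_combination_3)
    have "h \<le> 1/4" using hx hr by linarith
    then show "0 \<le> (1 - h)/2 + h * x" using ax(1) by (simp add: field_simps)
    show "(1 - h)/2 + h * x + h * r \<le> 1" using ax(2) h by (simp add: field_simps)
  qed (use hr in simp)
  ultimately have "z \<in> convex hull {p, q}"
    using faces_conforming[OF M sb] inter by auto
  then obtain u where "z = p + u *\<^sub>R (q - p)"
    by (auto simp: segment_convex_hull[symmetric] closed_segment_def algebra_simps)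
  then have "n \<bullet> cross3 (q - p) (z - p) = 0" by (simp add: cross_mult_right)
  moreover have "n \<bullet> cross3 (q - p) (z - p) = h * \<alpha>"
    unfolding z_def \<alpha>_def by (simp add: cross_add_right cross_mult_right)
  ultimately show False using h pos by (simp add: \<alpha>_def)
qed

text \<open>By a cyclic shift of the triple product, the conormal condition on a directed contact
  edge is the orientation condition on an edge of a wetted triangle.\<close>

lemma directed_contact_iff:
  assumes M: "valid_mesh M"
  shows "(a, b) \<in> directed_contact n M \<longleftrightarrow>
    {a, b} \<in> contact_edges M \<and> (\<exists>\<sigma>\<in>solid M. (a, b) \<in> directed_edges n \<sigma>)"
proof
  assume "(a, b) \<in> directed_contact n M"
  then obtain c where c: "{a, b} \<in> contact_edges M" "c \<notin> {a, b}" "{a, b, c} \<in> solid M"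
     "cross3 (b - a) n \<bullet> (c - a) < 0"
    by (auto simp: directed_contact_def)
  have "a \<noteq> b" using c(1) by (auto simp: contact_edges_def)
  then have "(a, b) \<in> directed_edges n {a, b, c}"
    using c by (auto simp: directed_edges_def cross3_dot_rotate)
  then show "{a, b} \<in> contact_edges M \<and> (\<exists>\<sigma>\<in>solid M. (a, b) \<in> directed_edges n \<sigma>)"
    using c by blast
next
  assume "{a, b} \<in> contact_edges M \<and> (\<exists>\<sigma>\<in>solid M. (a, b) \<in> directed_edges n \<sigma>)"
  then obtain c where "{a, b} \<in> contact_edges M" "{a, b, c} \<in> solid M" "distinct [a, b, c]"
    "n \<bullet> cross3 (b - a) (c - a) > 0"
    by (auto simp: directed_edges_def)
  then show "(a, b) \<in> directed_contact n M"
    unfolding directed_contact_def by (auto simp: cross3_dot_rotate intro!: exI[of _ c])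
qed

text \<open>Exactly two boundary faces meet at the edge. The second one is not free, otherwise the
  edge would be a contact edge. Being wetted, it cannot run through the edge in the same direction,
  since both triangles would then lie on the same side of it.\<close>

lemma directed_edges_reverse:
  assumes M: "valid_mesh M" and n: "norm n = 1" and fl: "flat_substrate n k M"
    and s: "\<sigma> \<in> solid M" "(a, b) \<in> directed_edges n \<sigma>" and nc: "{a, b} \<notin> contact_edges M"
  shows "\<exists>\<sigma>'\<in>solid M. (b, a) \<in> directed_edges n \<sigma>'"
proof -
  obtain c where c: "\<sigma> = {a, b, c}" "distinct [a, b, c]" "n \<bullet> cross3 (b - a) (c - a) > 0"
    using s(2) by (auto simp: directed_edges_def)
  have sb: "\<sigma> \<in> boundary_faces M" using mesh_faces(1)[OF M] s by blast
  have ab: "card {a, b} = 2" "{a, b} \<subseteq> \<sigma>" using c by auto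
  have "card {\<sigma>'\<in>boundary_faces M. {a, b} \<subseteq> \<sigma>'} = 2"
    by (rule mesh_edge_card[OF M sb ab(2,1)])
  then have "{\<sigma>'\<in>boundary_faces M. {a, b} \<subseteq> \<sigma>'} \<noteq> {\<sigma>}" by (intro notI) simp
  then obtain \<sigma>' where s': "\<sigma>' \<in> boundary_faces M" "{a, b} \<subseteq> \<sigma>'" "\<sigma>' \<noteq> \<sigma>" using sb ab by blast
  have "\<sigma>' \<notin> free M" using nc s(1) ab s'(2) unfolding contact_edges_def by blast
  then have ss: "\<sigma>' \<in> solid M" using s'(1) mesh_faces(3)[OF M] by blast
  obtain x y z where xyz: "\<sigma>' = {x, y, z}" "distinct [x, y, z]" "n \<bullet> cross3 (y - x) (z - x) > 0"
    by (rule solid_triangleE[OF M n fl ss])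
  have de: "directed_edges n \<sigma>' = {(x, y), (y, z), (z, x)}"
    unfolding xyz(1) by (rule directed_edges_triangle[OF xyz(2,3)])
  have "a \<in> {x, y, z}" "b \<in> {x, y, z}" "a \<noteq> b" using s'(2) xyz(1) c(2) by auto
  then have "(b, a) \<in> directed_edges n \<sigma>' \<or> (a, b) \<in> directed_edges n \<sigma>'" unfolding de by auto
  moreover have "(a, b) \<notin> directed_edges n \<sigma>'"
  proof
    assume "(a, b) \<in> directed_edges n \<sigma>'"
    then obtain c' where c': "\<sigma>' = {a, b, c'}" "distinct [a, b, c']" "n \<bullet> cross3 (b - a) (c' - a) > 0"
      by (auto simp: directed_edges_def)
    have "c = c'"
      using s(1) ss by (intro solid_third_vertex[OF M n fl _ _ c(2) c'(2) c(3) c'(3)]) (simp_all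
          add: c(1) c'(1))
    then show False using s'(3) c(1) c'(1) by simp
  qed
  ultimately show ?thesis using ss by blast
qed

lemma finite_solid: "valid_mesh M \<Longrightarrow> finite (solid M)"
  using finite_boundary_faces mesh_faces(1) finite_subset by metis

lemma finite_free: "valid_mesh M \<Longrightarrow> finite (free M)"
  using finite_boundary_faces mesh_faces(2) finite_subset by metis

text \<open>Interior edges of the wetted boundary are run through in both directions and cancel.\<close>

lemma sum_directed_edges:
  fixes f :: "pt \<Rightarrow> pt \<Rightarrow> real"
  assumes M: "valid_mesh M" and n: "norm n = 1" and fl: "flat_substrate n k M"
    and anti: "\<And>a b. f b a = - f a b"
  shows "(\<Sum>\<sigma>\<in>solid M. \<Sum>(a, b)\<in>directed_edges n \<sigma>. f a b) = (\<Sum>(a, b)\<in>directed_contact n M. f a b)"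
    and "finite (directed_contact n M)"
proof -
  let ?A = "\<Union>\<sigma>\<in>solid M. directed_edges n \<sigma>"
  have fin1: "finite (directed_edges n \<sigma>)" if sol: "\<sigma> \<in> solid M" for \<sigma>
  proof -
    obtain x y z where xyz: "\<sigma> = {x, y, z}" "distinct [x, y, z]" "n \<bullet> cross3 (y - x) (z - x) > 0"
      by (rule solid_triangleE[OF M n fl sol])
    show ?thesis unfolding xyz(1) directed_edges_triangle[OF xyz(2,3)] by simp
  qed
  have fin: "finite ?A" using fin1 finite_solid[OF M] by auto
  have sub: "directed_contact n M \<subseteq> ?A" using directed_contact_iff[OF M] by auto
  show "finite (directed_contact n M)" using fin sub by (rule rev_finite_subset)
  \<comment> \<open>A directed edge determines its triangle, since the third vertex on the given
    side is unique. So the double sum is a sum over the union of the edge sets.\<close>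
  have disj: "directed_edges n \<sigma> \<inter> directed_edges n \<sigma>' = {}"
    if "\<sigma> \<in> solid M" "\<sigma>' \<in> solid M" "\<sigma> \<noteq> \<sigma>'" for \<sigma> \<sigma>'
  proof (rule ccontr)
    assume "directed_edges n \<sigma> \<inter> directed_edges n \<sigma>' \<noteq> {}"
    then obtain a b where "(a, b) \<in> directed_edges n \<sigma>" "(a, b) \<in> directed_edges n \<sigma>'" by auto
    then obtain c c' where c: "\<sigma> = {a, b, c}" "distinct [a, b, c]" "n \<bullet> cross3 (b - a) (c - a) > 0"
      and c': "\<sigma>' = {a, b, c'}" "distinct [a, b, c']" "n \<bullet> cross3 (b - a) (c' - a) > 0"
      by (auto simp: directed_edges_def)
    have "c = c'"
      using that by (intro solid_third_vertex[OF M n fl _ _ c(2) c'(2) c(3) c'(3)]) (simp_all add: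
          c(1) c'(1))
    then show False using that c(1) c'(1) by simp
  qed
  have "(\<Sum>\<sigma>\<in>solid M. \<Sum>(a, b)\<in>directed_edges n \<sigma>. f a b) = (\<Sum>(a, b)\<in>?A. f a b)"
    using fin1 disj by (intro sum.UNION_disjoint[symmetric] finite_solid[OF M]) auto
  also have "\<dots> = (\<Sum>(a, b)\<in>directed_contact n M. f a b) + (\<Sum>(a, b)\<in>?A - directed_contact n M. f a b)"
    using sum.subset_diff[OF sub fin, of "\<lambda>(a, b). f a b"] by simp
  also have "(\<Sum>(a, b)\<in>?A - directed_contact n M. f a b) = 0"
  proof -
    define B where "B = ?A - directed_contact n M"
    have sw: "(b, a) \<in> B" if ab: "(a, b) \<in> B" for a b
    proof -
      obtain \<sigma> where s: "\<sigma> \<in> solid M" "(a, b) \<in> directed_edges n \<sigma>" using ab unfolding B_def by blast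
      have nc: "{a, b} \<notin> contact_edges M" using ab s directed_contact_iff[OF M] unfolding B_def by blast
      have "(b, a) \<notin> directed_contact n M"
        using nc unfolding directed_contact_iff[OF M] by (simp add: insert_commute)
      then show ?thesis using directed_edges_reverse[OF M n fl s nc] unfolding B_def by blast
    qed
    then have sweq: "(b, a) \<in> B \<longleftrightarrow> (a, b) \<in> B" for a b by blast
    have "(\<Sum>(a, b)\<in>B. f a b) = (\<Sum>(a, b)\<in>B. f b a)"
      by (rule sum.reindex_bij_witness[of _ prod.swap prod.swap]) (auto simp: sweq)
    also have "\<dots> = (\<Sum>(a, b)\<in>B. - f a b)"
      by (intro sum.cong refl) (clarify, rule anti)
    also have "\<dots> = - (\<Sum>(a, b)\<in>B. f a b)"
      by (simp add: split_def sum_negf)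
    finally have "(\<Sum>(a, b)\<in>B. f a b) = 0" by linarith
    then show ?thesis by (simp add: B_def)
  qed
  finally show "(\<Sum>\<sigma>\<in>solid M. \<Sum>(a, b)\<in>directed_edges n \<sigma>. f a b) = (\<Sum>(a, b)\<in>directed_contact n M. f a b)"
    by simp
qed

section \<open>Moving tetrahedra\<close>

text \<open>This is the cofactor identity for the transposed matrix acting on the cross product of
  two images, paired with \<open>z\<close>.\<close>

lemma triple_product_linear:
  fixes f :: "pt \<Rightarrow> pt"
  assumes "linear f"
  shows "cross3 (f x) (f y) \<bullet> f z = det (matrix f) * (cross3 x y \<bullet> z)"
proof -
  define A where "A = matrix f"
  have f: "f v = A *v v" for v unfolding A_def using assms by (simp add: matrix_vector_mul(1))
  have "cross3 (f x) (f y) \<bullet> f z = (transpose A *v cross3 (A *v x) (A *v y)) \<bullet> z"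
    unfolding f transpose_matrix_vector by (simp only: dot_lmul_matrix)
  then show ?thesis by (simp only: cross_matrix_mult A_def[symmetric]) simp
qed

lemma P1_affineE:
  assumes "f \<in> P1 C" "V \<in> C"
  obtains c L where "linear L" "\<And>x. x \<in> convex hull V \<Longrightarrow> f x = c + L x"
  using assms by (auto simp: P1_def)

text \<open>The flux of the field with affine factors \<open>e \<bullet> x\<close> and velocity through a triangle; the weights are
  the integrals of products of two barycentric coordinates over the reference triangle.\<close>

definition tri_flux :: "pt \<Rightarrow> pt \<Rightarrow> pt \<Rightarrow> pt \<Rightarrow> pt \<Rightarrow> pt \<Rightarrow> pt \<Rightarrow> real" where
  "tri_flux e a b c u v w = cross3 (b - a) (c - a) \<bullet>
     ((e \<bullet> a + e \<bullet> b + e \<bullet> c) *\<^sub>R (u + v + w) + (e \<bullet> a) *\<^sub>R u + (e \<bullet> b) *\<^sub>R v + (e \<bullet> c) *\<^sub>R w) / 24"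

lemma tri_flux_swap:
  "tri_flux e b a c v u w = - tri_flux e a b c u v w"
  "tri_flux e a c b u w v = - tri_flux e a b c u v w"
proof -
  have "cross3 (a - b) (c - b) = - cross3 (b - a) (c - a)"
    "cross3 (c - a) (b - a) = - cross3 (b - a) (c - a)" by (simp_all add: cross3_simps)
  then show "tri_flux e b a c v u w = - tri_flux e a b c u v w"
    "tri_flux e a c b u w v = - tri_flux e a b c u v w"
    by (simp_all add: tri_flux_def algebra_simps)
qed

lemma bounded_bilinear_cross3: "bounded_bilinear cross3"
  using bilinear_cross bilinear_conv_bounded_bilinear by blast

text \<open>The derivative of the moment of a tetrahedron with moving vertices is the flux through its
  four faces.\<close>

lemma tet_moment_derivative:
  fixes e a b c d u v w r :: pt
  defines "A \<equiv> \<lambda>\<theta>. a + \<theta> *\<^sub>R u" and "B \<equiv> \<lambda>\<theta>. b + \<theta> *\<^sub>R v" and "C \<equiv> \<lambda>\<theta>. c + \<theta> *\<^sub>R w"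
    and "E \<equiv> \<lambda>\<theta>. d + \<theta> *\<^sub>R r"
  shows "((\<lambda>\<theta>. vol4 (A \<theta>) (B \<theta>) (C \<theta>) (E \<theta>) *
      (e \<bullet> A \<theta> + e \<bullet> B \<theta> + e \<bullet> C \<theta> + e \<bullet> E \<theta>) / 24) has_real_derivative
     (tri_flux e (B \<theta>) (C \<theta>) (E \<theta>) v w r - tri_flux e (A \<theta>) (C \<theta>) (E \<theta>) u w r
      + tri_flux e (A \<theta>) (B \<theta>) (E \<theta>) u v r - tri_flux e (A \<theta>) (B \<theta>) (C \<theta>) u v w)) (at \<theta>)"
proof -
  define P where "P = B \<theta> - A \<theta>"
  define Q where "Q = C \<theta> - A \<theta>"
  define R where "R = E \<theta> - A \<theta>"
  have dA: "(A has_vector_derivative u) (at \<theta>)" and dB: "(B has_vector_derivative v) (at \<theta>)"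
    and dC: "(C has_vector_derivative w) (at \<theta>)" and dE: "(E has_vector_derivative r) (at \<theta>)"
    unfolding A_def B_def C_def E_def by (auto intro!: derivative_eq_intros)
  have dX: "((\<lambda>\<theta>. cross3 (B \<theta> - A \<theta>) (C \<theta> - A \<theta>)) has_vector_derivative
      (cross3 P (w - u) + cross3 (v - u) Q)) (at \<theta>)"
    unfolding P_def Q_def
    by (rule bounded_bilinear.has_vector_derivative[OF bounded_bilinear_cross3])
       (intro has_vector_derivative_diff dA dB dC)+
  have dV: "((\<lambda>\<theta>. vol4 (A \<theta>) (B \<theta>) (C \<theta>) (E \<theta>)) has_vector_derivative
      (cross3 P Q \<bullet> (r - u) + (cross3 P (w - u) + cross3 (v - u) Q) \<bullet> R)) (at \<theta>)"
    unfolding vol4_def P_def Q_def R_def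
    by (rule bounded_bilinear.has_vector_derivative[OF bounded_bilinear_inner])
       (use dX in \<open>auto intro!: has_vector_derivative_diff dA dE simp: P_def Q_def\<close>)
  have dz: "((\<lambda>\<theta>. e \<bullet> Y \<theta>) has_vector_derivative e \<bullet> y) (at \<theta>)"
    if "(Y has_vector_derivative y) (at \<theta>)" for Y y
    by (rule bounded_linear.has_vector_derivative[OF bounded_linear_inner_right that])
  have dS: "((\<lambda>\<theta>. e \<bullet> A \<theta> + e \<bullet> B \<theta> + e \<bullet> C \<theta> + e \<bullet> E \<theta>) has_vector_derivative
      (e \<bullet> u + e \<bullet> v + e \<bullet> w + e \<bullet> r)) (at \<theta>)"
    by (intro has_vector_derivative_add dz dA dB dC dE)
  have "((\<lambda>\<theta>. vol4 (A \<theta>) (B \<theta>) (C \<theta>) (E \<theta>) * (e \<bullet> A \<theta> + e \<bullet> B \<theta> + e \<bullet> C \<theta> + e \<bullet> E \<theta>) / 24)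
     has_real_derivative
      (vol4 (A \<theta>) (B \<theta>) (C \<theta>) (E \<theta>) * (e \<bullet> u + e \<bullet> v + e \<bullet> w + e \<bullet> r) +
       (cross3 P Q \<bullet> (r - u) + (cross3 P (w - u) + cross3 (v - u) Q) \<bullet> R) *
          (e \<bullet> A \<theta> + e \<bullet> B \<theta> + e \<bullet> C \<theta> + e \<bullet> E \<theta>)) / 24) (at \<theta>)"
    using has_vector_derivative_mult[OF dV dS]
    by (intro DERIV_cdivide) (simp add: has_real_derivative_iff_has_vector_derivative)
  moreover have "(vol4 (A \<theta>) (B \<theta>) (C \<theta>) (E \<theta>) * (e \<bullet> u + e \<bullet> v + e \<bullet> w + e \<bullet> r) +
       (cross3 P Q \<bullet> (r - u) + (cross3 P (w - u) + cross3 (v - u) Q) \<bullet> R) *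
          (e \<bullet> A \<theta> + e \<bullet> B \<theta> + e \<bullet> C \<theta> + e \<bullet> E \<theta>)) / 24 =
     tri_flux e (B \<theta>) (C \<theta>) (E \<theta>) v w r - tri_flux e (A \<theta>) (C \<theta>) (E \<theta>) u w r
      + tri_flux e (A \<theta>) (B \<theta>) (E \<theta>) u v r - tri_flux e (A \<theta>) (B \<theta>) (C \<theta>) u v w"
  proof -
    \<comment> \<open>Cramer's rule paired with \<open>e\<close>. It distributes the terms in which
      the derivative falls on a factor \<open>e \<bullet> x\<close>, all multiplied by the volume,
      over the normals of the faces.\<close>
    have cr: "cross3 P Q \<bullet> R * (e \<bullet> y) =
        (cross3 Q R \<bullet> y) * (e \<bullet> P) + (cross3 R P \<bullet> y) * (e \<bullet> Q) + (cross3 P Q \<bullet> y) * (e \<bullet> R)" for y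
      using arg_cong[OF cross3_cramer[of P Q R y], of "\<lambda>t. e \<bullet> t"]
      by (simp add: inner_add_right inner_commute)
    have V: "vol4 (A \<theta>) (B \<theta>) (C \<theta>) (E \<theta>) = cross3 P Q \<bullet> R"
      by (simp add: vol4_def P_def Q_def R_def)
    have z: "e \<bullet> B \<theta> = e \<bullet> A \<theta> + e \<bullet> P" "e \<bullet> C \<theta> = e \<bullet> A \<theta> + e \<bullet> Q" "e \<bullet> E \<theta> = e \<bullet> A \<theta> + e \<bullet> R"
      by (simp_all add: P_def Q_def R_def inner_diff_right)
    have N: "cross3 (C \<theta> - B \<theta>) (E \<theta> - B \<theta>) = cross3 Q R + cross3 R P + cross3 P Q"
      "cross3 (C \<theta> - A \<theta>) (E \<theta> - A \<theta>) = cross3 Q R"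
      "cross3 (B \<theta> - A \<theta>) (E \<theta> - A \<theta>) = - cross3 R P"
      "cross3 (B \<theta> - A \<theta>) (C \<theta> - A \<theta>) = cross3 P Q"
      by (simp_all add: P_def Q_def R_def cross3_simps)
    have t: "(cross3 P (w - u) + cross3 (v - u) Q) \<bullet> R = cross3 R P \<bullet> (w - u) + cross3 Q R \<bullet> (v - u)"
      by (simp add: cross3_simps)
    show ?thesis
      unfolding tri_flux_def N z t V diff_divide_distrib[symmetric] add_divide_distrib[symmetric]
      apply (rule arg_cong[where f = "\<lambda>t. t / 24"])
      unfolding inner_add_right inner_diff_right inner_add_left inner_scaleR_right inner_minus_left
      by (simp only: distrib_left[of "cross3 P Q \<bullet> R"] cr) (simp add: algebra_simps)
  qed
  ultimately show ?thesis by simp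
qed

text \<open>Both factors change sign when two vertices of the face are exchanged, so the product can
  be computed in the given order instead of the chosen one. The minus sign appears because the
  outward side is the one away from \<open>d\<close>.\<close>

lemma face_sign_mult:
  fixes f :: "pt \<Rightarrow> pt \<Rightarrow> pt \<Rightarrow> real"
  assumes "distinct [a, b, c, d]" and f: "\<And>a b c. f b a c = - f a b c" "\<And>a b c. f a c b = - f a b c"
  shows "face_sign {a, b, c} {a, b, c, d} * (case tri_vertices {a, b, c} of (x, y, z) \<Rightarrow> f x y z)
    = - sgn (vol4 a b c d) * f a b c"
proof -
  have "card {a, b, c} = 3" using assms(1) by auto
  then obtain x y z where xyz: "tri_vertices {a, b, c} = (x, y, z)" "{a, b, c} = {x, y, z}"
      "distinct [x, y, z]"
    by (rule tri_verticesE)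
  have "{a, b, c, d} - {a, b, c} = {d}" using assms(1) by auto
  then have E: "the_elem ({a, b, c, d} - {a, b, c}) = d" by simp
  have "distinct [a, b, c]" using assms(1) by simp
  note perm = triangle_vertex_cases[OF xyz(2,3) this]
  have rot: "f b c a = f a b c" "f c a b = f a b c" "f c b a = - f a b c"
    "f a c b = - f a b c" "f b a c = - f a b c"
    using f(1)[of b a c] f(1)[of c a b] f(1)[of c b a] f(2)[of a b c] f(2)[of b a c] f(2)[of c a b]
        f(2)[of b c a] 
    by linarith+
  have vol: "vol4 b c a d = vol4 a b c d" "vol4 c a b d = vol4 a b c d" "vol4 c b a d = - vol4 a b c d"
    "vol4 a c b d = - vol4 a b c d" "vol4 b a c d = - vol4 a b c d"
    by (rule vol4_perm_face vol4_swap)+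
  have "sgn (vol4 x y z d) * f x y z = sgn (vol4 a b c d) * f a b c"
    using perm by (elim insertE emptyE)
      (simp_all add: rot vol sgn_minus)
  then show ?thesis unfolding face_sign_def E xyz(1) prod.case by simp
qed

lemma tet_faces_eq:
  assumes "distinct [a, b, c, d]"
  shows "tet_faces {a, b, c, d} = {{b, c, d}, {a, c, d}, {a, b, d}, {a, b, c}}"
proof
  have removals: "{a, b, c, d} - {a} = {b, c, d}" "{a, b, c, d} - {b} = {a, c, d}"
    "{a, b, c, d} - {c} = {a, b, d}" "{a, b, c, d} - {d} = {a, b, c}" using assms by auto
  show "tet_faces {a, b, c, d} \<subseteq> {{b, c, d}, {a, c, d}, {a, b, d}, {a, b, c}}"
  proof
    fix \<sigma> assume "\<sigma> \<in> tet_faces {a, b, c, d}"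
    then have s: "\<sigma> \<subseteq> {a, b, c, d}" "card \<sigma> = 3" by (auto simp: tet_faces_def)
    have "card {a, b, c, d} = 4" using assms by auto
    then obtain x where x: "{a, b, c, d} = insert x \<sigma>" "x \<notin> \<sigma>"
      using opposite_vertexE[OF s(2,1)] by metis
    then have "\<sigma> = {a, b, c, d} - {x}" "x \<in> {a, b, c, d}" by auto
    then show "\<sigma> \<in> {{b, c, d}, {a, c, d}, {a, b, d}, {a, b, c}}"
      by (elim insertE emptyE) (simp_all only: removals insert_iff simp_thms)
  qed
  show "{{b, c, d}, {a, c, d}, {a, b, d}, {a, b, c}} \<subseteq> tet_faces {a, b, c, d}"
    using assms by (simp add: tet_faces_def subset_insertI insert_commute)
qed

text \<open>The signs are those of the oriented boundary of the simplex; the factor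
  \<open>sgn (vol4 a b c d)\<close> converts the order of the vertices into the outward
  orientation.\<close>

lemma sum_tet_faces:
  fixes f :: "pt \<Rightarrow> pt \<Rightarrow> pt \<Rightarrow> real"
  assumes d: "distinct [a, b, c, d]" and f: "\<And>a b c. f b a c = - f a b c" "\<And>a b c. f a c b = - f a b c"
  shows "(\<Sum>\<sigma>\<in>tet_faces {a, b, c, d}. face_sign \<sigma> {a, b, c, d} *
      (case tri_vertices \<sigma> of (x, y, z) \<Rightarrow> f x y z))
    = sgn (vol4 a b c d) * (f b c d - f a c d + f a b d - f a b c)"
proof -
  let ?g = "\<lambda>\<sigma>. face_sign \<sigma> {a, b, c, d} * (case tri_vertices \<sigma> of (x, y, z) \<Rightarrow> f x y z)"
  have ne: "{b, c, d} \<noteq> {a, c, d}" "{b, c, d} \<noteq> {a, b, d}" "{b, c, d} \<noteq> {a, b, c}"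
    "{a, c, d} \<noteq> {a, b, d}" "{a, c, d} \<noteq> {a, b, c}" "{a, b, d} \<noteq> {a, b, c}"
    using d by (auto simp: set_eq_iff)
  have "(\<Sum>\<sigma>\<in>tet_faces {a, b, c, d}. ?g \<sigma>) = ?g {b, c, d} + ?g {a, c, d} + ?g {a, b, d} + ?g {a, b, c}"
    unfolding tet_faces_eq[OF d] using ne by simp
  moreover have "?g {a, b, c} = - sgn (vol4 a b c d) * f a b c"
    by (rule face_sign_mult[OF d f])
  moreover have "?g {b, c, d} = sgn (vol4 a b c d) * f b c d"
  proof -
    have dd: "distinct [b, c, d, a]" using d by auto
    have "vol4 b c d a = - vol4 a b c d" by (simp add: vol4_def cross3_simps)
    moreover have "{a, b, c, d} = {b, c, d, a}" by auto
    ultimately show ?thesis using face_sign_mult[of b c d a f, OF dd f] by (simp add: sgn_minus)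
  qed
  moreover have "?g {a, c, d} = - sgn (vol4 a b c d) * f a c d"
  proof -
    have dd: "distinct [a, c, d, b]" using d by auto
    have "vol4 a c d b = vol4 a b c d" by (simp add: vol4_def cross3_simps)
    moreover have "{a, b, c, d} = {a, c, d, b}" by auto
    ultimately show ?thesis using face_sign_mult[of a c d b f, OF dd f] by simp
  qed
  moreover have "?g {a, b, d} = sgn (vol4 a b c d) * f a b d"
  proof -
    have dd: "distinct [a, b, d, c]" using d by auto
    have "vol4 a b d c = - vol4 a b c d" by (rule vol4_swap)
    moreover have "{a, b, c, d} = {a, b, d, c}" by auto
    ultimately show ?thesis using face_sign_mult[of a b d c f, OF dd f] by (simp add: sgn_minus)
  qed
  ultimately show ?thesis by (simp add: algebra_simps)
qed

lemma linear_id_plus: "linear L \<Longrightarrow> linear (\<lambda>v. v + t *\<^sub>R L v)"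
  for L :: "pt \<Rightarrow> pt"
  by (rule linearI) (simp_all add: linear_add linear_scale scaleR_add_right)

lemma has_derivative_on_simplex:
  fixes f :: "pt \<Rightarrow> 'b::euclidean_space"
  assumes "(h has_derivative h') (at x)" "\<And>y. y \<in> convex hull V \<Longrightarrow> f y = h y" "x \<in> interior (convex
      hull V)"
  shows "(f has_derivative h') (at x)"
  using assms(1) open_interior[of "convex hull V"] assms(3)
  by (rule has_derivative_transform_within_open) (metis assms(2) interior_subset subsetD)

lemma jacobian_eqI:
  assumes "(f has_derivative f') (at x)"
  shows "jacobian f (at x) = matrix f'"
  using frechet_derivative_at[OF assms] by (simp add: jacobian_def)

lemma interior_tet_nonempty:
  assumes "valid_mesh M" "T \<in> tets M"
  shows "interior (convex hull T) \<noteq> {}"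
  using assms by (subst interior_convex_hull_eq_empty) (auto simp: valid_mesh_def)

lemma tetE:
  assumes "valid_mesh M" "T \<in> tets M"
  obtains a b c d where "T = {a, b, c, d}" "distinct [a, b, c, d]" "vol4 a b c d \<noteq> 0"
proof -
  have c4: "card T = 4" "\<not> affine_dependent T" using assms by (auto simp: valid_mesh_def)
  then obtain a where "a \<in> T" by fastforce
  define \<sigma> where "\<sigma> = T - {a}"
  have a: "T = insert a \<sigma>" "a \<notin> \<sigma>" "card \<sigma> = 3" 
    using \<open>a \<in> T\<close> c4(1) by (auto simp: \<sigma>_def)
  then obtain b c d where "\<sigma> = {b, c, d}" "distinct [b, c, d]" using tri_verticesE[OF a(3)] by metis
  then have "T = {a, b, c, d}" "distinct [a, b, c, d]" using a by auto
  moreover from this have "vol4 a b c d \<noteq> 0" using c4 vol4_nonzero by metis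
  ultimately show thesis by (rule that)
qed

section \<open>A single time step: \<open>w\<close> moves the bulk mesh and agrees with
  \<open>wt\<close> on the free surface\<close>

locale mesh_step =
  fixes \<tau> k :: real and n :: pt and M :: mesh and w wt :: "pt \<Rightarrow> pt"
  assumes tau: "\<tau> > 0" and n: "norm n = 1"
    and M: "valid_mesh M" and M': "valid_mesh (moved (mesh_map \<tau> w) M)"
    and fl: "flat_substrate n k M" and fl': "flat_substrate n k (moved (mesh_map \<tau> w) M)"
    and nondeg: "nondegenerate_map M (mesh_map \<tau> w)"
    and w: "w \<in> P1 (tets M)" and wt: "wt \<in> P1 (free M)"
    and w_wt: "\<And>x. x \<in> carrier (free M) \<Longrightarrow> w x = wt x"
begin

abbreviation X :: "pt \<Rightarrow> pt" where "X \<equiv> mesh_map \<tau> w"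
abbreviation N :: mesh where "N \<equiv> moved X M"

lemma moved_simps: "tets N = image X ` tets M" "free N = image X ` free M" "solid N = image X ` solid M"
  by (simp_all add: moved_def)

lemma tet_vertex_in_carrier: "T \<in> tets M \<Longrightarrow> x \<in> T \<Longrightarrow> x \<in> carrier (tets M)"
  unfolding carrier_def by (rule UN_I) (auto intro: hull_inc)

lemma face_vertex_in_carrier: "\<sigma> \<in> boundary_faces M \<Longrightarrow> x \<in> \<sigma> \<Longrightarrow> x \<in> carrier (tets M)"
  using boundary_face_in_tet tet_vertex_in_carrier by blast

lemma inj_X: "inj_on X (carrier (tets M))"
  using nondeg by (simp add: nondegenerate_map_def)

lemma inj_image_tets: "inj_on (image X) (tets M)"
  by (rule inj_on_subset[OF inj_on_image_Pow[OF inj_X]]) (use tet_vertex_in_carrier in blast)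

lemma inj_image_faces: "inj_on (image X) (boundary_faces M)"
  by (rule inj_on_subset[OF inj_on_image_Pow[OF inj_X]]) (use face_vertex_in_carrier in blast)

lemma X_affineE:
  assumes "T \<in> tets M"
  obtains A q where "linear A" "\<forall>x\<in>convex hull T. X x = q + A x"
proof -
  obtain q L where L: "linear L" "\<And>x. x \<in> convex hull T \<Longrightarrow> w x = q + L x"
    using P1_affineE[OF w assms] by metis
  have "\<forall>x\<in>convex hull T. X x = \<tau> *\<^sub>R q + (x + \<tau> *\<^sub>R L x)"
    using L(2) by (simp add: mesh_map_def scaleR_add_right)
  then show thesis by (rule that[OF linear_id_plus[OF L(1)]])
qed

text \<open>On a tetrahedron the mesh map is affine, and its linear part is the Jacobian at an
  interior point, which has positive determinant by nondegeneracy. All edge vectors are multiplied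
  by this one matrix.\<close>

lemma vol4_image:
  assumes "T \<in> tets M" "T = {a, b, c, d}"
  shows "sgn (vol4 (X a) (X b) (X c) (X d)) = sgn (vol4 a b c d)"
proof -
  obtain A q where linA: "linear A" and XA': "\<forall>x\<in>convex hull T. X x = q + A x"
    by (rule X_affineE[OF assms(1)])
  note XA = bspec[OF XA']
  obtain x where x: "x \<in> interior (convex hull T)" using interior_tet_nonempty[OF M assms(1)] by blast
  have "(A has_derivative A) (at x)"
    using linA by (simp add: bounded_linear_imp_has_derivative linear_linear)
  from has_derivative_add[OF has_derivative_const this]
  have "((\<lambda>x. q + A x) has_derivative A) (at x)" by simp
  then have "(X has_derivative A) (at x)"
    by (rule has_derivative_on_simplex[OF _ XA x])
  then have "det (matrix A) > 0"
    using nondeg assms(1) x jacobian_eqI unfolding nondegenerate_map_def by metis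
  moreover have "vol4 (X a) (X b) (X c) (X d) = det (matrix A) * vol4 a b c d"
  proof -
    have "X y - X x = A (y - x)" if "x \<in> T" "y \<in> T" for x y
      using XA[OF hull_inc[OF that(1)]] XA[OF hull_inc[OF that(2)]] by (simp add: linear_diff[OF linA])
    then have "X b - X a = A (b - a)" "X c - X a = A (c - a)" "X d - X a = A (d - a)"
      by (simp_all add: assms(2))
    then show ?thesis by (simp add: vol4_def triple_product_linear[OF linA])
  qed
  ultimately show ?thesis by (simp add: sgn_mult)
qed

text \<open>The vertex and its image lie in the same plane, so the displacement is tangential to the
  substrate.\<close>

lemma normal_velocity_zero:
  assumes "\<sigma> \<in> solid M" "x \<in> \<sigma>"
  shows "n \<bullet> w x = 0"
proof -
  have "n \<bullet> x = k" using fl assms by (auto simp: flat_substrate_def)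
  moreover have "n \<bullet> X x = k" using fl' assms by (auto simp: flat_substrate_def moved_simps)
  ultimately show ?thesis using tau by (simp add: mesh_map_def inner_add_right)
qed

text \<open>To remove the norm from the new area, the image has to keep its orientation in the
  plane. This is inherited from the adjacent tetrahedron: \<open>n\<close> is the outward normal
  before and after the step, so the fourth vertex stays on the inner side, and the preserved sign of
  \<open>vol4\<close> forces that of the planar factor.\<close>

lemma solid_area_image:
  assumes s: "\<sigma> \<in> solid M" "\<sigma> = {a, b, c}" "distinct [a, b, c]" and pos: "n \<bullet> cross3 (b - a) (c - a) > 0"
  shows "tri_area \<sigma> = n \<bullet> cross3 (b - a) (c - a) / 2"
    "tri_area (X ` \<sigma>) = n \<bullet> cross3 (X b - X a) (X c - X a) / 2"
proof -
  have sb: "\<sigma> \<in> boundary_faces M" and sb': "X ` \<sigma> \<in> boundary_faces N"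
    using subsetD[OF mesh_faces(1)[OF M] s(1)] subsetD[OF mesh_faces(1)[OF M'], of "X ` \<sigma>"] s(1)
    by (simp_all add: moved_simps)
  obtain T where T: "T \<in> tets M" "\<sigma> \<subseteq> T" using boundary_face_in_tet[OF sb] by blast
  obtain d where d: "T = insert d \<sigma>" "d \<notin> \<sigma>"
    using opposite_vertexE[OF _ T(2) card_tet[OF M T(1)]] sb by (auto simp: boundary_faces_def)
  have inT: "a \<in> T" "b \<in> T" "c \<in> T" "d \<in> T" using d s(2) by auto
  have Xinj: "X x = X y \<longleftrightarrow> x = y" if "x \<in> T" "y \<in> T" for x y
    using inj_X tet_vertex_in_carrier[OF T(1)] that by (auto simp: inj_on_def)
  have nz: "n \<bullet> (d - a) < 0"
  proof -
    have "outward_normal M \<sigma> = n" using fl s(1) by (auto simp: flat_substrate_def)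
    then show ?thesis using outward_normal_eq(5)[OF M sb T, of d a] d s(2) by auto
  qed
  have nz': "n \<bullet> (X d - X a) < 0"
  proof -
    have "outward_normal N (X ` \<sigma>) = n" using fl' s(1) by (auto simp: flat_substrate_def moved_simps)
    moreover have "X d \<notin> X ` \<sigma>" using d(2) Xinj inT T(2) by (auto simp: image_iff)
    moreover have "X ` T \<in> tets N" "X ` \<sigma> \<subseteq> X ` T" "X d \<in> X ` T" "X a \<in> X ` \<sigma>"
      using T inT s(2) by (auto simp: moved_simps)
    ultimately show ?thesis
      using outward_normal_eq(5)[OF M' sb', of "X ` T" "X d" "X a"] by auto
  qed
  have flat: "n \<bullet> a = k" "n \<bullet> b = k" "n \<bullet> c = k"
    using fl s by (auto simp: flat_substrate_def)
  have flat': "n \<bullet> X a = k" "n \<bullet> X b = k" "n \<bullet> X c = k"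
    using fl' s by (auto simp: flat_substrate_def moved_simps)
  define \<alpha> where "\<alpha> = n \<bullet> cross3 (b - a) (c - a)"
  define \<alpha>' where "\<alpha>' = n \<bullet> cross3 (X b - X a) (X c - X a)"
  have c: "cross3 (b - a) (c - a) = \<alpha> *\<^sub>R n" unfolding \<alpha>_def
    by (rule cross3_normal_unique) (use flat n in \<open>simp_all add: inner_diff_right\<close>)
  have c': "cross3 (X b - X a) (X c - X a) = \<alpha>' *\<^sub>R n" unfolding \<alpha>'_def
    by (rule cross3_normal_unique) (use flat' n in \<open>simp_all add: inner_diff_right\<close>)
  have "T = {a, b, c, d}" using d s(2) by auto
  then have "sgn (\<alpha>' * (n \<bullet> (X d - X a))) = sgn (\<alpha> * (n \<bullet> (d - a)))"
    using vol4_image[OF T(1), of a b c d] by (simp add: vol4_def c c')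
  then have "sgn \<alpha>' = sgn \<alpha>" using nz nz' by (simp add: sgn_mult)
  moreover have ap: "\<alpha> > 0" using pos by (simp only: \<alpha>_def)
  ultimately have ap': "\<alpha>' > 0" by (simp add: sgn_1_pos)
  have "tri_area {a, b, c} = \<alpha> / 2"
    using ap n unfolding tri_area_eq[OF s(3)] c by simp
  then show "tri_area \<sigma> = n \<bullet> cross3 (b - a) (c - a) / 2" by (simp add: s(2) \<alpha>_def)
  have "distinct [X a, X b, X c]" using s(3) Xinj inT by simp
  then have "tri_area {X a, X b, X c} = norm (cross3 (X b - X a) (X c - X a)) / 2" by (rule tri_area_eq)
  also have "\<dots> = \<alpha>' / 2" using ap' n unfolding c' by simp
  finally have "tri_area {X a, X b, X c} = \<alpha>' / 2" .
  then show "tri_area (X ` \<sigma>) = n \<bullet> cross3 (X b - X a) (X c - X a) / 2" by (simp add: s(2) \<alpha>'_def)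
qed

text \<open>\<open>\<tau> * edge_flux a b\<close> is the signed area swept by the edge during the step.\<close>

definition edge_flux :: "pt \<Rightarrow> pt \<Rightarrow> real" where
  "edge_flux a b = cross3 ((b - a) + (\<tau>/2) *\<^sub>R (w b - w a)) n \<bullet> ((1/2) *\<^sub>R (w a + w b))"

text \<open>The area in the plane is quadratic in the displacement, so pairing the mean of the old
  and the new edge with the mean velocity is exact on each triangle. As \<open>edge_flux\<close> is
  antisymmetric, only contact edges survive.\<close>

lemma solid_area_change:
  "surface_area (solid N) - surface_area (solid M) = \<tau> * (\<Sum>(a, b)\<in>directed_contact n M. edge_flux a b)"
proof -
  have anti: "edge_flux b a = - edge_flux a b" for a b
  proof -
    have "(a - b) + (\<tau>/2) *\<^sub>R (w a - w b) = - ((b - a) + (\<tau>/2) *\<^sub>R (w b - w a))"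
      by (simp add: algebra_simps)
    then show ?thesis
      by (simp only: edge_flux_def cross_minus_left inner_minus_left add.commute[of "w b" "w a"])
  qed
  have "surface_area (solid N) = (\<Sum>\<sigma>\<in>solid M. tri_area (X ` \<sigma>))"
    unfolding surface_area_def moved_simps
    by (subst sum.reindex) (use inj_on_subset[OF inj_image_faces mesh_faces(1)[OF M]] in auto)
  then have "surface_area (solid N) - surface_area (solid M) = (\<Sum>\<sigma>\<in>solid M. tri_area (X ` \<sigma>) -
      tri_area \<sigma>)"
    by (simp add: surface_area_def sum_subtractf)
  also have "\<dots> = (\<Sum>\<sigma>\<in>solid M. \<tau> * (\<Sum>(a, b)\<in>directed_edges n \<sigma>. edge_flux a b))"
  proof (intro sum.cong refl)
    fix \<sigma> assume s: "\<sigma> \<in> solid M"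
    obtain a b c where abc: "\<sigma> = {a, b, c}" "distinct [a, b, c]" "n \<bullet> cross3 (b - a) (c - a) > 0"
      by (rule solid_triangleE[OF M n fl s])
    have "(\<Sum>(a, b)\<in>directed_edges n \<sigma>. edge_flux a b) = edge_flux a b + edge_flux b c + edge_flux c a"
      unfolding abc(1) directed_edges_triangle[OF abc(2,3)] using abc(2) by simp
    moreover have "n \<bullet> cross3 (X b - X a) (X c - X a) / 2 - n \<bullet> cross3 (b - a) (c - a) / 2
      = \<tau> * (edge_flux a b + edge_flux b c + edge_flux c a)"
      unfolding edge_flux_def mesh_map_def
      by (simp add: cross3_simps) (simp add: field_simps)
    ultimately show "tri_area (X ` \<sigma>) - tri_area \<sigma> = \<tau> * (\<Sum>(a, b)\<in>directed_edges n \<sigma>. edge_flux a b)"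
      using solid_area_image[OF s abc] by simp
  qed
  also have "\<dots> = \<tau> * (\<Sum>(a, b)\<in>directed_contact n M. edge_flux a b)"
    using sum_directed_edges(1)[OF M n fl, of edge_flux, OF anti] by (simp add:
        sum_distrib_left[symmetric])
  finally show ?thesis .
qed

text \<open>The face is taken at the fraction \<theta> of the step. Velocities are derivatives with
  respect to this fraction, hence the factors \<tau>.\<close>

definition face_flux :: "pt \<Rightarrow> real \<Rightarrow> pt set \<Rightarrow> real" where
  "face_flux e \<theta> \<sigma> = (case tri_vertices \<sigma> of (a, b, c) \<Rightarrow>
     tri_flux e (a + \<theta> *\<^sub>R \<tau> *\<^sub>R w a) (b + \<theta> *\<^sub>R \<tau> *\<^sub>R w b) (c + \<theta> *\<^sub>R \<tau> *\<^sub>R w c) (\<tau> *\<^sub>R w a) (\<tau> *\<^sub>R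
         w b) (\<tau> *\<^sub>R w c))"

text \<open>At every \<theta> the triangle remains in the plane of the substrate, so its area vector
  is a multiple of \<open>n\<close>, while its velocities are orthogonal to
  \<open>n\<close>.\<close>

lemma face_flux_solid:
  assumes s: "\<sigma> \<in> solid M"
  shows "face_flux e \<theta> \<sigma> = 0"
proof -
  have sb: "\<sigma> \<in> boundary_faces M" using mesh_faces(1)[OF M] s by blast
  then obtain a b c where abc: "tri_vertices \<sigma> = (a, b, c)" "\<sigma> = {a, b, c}"
    by (auto simp: boundary_faces_def elim: tri_verticesE)
  have v: "n \<bullet> w x = 0" "n \<bullet> x = k" if "x \<in> {a, b, c}" for x
    using normal_velocity_zero[OF s] that fl s abc(2) by (auto simp: flat_substrate_def)
  let ?Y = "\<lambda>x. x + \<theta> *\<^sub>R \<tau> *\<^sub>R w x"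
  have "cross3 (?Y b - ?Y a) (?Y c - ?Y a) = (n \<bullet> cross3 (?Y b - ?Y a) (?Y c - ?Y a)) *\<^sub>R n"
    by (rule cross3_normal_unique) (use v n in \<open>simp_all add: inner_diff_right inner_add_right\<close>)
  then obtain q where q: "cross3 (?Y b - ?Y a) (?Y c - ?Y a) = q *\<^sub>R n" by blast
  show ?thesis unfolding face_flux_def abc(1) prod.case tri_flux_def q
    using v by (simp add: inner_add_right)
qed

text \<open>For positive orientation this is the integral of \<open>e \<bullet> x\<close> over the
  tetrahedron: the volume \<open>vol4 a b c d / 6\<close> times the mean of the four vertex
  values.\<close>

definition tet_moment :: "pt \<Rightarrow> pt \<Rightarrow> pt \<Rightarrow> pt \<Rightarrow> pt \<Rightarrow> real" where
  "tet_moment e a b c d = vol4 a b c d * (e \<bullet> a + e \<bullet> b + e \<bullet> c + e \<bullet> d) / 24"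

lemma tet_moment_change:
  assumes T: "T \<in> tets M" and abcd: "T = {a, b, c, d}" "distinct [a, b, c, d]"
  shows "((\<lambda>\<theta>. \<Sum>\<sigma>\<in>tet_faces T. face_sign \<sigma> T * face_flux e \<theta> \<sigma>) has_integral
     (sgn (vol4 a b c d) * (tet_moment e (X a) (X b) (X c) (X d) - tet_moment e a b c d))) {0..1}"
proof -
  let ?Y = "\<lambda>\<theta> x. x + \<theta> *\<^sub>R \<tau> *\<^sub>R w x" and ?W = "\<lambda>x. \<tau> *\<^sub>R w x"
  let ?f = "\<lambda>\<theta> a b c. tri_flux e (?Y \<theta> a) (?Y \<theta> b) (?Y \<theta> c) (?W a) (?W b) (?W c)"
  let ?m = "\<lambda>\<theta>. sgn (vol4 a b c d) * tet_moment e (?Y \<theta> a) (?Y \<theta> b) (?Y \<theta> c) (?Y \<theta> d)"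
  have "(\<Sum>\<sigma>\<in>tet_faces T. face_sign \<sigma> T * face_flux e \<theta> \<sigma>) =
     sgn (vol4 a b c d) * (?f \<theta> b c d - ?f \<theta> a c d + ?f \<theta> a b d - ?f \<theta> a b c)" for \<theta>
    unfolding abcd(1) face_flux_def
    by (rule sum_tet_faces[OF abcd(2)]) (rule tri_flux_swap)+
  moreover have "(?m has_vector_derivative
      sgn (vol4 a b c d) * (?f \<theta> b c d - ?f \<theta> a c d + ?f \<theta> a b d - ?f \<theta> a b c)) (at \<theta> within
          {0..1})" for \<theta>
    unfolding tet_moment_def has_real_derivative_iff_has_vector_derivative[symmetric]
    by (rule has_field_derivative_at_within, rule DERIV_cmult, rule tet_moment_derivative)
  ultimately have "((\<lambda>\<theta>. \<Sum>\<sigma>\<in>tet_faces T. face_sign \<sigma> T * face_flux e \<theta> \<sigma>) has_integral (?m 1 - ?m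
      0)) {0..1}"
    by (intro fundamental_theorem_of_calculus) auto
  then show ?thesis by (simp add: mesh_map_def right_diff_distrib)
qed

end

section \<open>Integrals over triangles, tetrahedra and domains\<close>

lemma integrable_continuous_on_compact:
  fixes f :: "'a::euclidean_space \<Rightarrow> 'b::euclidean_space"
  assumes "compact K" "continuous_on K f" "\<Omega> \<subseteq> K" "\<Omega> \<in> sets lebesgue"
  shows "integrable (lebesgue_on \<Omega>) f"
proof -
  have b: "integrable lborel (\<lambda>x. indicator K x *\<^sub>R f x)"
    using assms(1,2) by (rule borel_integrable_compact)
  then have "integrable lebesgue (\<lambda>x. indicator K x *\<^sub>R f x)"
    by (subst integrable_completion) auto
  then have "integrable lebesgue (\<lambda>x. indicator \<Omega> x *\<^sub>R (indicator K x *\<^sub>R f x))"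
    by (rule integrable_mult_indicator[OF assms(4)])
  moreover have "(\<lambda>x. indicator \<Omega> x *\<^sub>R (indicator K x *\<^sub>R f x)) = (\<lambda>x. indicator \<Omega> x *\<^sub>R f x)"
    using assms(3) by (auto simp: indicator_def fun_eq_iff)
  ultimately show ?thesis using assms(4) by (subst integrable_restrict_space) auto
qed

lemma ref_triangle_props: "compact ref_triangle" "ref_triangle \<in> sets borel" "ref_triangle \<in> sets
    lebesgue"
  "convex ref_triangle"
proof -
  have e: "ref_triangle = {p. 0 \<le> fst p} \<inter> {p. 0 \<le> snd p} \<inter> {p. fst p + snd p \<le> 1}"
    by (auto simp: ref_triangle_def)
  have cl: "closed ref_triangle" unfolding e
    by (intro closed_Int closed_Collect_le continuous_intros)
  have "ref_triangle \<subseteq> cbox (0, 0) (1, 1)" by (auto simp: ref_triangle_def cbox_Pair_eq)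
  then have "bounded ref_triangle" using bounded_cbox bounded_subset by blast
  then show "compact ref_triangle" using cl compact_eq_bounded_closed by blast
  show "ref_triangle \<in> sets borel" using cl by simp
  then show "ref_triangle \<in> sets lebesgue" by simp
  show "convex ref_triangle"
    unfolding convex_alt
  proof (intro ballI allI impI)
    fix p q :: "real \<times> real" and u :: real
    assume "p \<in> ref_triangle" "q \<in> ref_triangle" and u: "0 \<le> u \<and> u \<le> 1"
    then have pq: "0 \<le> fst p" "0 \<le> snd p" "fst p + snd p \<le> 1" "0 \<le> fst q" "0 \<le> snd q" "fst q + snd q \<le> 1"
      by (auto simp: ref_triangle_def)
    have "(1 - u) * (fst p + snd p) + u * (fst q + snd q) \<le> (1 - u) * 1 + u * 1"
      using pq u by (intro add_mono mult_left_mono) auto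
    moreover have "(1 - u) * (fst p + snd p) + u * (fst q + snd q) =
        ((1 - u) * fst p + u * fst q) + ((1 - u) * snd p + u * snd q)"
      by (simp add: algebra_simps)
    moreover have "0 \<le> (1 - u) * fst p + u * fst q" "0 \<le> (1 - u) * snd p + u * snd q"
      using pq u by simp_all
    ultimately show "(1 - u) *\<^sub>R p + u *\<^sub>R q \<in> ref_triangle"
      by (simp add: ref_triangle_def case_prod_unfold)
  qed
qed

lemma ref_triangle_integral_iterated:
  fixes f :: "real \<times> real \<Rightarrow> real"
  assumes f: "continuous_on UNIV f"
  shows "integral\<^sup>L (lebesgue_on ref_triangle) f = integral {0..1} (\<lambda>s. integral {0..1-s} (\<lambda>t. f (s,
      t)))"
proof -
  define h where "h = (\<lambda>p. indicator ref_triangle p *\<^sub>R f p)"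
  have ih: "integrable lborel h" unfolding h_def
    by (rule borel_integrable_compact) (use ref_triangle_props f continuous_on_subset in auto)
  then have ih2: "integrable (lborel \<Otimes>\<^sub>M lborel) h" by (simp add: lborel_prod)
  have h: "h (s, t) = indicator {0..1} s *\<^sub>R (indicator {0..1-s} t *\<^sub>R f (s, t))" for s t
    by (auto simp: h_def ref_triangle_def indicator_def)
  have inner: "(\<integral>t. h (s, t) \<partial>lborel) = indicator {0..1} s *\<^sub>R integral {0..1-s} (\<lambda>t. f (s, t))" for s
  proof -
    have "set_integrable lborel {0..1-s} (\<lambda>t. f (s, t))"
      unfolding set_integrable_def
      by (rule borel_integrable_compact) (auto intro!: continuous_on_compose2[OF f] continuous_intros)
    from set_borel_integral_eq_integral(2)[OF this]
    show ?thesis by (simp add: h set_lebesgue_integral_def)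
  qed
  have "integral\<^sup>L (lebesgue_on ref_triangle) f = integral\<^sup>L lebesgue h"
    unfolding h_def using ref_triangle_props by (subst integral_restrict_space) auto
  also have "\<dots> = integral\<^sup>L lborel h" using ih by (intro integral_completion) auto
  also have "\<dots> = integral\<^sup>L (lborel \<Otimes>\<^sub>M lborel) h" by (simp add: lborel_prod)
  also have "\<dots> = (\<integral>s. \<integral>t. h (s, t) \<partial>lborel \<partial>lborel)"
    by (rule lborel_pair.integral_fst'[OF ih2, symmetric])
  also have "\<dots> = (LINT s : {0..1} | lborel. integral {0..1-s} (\<lambda>t. f (s, t)))"
    by (simp add: inner set_lebesgue_integral_def)
  also have "\<dots> = integral {0..1} (\<lambda>s. integral {0..1-s} (\<lambda>t. f (s, t)))"
  proof (rule set_borel_integral_eq_integral(2))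
    show "set_integrable lborel {0..1} (\<lambda>s. integral {0..1-s} (\<lambda>t. f (s, t)))"
      unfolding set_integrable_def inner[symmetric] by (rule lborel_pair.integrable_fst'[OF ih2])
  qed
  finally show ?thesis .
qed

text \<open>The weights are the moments \<open>i! j! / (i + j + 2)!\<close> of the monomials. The
  antiderivative \<open>G\<close> keeps the powers of \<open>1 - s\<close> that the inner integral
  produces for \<open>\<gamma>\<close> and \<open>\<zeta>\<close>.\<close>

lemma ref_triangle_integral_quadratic:
  "integral\<^sup>L (lebesgue_on ref_triangle)
     (\<lambda>(s, t). \<alpha> + \<beta> * s + \<gamma> * t + \<delta> * s\<^sup>2 + \<epsilon> * (s * t) + \<zeta> * t\<^sup>2)
   = \<alpha> / 2 + \<beta> / 6 + \<gamma> / 6 + \<delta> / 12 + \<epsilon> / 24 + \<zeta> / 12"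
proof -
  let ?f = "\<lambda>(s, t). \<alpha> + \<beta> * s + \<gamma> * t + \<delta> * s\<^sup>2 + \<epsilon> * (s * t) + \<zeta> * t\<^sup>2"
  have cont: "continuous_on UNIV ?f" unfolding case_prod_unfold by (intro continuous_intros)
  define F where "F = (\<lambda>s t. \<alpha> * t + \<beta> * s * t + \<gamma> * t\<^sup>2 / 2 + \<delta> * s\<^sup>2 * t + \<epsilon> * s * t\<^sup>2 / 2 + \<zeta> * t
      ^ 3 / 3)"
  have inner: "integral {0..1-s} (\<lambda>t. ?f (s, t)) = F s (1 - s)" if "s \<in> {0..1}" for s
  proof -
    have "((\<lambda>t. ?f (s, t)) has_integral (F s (1 - s) - F s 0)) {0..1-s}"
      using that unfolding F_def
      by (intro fundamental_theorem_of_calculus)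
        (auto simp: has_real_derivative_iff_has_vector_derivative[symmetric] power2_eq_square
            power3_eq_cube
          intro!: derivative_eq_intros)
    then show ?thesis by (simp add: F_def integral_unique)
  qed
  define G where "G = (\<lambda>s. \<alpha> * (s - s\<^sup>2/2) + \<beta> * (s\<^sup>2/2 - s^3/3) - \<gamma> * (1 - s)^3 / 6 + \<delta> * (s^3/3 -
      s^4/4)
     + \<epsilon> / 2 * (s\<^sup>2/2 - 2 * s^3 / 3 + s^4/4) - \<zeta> / 12 * (1 - s)^4)"
  have "((\<lambda>s. F s (1 - s)) has_integral (G 1 - G 0)) {0..1}"
    unfolding F_def G_def
    by (intro fundamental_theorem_of_calculus)
      (auto simp: has_real_derivative_iff_has_vector_derivative[symmetric]
          intro!: derivative_eq_intros, simp add: field_simps power2_eq_square power3_eq_cube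
              power4_eq_xxxx)
  then have "integral {0..1} (\<lambda>s. F s (1 - s)) = G 1 - G 0" by (rule integral_unique)
  moreover have "G 1 - G 0 = \<alpha> / 2 + \<beta> / 6 + \<gamma> / 6 + \<delta> / 12 + \<epsilon> / 24 + \<zeta> / 12"
    by (simp add: G_def field_simps)
  moreover have "integral {0..1} (\<lambda>s. integral {0..1-s} (\<lambda>t. ?f (s, t))) = integral {0..1} (\<lambda>s. F s
      (1 - s))"
    by (intro integral_cong inner)
  ultimately show ?thesis using ref_triangle_integral_iterated[OF cont] by simp
qed

text \<open>Elementwise derivatives are under control only in the open triangle; this allows its
  edges to be discarded in integrals.\<close>

lemma negligible_ref_triangle_boundary:
  "negligible (ref_triangle - {p. 0 < fst p \<and> 0 < snd p \<and> fst p + snd p < 1})"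
proof -
  have sub: "ref_triangle - interior ref_triangle \<subseteq> frontier ref_triangle"
    using closure_subset by (auto simp: frontier_def)
  then have neg: "negligible (ref_triangle - interior ref_triangle)"
    using negligible_convex_frontier[OF ref_triangle_props(4)] negligible_subset by blast
  have int: "0 < fst p \<and> 0 < snd p \<and> fst p + snd p < 1" if p: "p \<in> interior ref_triangle" for p
  proof -
    obtain e where e: "e > 0" "cball p e \<subseteq> ref_triangle" using p mem_interior_cball by blast
    have "p + (e/2) *\<^sub>R v \<in> ref_triangle" if "norm v \<le> 2" for v
      using e that by (intro subsetD[OF e(2)]) (simp add: dist_norm)
    from this[of "(-1, 0)"] this[of "(0, -1)"] this[of "(1, 0)"]
    have "p + (e/2) *\<^sub>R (-1, 0) \<in> ref_triangle" "p + (e/2) *\<^sub>R (0, -1) \<in> ref_triangle" "p + (e/2)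
        *\<^sub>R (1, 0) \<in> ref_triangle"
      by (simp_all add: norm_Pair)
    then show ?thesis using e(1) by (cases p) (auto simp: ref_triangle_def)
  qed
  then show ?thesis using neg by (elim negligible_subset) blast
qed

section \<open>Volume and first moments of a tetrahedron\<close>

lemma volume_tet:
  fixes a b c d :: pt
  assumes "distinct [a, b, c, d]"
  shows "measure lebesgue (convex hull {a, b, c, d}) = \<bar>vol4 a b c d\<bar> / 6"
proof -
  define f where "f = (\<lambda>i::3. if i = 1 then b else if i = 2 then c else d)"
  have "bij_betw f UNIV ({a, b, c, d} - {a})"
    unfolding bij_betw_def
  proof
    show "inj f"
    proof (rule injI)
      fix i j assume "f i = f j"
      then show "i = j" using assms exhaust_3[of i] exhaust_3[of j] by (auto simp: f_def)
    qed
    have "range f = {f 1, f 2, f 3}" by (simp only: UNIV_3 image_insert image_empty)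
    then have "range f = {b, c, d}" by (simp add: f_def)
    moreover have "{a, b, c, d} - {a} = {b, c, d}" using assms by auto
    ultimately show "range f = {a, b, c, d} - {a}" by simp
  qed
  then have "measure lborel (convex hull {a, b, c, d}) = \<bar>det (\<chi> i. \<chi> j. f j $ i - a $ i)\<bar> / fact
      (CARD(3))"
    using assms by (intro content_simplex) auto
  moreover have "det (\<chi> i. \<chi> j. f j $ i - a $ i) = vol4 a b c d"
    by (simp add: f_def vol4_def cross3_simps)
  moreover have "measure lebesgue (convex hull {a, b, c, d}) = measure lborel (convex hull {a, b, c, d})"
    by (intro measure_completion) (simp add: compact_imp_closed borel_closed
        finite_imp_compact_convex_hull)
  ultimately show ?thesis by (simp add: fact_numeral)
qed

text \<open>The dual basis consists of the cross products of pairs, divided by the triple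
  product.\<close>

lemma dual_vectorE:
  fixes u v w :: pt
  assumes "cross3 u v \<bullet> w \<noteq> 0"
  obtains m where "m \<bullet> u = p" "m \<bullet> v = q" "m \<bullet> w = r"
proof -
  let ?V = "cross3 u v \<bullet> w"
  have c: "cross3 v w \<bullet> u = ?V" "cross3 w u \<bullet> v = ?V" by (simp_all add: cross3_simps)
  define m where "m = (1/?V) *\<^sub>R (p *\<^sub>R cross3 v w + q *\<^sub>R cross3 w u + r *\<^sub>R cross3 u v)"
  show thesis
    by (rule that[of m]) (use assms in \<open>simp_all add: m_def inner_add_left c dot_cross_self\<close>)
qed

text \<open>The affine involution exchanging the vertices \<open>a\<close> and \<open>b\<close> maps the tetrahedron to itself and
  changes the sign of the affine function which is \<open>1\<close> at \<open>a\<close>, \<open>-1\<close> at \<open>b\<close> and \<open>0\<close> at \<open>c\<close>, \<open>d\<close>.\<close>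

lemma tet_integral_exchange:
  fixes a b c d m :: pt
  defines "S \<equiv> convex hull {a, b, c, d}"
  assumes m: "m \<bullet> (b - a) = -2" "m \<bullet> (c - a) = -1" "m \<bullet> (d - a) = -1"
  shows "((\<lambda>x. 1 + m \<bullet> (x - a)) has_integral 0) S"
proof -
  define l where "l = (\<lambda>x. 1 + m \<bullet> (x - a))"
  \<comment> \<open>\<open>l\<close> decreases by 2 along \<open>b - a\<close>, so adding
    \<open>l x\<close> times this vector reverses the sign of \<open>l\<close>, and applying
    \<open>g\<close> twice gives the identity. Its linear part \<open>A\<close> therefore has
    determinant of modulus 1.\<close>
  define g where "g = (\<lambda>x. x + l x *\<^sub>R (b - a))"
  define A where "A = (\<lambda>x. x + (m \<bullet> x) *\<^sub>R (b - a))"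
  have linA: "linear A" by (rule linearI) (simp_all add: A_def inner_add_right scaleR_add_left
      algebra_simps)
  have lg: "l (g x) = - l x" for x
  proof -
    have "l (x + t *\<^sub>R (b - a)) = l x + t * (m \<bullet> (b - a))" for t
      by (simp add: l_def inner_diff_right inner_add_right algebra_simps)
    then show ?thesis by (simp add: g_def m(1))
  qed
  have gg: "g (g x) = x" for x using lg[of x] by (simp add: g_def)
  have AA: "A (A x) = x" for x
  proof -
    have "m \<bullet> A x = - (m \<bullet> x)" by (simp add: A_def inner_add_right m(1))
    then show ?thesis unfolding A_def by simp
  qed
  have gaff: "g x = A x + ((1 - m \<bullet> a) *\<^sub>R (b - a))" for x
    by (simp add: g_def A_def l_def inner_diff_right algebra_simps)
  have "matrix A ** matrix A = mat 1"
  proof -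
    have "matrix (A \<circ> A) = matrix A ** matrix A" by (rule matrix_compose[OF linA linA])
    moreover have "A \<circ> A = id" using AA by (simp add: fun_eq_iff)
    ultimately show ?thesis by (simp add: matrix_id_mat_1)
  qed
  then have "det (matrix A) * det (matrix A) = 1" by (metis det_mul det_I)
  then have det1: "\<bar>det (matrix A)\<bar> = 1" by (metis abs_mult abs_one abs_mult_self_eq power2_eq_1_iff
      power2_eq_square abs_minus_cancel)
  have gv: "g a = b" "g b = a" "g c = c" "g d = d"
    using m by (simp_all add: g_def l_def)
  have "g ` S = convex hull (g ` {a, b, c, d})"
  proof -
    have "g ` S = (\<lambda>x. (1 - m \<bullet> a) *\<^sub>R (b - a) + x) ` A ` S" 
      by (auto simp: image_image gaff add.commute)
    also have "\<dots> = convex hull ((\<lambda>x. (1 - m \<bullet> a) *\<^sub>R (b - a) + x) ` A ` {a, b, c, d})"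
      by (simp only: S_def convex_hull_translation convex_hull_linear_image[OF linA])
    also have "(\<lambda>x. (1 - m \<bullet> a) *\<^sub>R (b - a) + x) ` A ` {a, b, c, d} = g ` {a, b, c, d}"
      by (simp add: gaff add.commute)
    finally show ?thesis .
  qed
  also have "g ` {a, b, c, d} = {a, b, c, d}" using gv by auto
  finally have gS: "g ` S = S" by (simp add: S_def)
  have inj: "inj_on g S" by (rule inj_on_inverseI[of _ g]) (rule gg)
  have comp: "compact S" unfolding S_def by (intro finite_imp_compact_convex_hull) simp
  then have Sl: "S \<in> sets lebesgue" by (simp add: compact_imp_closed borel_closed)
  have gd: "(g has_derivative A) (at x within S)" for x
  proof -
    have "(A has_derivative A) (at x within S)"
      using linA by (simp add: bounded_linear_imp_has_derivative linear_linear)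
    from has_derivative_add[OF this has_derivative_const] show ?thesis by (simp add: gaff[abs_def])
  qed
  have contl: "continuous_on S l" unfolding l_def by (intro continuous_intros)
  \<comment> \<open>The change of variables is stated for integrands with values in
    \<open>real^n\<close>, so the scalar is wrapped into \<open>real^1\<close>.\<close>
  let ?F = "\<lambda>x. (\<chi> i. l x) :: real^1"
  have ai: "?F absolutely_integrable_on S"
    using integrable_continuous_on_compact[OF comp _ subset_refl Sl, of ?F] contl Sl
    by (simp add: set_integrable_def integrable_restrict_space continuous_on_vec_lambda)
  have "(\<lambda>x. \<bar>det (matrix A)\<bar> *\<^sub>R ?F (g x)) absolutely_integrable_on S \<and>
      integral S (\<lambda>x. \<bar>det (matrix A)\<bar> *\<^sub>R ?F (g x)) = integral S ?F"
    using has_absolute_integral_change_of_variables[OF Sl gd inj, of ?F "integral S ?F"] ai gS by simp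
  then have "integral S (\<lambda>x. ?F (g x)) = integral S ?F" by (simp add: det1)
  moreover have "?F (g x) = - ?F x" for x by (simp add: lg vec_eq_iff)
  ultimately have "- integral S ?F = integral S ?F" by simp
  then have "(2::real) *\<^sub>R integral S ?F = 0" by (metis add.left_inverse scaleR_2)
  then have "integral S ?F = 0" by simp
  moreover have "integral S (\<lambda>x. ?F x $ 1) = integral S ?F $ 1"
    using set_lebesgue_integral_eq_integral(1)[OF ai] by (rule integral_component_eq_cart)
  moreover have "l integrable_on S"
    using integrable_continuous_on_compact[OF comp contl subset_refl Sl] Sl by (rule
        integrable_on_lebesgue_on)
  ultimately show ?thesis unfolding l_def[symmetric] by (simp add: has_integral_iff)
qed

lemma has_integral_const_compact:
  fixes S :: "pt set" and k :: real
  assumes "compact S"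
  shows "((\<lambda>x. k) has_integral k * measure lebesgue S) S"
proof -
  have "S \<in> lmeasurable" using assms by (rule lmeasurable_compact)
  then have "((\<lambda>x. 1::real) has_integral measure lebesgue S) S"
    by (simp add: has_integral_iff lmeasure_integral integrable_on_const)
  from has_integral_mult_right[OF this, of k] show ?thesis by simp
qed

text \<open>Subtracting the mean of the vertex values leaves an affine function whose vertex values
  sum to zero. It is a combination of three functions that are 1 at \<open>a\<close>, -1 at one
  other vertex and 0 at the remaining two, and these have integral zero by symmetry. The mean
  contributes the volume.\<close>

lemma tet_integral_linear:
  fixes a b c d e :: pt
  assumes dist: "distinct [a, b, c, d]" and v: "vol4 a b c d \<noteq> 0"
  shows "((\<lambda>x. e \<bullet> x) has_integral
     (\<bar>vol4 a b c d\<bar> * (e \<bullet> a + e \<bullet> b + e \<bullet> c + e \<bullet> d) / 24)) (convex hull {a, b, c, d})"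
proof -
  let ?S = "convex hull {a, b, c, d}"
  define mean where "mean = (e \<bullet> a + e \<bullet> b + e \<bullet> c + e \<bullet> d) / 4"
  define h where "h = (\<lambda>x. e \<bullet> x - mean)"
  have v': "cross3 (b - a) (c - a) \<bullet> (d - a) \<noteq> 0" using v by (simp add: vol4_def)
  obtain p where p: "p \<bullet> (b - a) = -2" "p \<bullet> (c - a) = -1" "p \<bullet> (d - a) = -1" using dual_vectorE[OF
      v'] by metis
  obtain q where q: "q \<bullet> (b - a) = -1" "q \<bullet> (c - a) = -2" "q \<bullet> (d - a) = -1" using dual_vectorE[OF
      v'] by metis
  obtain r where r: "r \<bullet> (b - a) = -1" "r \<bullet> (c - a) = -1" "r \<bullet> (d - a) = -2" using dual_vectorE[OF
      v'] by metis
  have ip: "((\<lambda>x. 1 + p \<bullet> (x - a)) has_integral 0) ?S"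
    by (rule tet_integral_exchange[OF p])
  have iq: "((\<lambda>x. 1 + q \<bullet> (x - a)) has_integral 0) ?S"
    using tet_integral_exchange[OF q(2,1,3)] by (simp add: insert_commute)
  have ir: "((\<lambda>x. 1 + r \<bullet> (x - a)) has_integral 0) ?S"
  proof -
    have "{a, d, b, c} = {a, b, c, d}" by auto
    then show ?thesis using tet_integral_exchange[OF r(3,1,2)] by simp
  qed
  have eq: "h x = - h b * (1 + p \<bullet> (x - a)) + (- h c * (1 + q \<bullet> (x - a)) + - h d * (1 + r \<bullet> (x -
      a)))" for x
  proof -
    \<comment> \<open>\<open>y\<close> is the difference of the gradients of the two sides. It is
      orthogonal to three independent edge vectors and therefore zero.\<close>
    define y where "y = e + h b *\<^sub>R p + h c *\<^sub>R q + h d *\<^sub>R r"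
    have s: "h a + h b + h c + h d = 0" by (simp add: h_def mean_def field_simps)
    have "e \<bullet> (b - a) = h b - h a" "e \<bullet> (c - a) = h c - h a" "e \<bullet> (d - a) = h d - h a"
      by (simp_all add: h_def inner_diff_right)
    then have "y \<bullet> (b - a) = 0" "y \<bullet> (c - a) = 0" "y \<bullet> (d - a) = 0"
      using s unfolding y_def inner_add_left inner_scaleR_left p q r by linarith+
    then have "(cross3 (b - a) (c - a) \<bullet> (d - a)) * (y \<bullet> y) = 0"
      using arg_cong[OF cross3_cramer[of "b - a" "c - a" "d - a" y], of "\<lambda>t. y \<bullet> t"]
      by (simp add: inner_add_right)
    then have "y = 0" using v' by simp
    then have "y \<bullet> (x - a) = 0" by simp
    then have "e \<bullet> (x - a) = - (h b * (p \<bullet> (x - a)) + h c * (q \<bullet> (x - a)) + h d * (r \<bullet> (x - a)))"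
      by (simp add: y_def inner_add_left)
    moreover have "h x = e \<bullet> (x - a) + h a" by (simp add: h_def inner_diff_right)
    ultimately show ?thesis using s by (simp add: algebra_simps)
  qed
  have "((\<lambda>x. - h b * (1 + p \<bullet> (x - a)) + (- h c * (1 + q \<bullet> (x - a)) + - h d * (1 + r \<bullet> (x - a))))
      has_integral (- h b * 0 + (- h c * 0 + - h d * 0))) ?S"
    by (intro has_integral_add has_integral_mult_right ip iq ir)
  then have "(h has_integral 0) ?S" by (simp only: eq[symmetric]) simp
  moreover have comp: "compact ?S" by (intro finite_imp_compact_convex_hull) simp
  ultimately have "((\<lambda>x. h x + mean) has_integral (0 + mean * measure lebesgue ?S)) ?S"
    by (intro has_integral_add has_integral_const_compact) simp_all
  then show ?thesis by (simp add: h_def mean_def volume_tet[OF dist] mult.commute)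
qed

section \<open>Integrals over the triangulated domain\<close>

lemma compact_carrier: "valid_mesh M \<Longrightarrow> compact (carrier (tets M))"
  unfolding carrier_def by (intro compact_UN finite_tets finite_imp_compact_convex_hull finite_tet)

lemma domain_props:
  "domain M \<subseteq> carrier (tets M)" "open (domain M)" "domain M \<in> sets lebesgue"
  by (simp_all add: domain_def interior_subset borel_open)

lemma carrier_minus_domain: 
  "carrier (tets M) - (\<Union>T\<in>tets M. interior (convex hull T)) \<subseteq> (\<Union>T\<in>tets M. frontier (convex hull T))"
  using closure_subset by (fastforce simp: carrier_def frontier_def)

lemma negligible_skeleton: "valid_mesh M \<Longrightarrow> negligible (\<Union>T\<in>tets M. frontier (convex hull T))"
  by (intro negligible_Union) (auto simp: finite_tets intro: negligible_convex_frontier)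

lemma interior_tet_subset_domain: "T \<in> tets M \<Longrightarrow> interior (convex hull T) \<subseteq> domain M"
  unfolding domain_def by (rule interior_mono) (auto simp: carrier_def)

lemma negligible_domain_skeleton:
  assumes "valid_mesh M"
  shows "negligible (domain M - (\<Union>T\<in>tets M. interior (convex hull T)))"
  by (rule negligible_subset[OF negligible_skeleton[OF assms]])
    (use carrier_minus_domain[of M] domain_props(1)[of M] in blast)

text \<open>Integrability of \<open>f\<close> is a conclusion: integrands built from elementwise
  derivatives are known only off a null set, and they inherit it from an explicit
  \<open>g\<close>.\<close>

lemma lebesgue_integral_spike:
  fixes f g :: "'a::euclidean_space \<Rightarrow> 'b::euclidean_space"
  assumes S: "S \<in> sets lebesgue" and neg: "negligible Z" and g: "integrable (lebesgue_on S) g"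
    and eq: "\<And>x. x \<in> S - Z \<Longrightarrow> f x = g x"
  shows "integrable (lebesgue_on S) f" "integral\<^sup>L (lebesgue_on S) f = integral\<^sup>L (lebesgue_on S) g"
proof -
  have abs: "integrable (lebesgue_on S) k \<longleftrightarrow> k absolutely_integrable_on S" for k :: "'a \<Rightarrow> 'b"
    using S by (simp add: set_integrable_def integrable_restrict_space)
  have "f absolutely_integrable_on S"
    using g neg eq unfolding abs by (rule absolutely_integrable_spike)
  then show f: "integrable (lebesgue_on S) f" unfolding abs .
  have "integral S f = integral S g" using neg eq by (metis integral_spike)
  then show "integral\<^sup>L (lebesgue_on S) f = integral\<^sup>L (lebesgue_on S) g"
    using lebesgue_integral_eq_integral[OF f S] lebesgue_integral_eq_integral[OF g S] by simp
qed

text \<open>Different tetrahedra share at most three vertices, and the hull of fewer than four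
  points has no interior in space.\<close>

lemma negligible_tet_intersection:
  assumes M: "valid_mesh M" and "S \<in> tets M" "T \<in> tets M" "S \<noteq> T"
  shows "negligible (convex hull S \<inter> convex hull T)"
proof -
  have "S \<inter> T \<subset> S"
  proof -
    have "\<not> S \<subseteq> T" using card_subset_eq[OF finite_tet[OF M assms(3)], of S] card_tet[OF M] assms by auto
    then show ?thesis by blast
  qed
  then have "card (S \<inter> T) < 4" using psubset_card_mono[OF finite_tet[OF M assms(2)]] card_tet[OF M
      assms(2)] by metis
  moreover have "\<not> affine_dependent (S \<inter> T)"
    using M assms(2) affine_dependent_subset[of "S \<inter> T" S] by (auto simp: valid_mesh_def)
  ultimately have "interior (convex hull (S \<inter> T)) = {}"
    by (subst interior_convex_hull_explicit) auto
  then show ?thesis unfolding mesh_conforming[OF M assms(2,3)]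
    by (simp add: negligible_convex_interior)
qed

lemma vol_int_domain:
  fixes f :: "pt \<Rightarrow> real"
  assumes M: "valid_mesh M" and f: "continuous_on (carrier (tets M)) f"
    and I: "\<And>T. T \<in> tets M \<Longrightarrow> (f has_integral I T) (convex hull T)"
  shows "vol_int (domain M) f = sum I (tets M)"
proof -
  have "(f has_integral sum I (tets M)) (carrier (tets M))"
    unfolding carrier_def
    using finite_tets[OF M] I by (rule has_integral_UN) (auto simp: pairwise_def
        negligible_tet_intersection[OF M])
  moreover have "carrier (tets M) - domain M \<subseteq> (\<Union>T\<in>tets M. frontier (convex hull T))"
    using carrier_minus_domain[of M] interior_tet_subset_domain by blast
  then have "negligible (carrier (tets M) - domain M)"
    using negligible_skeleton[OF M] negligible_subset by blast
  moreover have "domain M - carrier (tets M) = {}" using domain_props(1) by blast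
  ultimately have "(f has_integral sum I (tets M)) (domain M)"
    by (subst has_integral_spike_set_eq[of _ "carrier (tets M)"]) (auto intro: negligible_subset)
  moreover have "integrable (lebesgue_on (domain M)) f"
    using compact_carrier[OF M] f domain_props(1,3) by (rule integrable_continuous_on_compact)
  ultimately show ?thesis
    unfolding vol_int_def using lebesgue_integral_eq_integral domain_props(3) integral_unique by metis
qed

section \<open>Gravity and surface tension\<close>

text \<open>The values of \<open>f\<close> off \<open>S\<close> are arbitrary, but the derivative
  along \<open>t\<close> only sees a short segment through \<open>x\<close>, and this lies in
  \<open>S\<close>.\<close>

lemma dir_deriv_affine:
  fixes f :: "pt \<Rightarrow> pt"
  assumes L: "linear L" and f: "\<And>y. y \<in> S \<Longrightarrow> f y = q + L y"
    and e: "\<epsilon> > 0" "\<And>r::real. \<bar>r\<bar> < \<epsilon> \<Longrightarrow> x + r *\<^sub>R t \<in> S"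
  shows "dir_deriv t f x = L t"
proof -
  have "((\<lambda>r. q + L x + r *\<^sub>R L t) has_vector_derivative L t) (at 0)"
    by (auto intro!: derivative_eq_intros)
  then have "((\<lambda>r. f (x + r *\<^sub>R t)) has_vector_derivative L t) (at 0)"
  proof (rule has_vector_derivative_transform_within_open[of _ _ _ "ball 0 \<epsilon>"])
    fix r :: real assume "r \<in> ball 0 \<epsilon>"
    then have "x + r *\<^sub>R t \<in> S" using e(2)[of r] by (simp add: dist_norm)
    then show "q + L x + r *\<^sub>R L t = f (x + r *\<^sub>R t)"
      by (simp add: f linear_add[OF L] linear_scale[OF L])
  qed (use e(1) in simp_all)
  then show ?thesis unfolding dir_deriv_def by (rule vector_derivative_at)
qed

lemma triangle_interior_line:
  fixes a b c :: pt
  assumes "0 < s" "0 < t" "s + t < (1::real)"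
  obtains \<epsilon> where "\<epsilon> > 0" "\<And>r. \<bar>r\<bar> < \<epsilon> \<Longrightarrow>
    a + s *\<^sub>R (b - a) + t *\<^sub>R (c - a) + r *\<^sub>R (\<alpha> *\<^sub>R (b - a) + \<beta> *\<^sub>R (c - a)) \<in> convex hull {a, b, c}"
proof -
  \<comment> \<open>\<open>\<delta>\<close> is the smallest barycentric coordinate of the point.
    Moving by \<open>r\<close> changes each coordinate by at most the modulus of \<open>r\<close>
    times the sum of the moduli of \<open>\<alpha>\<close> and \<open>\<beta>\<close>.\<close>
  define \<delta> where "\<delta> = min s (min t (1 - s - t))"
  define \<epsilon> where "\<epsilon> = \<delta> / (\<bar>\<alpha>\<bar> + \<bar>\<beta>\<bar> + 1)"
  have d: "\<delta> > 0" "\<delta> \<le> s" "\<delta> \<le> t" "\<delta> \<le> 1 - s - t" using assms by (auto simp: \<delta>_def)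
  have e: "\<epsilon> > 0" using d by (simp add: \<epsilon>_def add_nonneg_pos)
  have "a + s *\<^sub>R (b - a) + t *\<^sub>R (c - a) + r *\<^sub>R (\<alpha> *\<^sub>R (b - a) + \<beta> *\<^sub>R (c - a)) \<in> convex hull {a,
      b, c}"
    if r: "\<bar>r\<bar> < \<epsilon>" for r
  proof -
    have "\<bar>r\<bar> * (\<bar>\<alpha>\<bar> + \<bar>\<beta>\<bar> + 1) < \<delta>"
      using r by (simp add: \<epsilon>_def pos_less_divide_eq add_nonneg_pos)
    then have "\<bar>r * \<alpha>\<bar> + \<bar>r * \<beta>\<bar> < \<delta>" using abs_ge_zero[of r] unfolding abs_mult distrib_left by linarith
    then have "0 \<le> s + r * \<alpha>" "0 \<le> t + r * \<beta>" "(s + r * \<alpha>) + (t + r * \<beta>) \<le> 1"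
      using d abs_ge_self[of "r * \<alpha>"] abs_ge_self[of "r * \<beta>"] abs_ge_minus_self[of "r * \<alpha>"]
          abs_ge_minus_self[of "r * \<beta>"]
        abs_ge_zero[of "r * \<alpha>"] abs_ge_zero[of "r * \<beta>"] by linarith+
    then have "a + (s + r * \<alpha>) *\<^sub>R (b - a) + (t + r * \<beta>) *\<^sub>R (c - a) \<in> convex hull {a, b, c}"
      by (rule convex_combination_3)
    moreover have "a + s *\<^sub>R (b - a) + t *\<^sub>R (c - a) + r *\<^sub>R (\<alpha> *\<^sub>R (b - a) + \<beta> *\<^sub>R (c - a))
      = a + (s + r * \<alpha>) *\<^sub>R (b - a) + (t + r * \<beta>) *\<^sub>R (c - a)"
      by (simp add: scaleR_add_left scaleR_add_right)
    ultimately show ?thesis by (simp only:)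
  qed
  with e show thesis by (rule that)
qed

text \<open>Cramer's rule in the basis formed by \<open>u\<close>, \<open>w\<close> and their cross
  product: the third coefficient is zero by hypothesis.\<close>

lemma tangential_coordinates:
  assumes "v \<bullet> cross3 u w = 0" "cross3 u w \<noteq> 0"
  obtains \<alpha> \<beta> where "v = \<alpha> *\<^sub>R u + \<beta> *\<^sub>R w"
proof -
  let ?N = "cross3 u w"
  let ?V = "?N \<bullet> ?N"
  have "?V *\<^sub>R v = (v \<bullet> cross3 w ?N) *\<^sub>R u + (v \<bullet> cross3 ?N u) *\<^sub>R w"
    using cross3_cramer[of u w ?N v] assms(1) by simp
  then have "(1/?V) *\<^sub>R (?V *\<^sub>R v) = ((v \<bullet> cross3 w ?N)/?V) *\<^sub>R u + ((v \<bullet> cross3 ?N u)/?V) *\<^sub>R w"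
    by (simp add: scaleR_add_right)
  then show thesis using assms(2) by (intro that) simp
qed

text \<open>The determinant of a linear map on the plane spanned by \<open>u\<close> and \<open>w\<close>, evaluated on two bases.\<close>

lemma cross3_linear_ratio:
  assumes L: "linear L" and N: "cross3 u w \<noteq> 0" and t: "t1 \<bullet> cross3 u w = 0" "t2 \<bullet> cross3 u w = 0"
    and c: "cross3 t1 t2 = \<kappa> *\<^sub>R cross3 u w"
  shows "cross3 (L t1) (L t2) = \<kappa> *\<^sub>R cross3 (L u) (L w)"
proof -
  obtain \<alpha> \<beta> where 1: "t1 = \<alpha> *\<^sub>R u + \<beta> *\<^sub>R w" using tangential_coordinates[OF t(1) N] .
  obtain \<gamma> \<delta> where 2: "t2 = \<gamma> *\<^sub>R u + \<delta> *\<^sub>R w" using tangential_coordinates[OF t(2) N] .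
  have *: "cross3 (\<alpha> *\<^sub>R x + \<beta> *\<^sub>R y) (\<gamma> *\<^sub>R x + \<delta> *\<^sub>R y) = (\<alpha> * \<delta> - \<beta> * \<gamma>) *\<^sub>R cross3 x y" for x y
    by (simp add: cross3_simps)
  have "(\<alpha> * \<delta> - \<beta> * \<gamma>) *\<^sub>R cross3 u w = \<kappa> *\<^sub>R cross3 u w" using c unfolding 1 2 * .
  then have k: "\<alpha> * \<delta> - \<beta> * \<gamma> = \<kappa>" using N by simp
  have "L t1 = \<alpha> *\<^sub>R L u + \<beta> *\<^sub>R L w" "L t2 = \<gamma> *\<^sub>R L u + \<delta> *\<^sub>R L w"
    by (simp_all add: 1 2 linear_add[OF L] linear_scale[OF L])
  then show ?thesis by (simp only: * k)
qed

section \<open>Tangential frames and linear integrands on a triangle\<close>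

lemma orthonormal_frame_exists:
  fixes n :: pt
  assumes "norm n = 1"
  obtains t1 t2 where "norm t1 = 1" "norm t2 = 1" "t1 \<bullet> t2 = 0" "t1 \<bullet> n = 0" "t2 \<bullet> n = 0" "cross3 t1
      t2 = n"
proof -
  obtain y where y: "y \<noteq> 0" "orthogonal n y" using orthogonal_to_vector_exists[of n] by auto
  define t1 where "t1 = (1 / norm y) *\<^sub>R y"
  define t2 where "t2 = cross3 n t1"
  have 1: "norm t1 = 1" "t1 \<bullet> n = 0" using y by (simp_all add: t1_def orthogonal_def inner_commute)
  have c: "cross3 t1 t2 = n" using 1 unfolding t2_def Lagrange by (simp add: norm_eq_1)
  have "(norm t2)\<^sup>2 = 1" using assms 1 unfolding t2_def norm_cross by (simp add: inner_commute)
  then have "norm t2 = 1" by (simp add: power2_eq_1_iff) (use norm_ge_zero[of t2] in linarith)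
  then show thesis using 1 c that[of t1 t2] by (simp add: t2_def dot_cross_self)
qed

lemma tangent_frame_props:
  assumes "norm n = 1" "tangent_frame n = (t1, t2)"
  shows "t1 \<bullet> n = 0" "t2 \<bullet> n = 0" "cross3 t1 t2 = n"
proof -
  obtain u v where "u \<bullet> n = 0" "v \<bullet> n = 0" "cross3 u v = n" using orthonormal_frame_exists[OF
      assms(1)] by metis
  moreover define P where "P = (\<lambda>(t1, t2). t1 \<bullet> n = 0 \<and> t2 \<bullet> n = 0 \<and> cross3 t1 t2 = n)"
  ultimately have "P (u, v)" by simp
  then have "P (Eps P)" by (rule someI)
  moreover have "Eps P = (t1, t2)" using assms(2) unfolding tangent_frame_def P_def .
  ultimately have "P (t1, t2)" by simp
  then show "t1 \<bullet> n = 0" "t2 \<bullet> n = 0" "cross3 t1 t2 = n" unfolding P_def prod.case by blast+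
qed

lemma tang_proj_frame:
  assumes "norm t1 = 1" "norm t2 = 1" "t1 \<bullet> t2 = 0" "t1 \<bullet> n = 0" "t2 \<bullet> n = 0" "cross3 t1 t2 = n"
  shows "tang_proj n v = (t1 \<bullet> v) *\<^sub>R t1 + (t2 \<bullet> v) *\<^sub>R t2"
proof -
  have "n \<bullet> n = 1" using norm_cross[of t1 t2] assms unfolding assms(6) by (simp add:
      power2_norm_eq_inner)
  moreover have "cross3 t2 n = t1" "cross3 n t1 = t2"
    using assms unfolding assms(6)[symmetric] 
    by (simp_all add: Lagrange cross_skew[of "cross3 t1 t2"] norm_eq_1 inner_commute)
  ultimately have "v = (t1 \<bullet> v) *\<^sub>R t1 + (t2 \<bullet> v) *\<^sub>R t2 + (n \<bullet> v) *\<^sub>R n"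
    using cross3_cramer[of t1 t2 n v] assms(6) by (simp add: inner_commute)
  then show ?thesis unfolding tang_proj_def by (metis add_diff_cancel_right')
qed

lemma inner_matrix_columns:
  fixes A B :: "real^3^3"
  shows "A \<bullet> B = (\<Sum>j\<in>UNIV. (A *v axis j 1) \<bullet> (B *v axis j 1))"
  by (simp add: inner_vec_def matrix_vector_mult_basis column_def sum_3) 

text \<open>Summed over the standard columns, the coefficient of \<open>F t1 \<bullet> G t2\<close>
  is \<open>t1 \<bullet> t2\<close>, and likewise for the other pairs; orthonormality leaves the
  diagonal terms. This expresses that the Frobenius product does not depend on the basis.\<close>

lemma inner_matrix_tangential:
  fixes F G :: "pt \<Rightarrow> pt"
  assumes F: "linear F" and G: "linear G" and t: "norm t1 = 1" "norm t2 = 1" "t1 \<bullet> t2 = 0"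
  shows "matrix (\<lambda>v. F ((t1 \<bullet> v) *\<^sub>R t1 + (t2 \<bullet> v) *\<^sub>R t2)) \<bullet> matrix (\<lambda>v. G ((t1 \<bullet> v) *\<^sub>R t1 + (t2 \<bullet>
      v) *\<^sub>R t2))
    = F t1 \<bullet> G t1 + F t2 \<bullet> G t2"
proof -
  have lin: "linear (\<lambda>v. L ((t1 \<bullet> v) *\<^sub>R t1 + (t2 \<bullet> v) *\<^sub>R t2))" if "linear L" for L :: "pt \<Rightarrow> pt"
    by (rule linearI) (simp_all add: linear_add[OF that] linear_scale[OF that] inner_add_right
        algebra_simps)
  have app: "matrix (\<lambda>v. L ((t1 \<bullet> v) *\<^sub>R t1 + (t2 \<bullet> v) *\<^sub>R t2)) *v x = (t1 \<bullet> x) *\<^sub>R L t1 + (t2 \<bullet> x)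
      *\<^sub>R L t2"
    if "linear L" for L :: "pt \<Rightarrow> pt" and x
    using fun_cong[OF matrix_vector_mul(2)[OF lin[OF that]], of x]
    by (simp add: linear_add[OF that] linear_scale[OF that])
  have s: "t1$1*t1$1 + t1$2*t1$2 + t1$3*t1$3 = 1" "t2$1*t2$1 + t2$2*t2$2 + t2$3*t2$3 = 1"
     "t1$1*t2$1 + t1$2*t2$2 + t1$3*t2$3 = 0"
    using t by (simp_all add: norm_eq_1 inner_vec_def sum_3)
  define P Q R S where "P = F t1 \<bullet> G t1" and "Q = F t1 \<bullet> G t2" and "R = F t2 \<bullet> G t1" and "S = F t2 \<bullet>
      G t2"
  have "matrix (\<lambda>v. F ((t1 \<bullet> v) *\<^sub>R t1 + (t2 \<bullet> v) *\<^sub>R t2)) \<bullet> matrix (\<lambda>v. G ((t1 \<bullet> v) *\<^sub>R t1 + (t2 \<bullet>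
      v) *\<^sub>R t2))
    = (t1$1*t1$1 + t1$2*t1$2 + t1$3*t1$3) * P + (t1$1*t2$1 + t1$2*t2$2 + t1$3*t2$3) * Q
     + (t1$1*t2$1 + t1$2*t2$2 + t1$3*t2$3) * R + (t2$1*t2$1 + t2$2*t2$2 + t2$3*t2$3) * S"
    unfolding inner_matrix_columns app[OF F] app[OF G] sum_3 
    by (simp add: inner_axis P_def Q_def R_def S_def inner_add_left inner_add_right algebra_simps)
  then show ?thesis by (simp add: s P_def S_def)
qed

text \<open>These are the entries of the mass matrix of linear functions, 1/12 on the diagonal and
  1/24 off it. The same weights define \<open>tri_flux\<close>, so that flux and surface integral
  agree exactly.\<close>

lemma ref_triangle_integral_product:
  fixes p q r u v w :: pt
  shows "integral\<^sup>L (lebesgue_on ref_triangle) (\<lambda>(s, t). (p + s *\<^sub>R (q - p) + t *\<^sub>R (r - p)) \<bullet> (u +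
      s *\<^sub>R (v - u) + t *\<^sub>R (w - u)))
    = ((p + q + r) \<bullet> (u + v + w) + p \<bullet> u + q \<bullet> v + r \<bullet> w) / 24"
proof -
  have "(\<lambda>(s, t). (p + s *\<^sub>R (q - p) + t *\<^sub>R (r - p)) \<bullet> (u + s *\<^sub>R (v - u) + t *\<^sub>R (w - u))) =
    (\<lambda>(s, t). p \<bullet> u + (p \<bullet> (v - u) + (q - p) \<bullet> u) * s + (p \<bullet> (w - u) + (r - p) \<bullet> u) * t + ((q - p) \<bullet>
        (v - u)) * s\<^sup>2
       + ((q - p) \<bullet> (w - u) + (r - p) \<bullet> (v - u)) * (s * t) + ((r - p) \<bullet> (w - u)) * t\<^sup>2)"
    by (auto simp: fun_eq_iff inner_add_left inner_add_right power2_eq_square algebra_simps)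
  then show ?thesis
    by (simp only: ref_triangle_integral_quadratic) (simp add: inner_add_left inner_add_right
        inner_diff_left inner_diff_right field_simps)
qed

lemma integrable_ref_triangle_const: "integrable (lebesgue_on ref_triangle) (\<lambda>p. k::real)"
  by (rule integrable_continuous_on_compact[OF ref_triangle_props(1) _ subset_refl
      ref_triangle_props(3)]) simp

lemma integral_ref_triangle_const: "integral\<^sup>L (lebesgue_on ref_triangle) (\<lambda>p. k::real) = k / 2"
  using ref_triangle_integral_quadratic[of k 0 0 0 0 0] by (simp add: case_prod_unfold)

lemma dir_deriv_triangle:
  fixes f :: "pt \<Rightarrow> pt"
  assumes L: "linear L" and f: "\<And>y. y \<in> convex hull {a, b, c} \<Longrightarrow> f y = q + L y"
    and N: "cross3 (b - a) (c - a) \<noteq> 0" and v: "v \<bullet> cross3 (b - a) (c - a) = 0"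
    and st: "0 < s" "0 < t" "s + t < (1::real)"
  shows "dir_deriv v f (a + s *\<^sub>R (b - a) + t *\<^sub>R (c - a)) = L v"
proof -
  obtain \<alpha> \<beta> where ab: "v = \<alpha> *\<^sub>R (b - a) + \<beta> *\<^sub>R (c - a)" using tangential_coordinates[OF v N] .
  obtain \<epsilon> where e: "\<epsilon> > 0" "\<And>r. \<bar>r\<bar> < \<epsilon> \<Longrightarrow>
    a + s *\<^sub>R (b - a) + t *\<^sub>R (c - a) + r *\<^sub>R v \<in> convex hull {a, b, c}"
    unfolding ab using triangle_interior_line[OF st] by metis
  show ?thesis by (rule dir_deriv_affine[OF L f e])
qed

lemma tri_chart_eq:
  "tri_vertices \<sigma> = (a, b, c) \<Longrightarrow> tri_chart \<sigma> (s, t) = a + s *\<^sub>R (b - a) + t *\<^sub>R (c - a)"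
  by (simp add: tri_chart_def)

section \<open>Increments of the potential energy and of the free surface area\<close>

context mesh_step
begin

lemma free_faceE:
  assumes "\<sigma> \<in> free M"
  obtains a b c L q where "tri_vertices \<sigma> = (a, b, c)" "\<sigma> = {a, b, c}" "distinct [a, b, c]"
    "cross3 (b - a) (c - a) \<noteq> 0" "normal_vec \<sigma> = cross3 (b - a) (c - a)"
    "outward_normal M \<sigma> = (boundary_sign M \<sigma> / norm (cross3 (b - a) (c - a))) *\<^sub>R cross3 (b - a) (c - a)"
    "linear L" "\<forall>y\<in>convex hull {a, b, c}. wt y = q + L y"
    "w a = wt a" "w b = wt b" "w c = wt c"
proof -
  have sb: "\<sigma> \<in> boundary_faces M" using subsetD[OF mesh_faces(2)[OF M] assms] .
  then have "card \<sigma> = 3" by (simp add: boundary_faces_def)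
  then obtain a b c where abc: "tri_vertices \<sigma> = (a, b, c)" "\<sigma> = {a, b, c}" "distinct [a, b, c]"
    by (rule tri_verticesE)
  have nv: "normal_vec \<sigma> = cross3 (b - a) (c - a)" by (simp add: normal_vec_def abc(1))
  obtain q L where L: "linear L" "\<And>y. y \<in> convex hull \<sigma> \<Longrightarrow> wt y = q + L y"
    using P1_affineE[OF wt assms] by metis
  have "w x = wt x" if "x \<in> \<sigma>" for x
  proof (rule w_wt)
    show "x \<in> carrier (free M)" unfolding carrier_def using assms hull_inc[OF that] by blast
  qed
  then have ww: "w a = wt a" "w b = wt b" "w c = wt c" using abc(2) by simp_all
  note on = outward_normal_eq(1,2)[OF M sb, unfolded nv]
  have L': "\<forall>y\<in>convex hull {a, b, c}. wt y = q + L y" using L(2) unfolding abc(2) by blast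
  show thesis by (rule that[OF abc on(2) nv on(1) L(1) L' ww])
qed

text \<open>On a face the intermediate normal does not vary in space and the height is affine, so in
  the open face the gravity vector is the linear interpolant of the vertex integrals
  \<open>G\<close>. Both sides become the same mass matrix sum, and integration in time passes
  through a finite sum.\<close>

lemma gravity_face:
  assumes s: "\<sigma> \<in> free M"
  shows "((\<lambda>\<theta>. boundary_sign M \<sigma> * face_flux e \<theta> \<sigma>) has_integral
    \<tau> * (2 * tri_area \<sigma> * integral\<^sup>L (lebesgue_on ref_triangle)
      (\<lambda>p. gravity_vec M \<tau> e wt \<sigma> (tri_chart \<sigma> p) \<bullet> wt (tri_chart \<sigma> p)))) {0..1}"
proof -
  obtain a b c L q where abc: "tri_vertices \<sigma> = (a, b, c)" "\<sigma> = {a, b, c}" "distinct [a, b, c]"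
    and N0: "cross3 (b - a) (c - a) \<noteq> 0" "normal_vec \<sigma> = cross3 (b - a) (c - a)"
    "outward_normal M \<sigma> = (boundary_sign M \<sigma> / norm (cross3 (b - a) (c - a))) *\<^sub>R cross3 (b - a) (c - a)"
    and L0: "linear L" "\<forall>y\<in>convex hull {a, b, c}. wt y = q + L y"
    and ww: "w a = wt a" "w b = wt b" "w c = wt c"
    by (rule free_faceE[OF s])
  note L = L0(1) bspec[OF L0(2)]
  have sb: "\<sigma> \<in> boundary_faces M" using subsetD[OF mesh_faces(2)[OF M] s] .
  define n' where "n' = outward_normal M \<sigma>"
  define B where "B = b - a"
  define C where "C = c - a"
  \<comment> \<open>\<open>\<kappa>\<close> turns the area vector of the face into the unit outward
    normal and allows the tangent frame to be replaced by the two edges. Multiplied by twice the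
    area it leaves just the boundary sign.\<close>
  define \<kappa> where "\<kappa> = boundary_sign M \<sigma> / norm (cross3 B C)"
  have n': "norm n' = 1" "n' = \<kappa> *\<^sub>R cross3 B C"
    using outward_normal_eq(3)[OF M sb] N0(3) by (simp_all add: n'_def \<kappa>_def B_def C_def)
  define Y where "Y = (\<lambda>\<theta> x. inter_pos \<tau> wt \<theta> x)"
  define Nn where "Nn = (\<lambda>\<theta>. cross3 (Y \<theta> b - Y \<theta> a) (Y \<theta> c - Y \<theta> a))"
  define G where "G = (\<lambda>x. integral\<^sup>L (lebesgue_on {0..1}) (\<lambda>\<theta>. (Y \<theta> x \<bullet> e) *\<^sub>R Nn \<theta>))"
  have in_hull: "x \<in> convex hull {a, b, c}" if "x \<in> {a, b, c}" for x using that by (rule hull_inc)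
  have inter: "inter_normal M \<tau> wt \<theta> \<sigma> (a + u *\<^sub>R (b - a) + v *\<^sub>R (c - a)) = \<kappa> *\<^sub>R Nn \<theta>"
    if uv: "0 < u" "0 < v" "u + v < 1" for u v \<theta>
  proof -
    obtain t1 t2 where t: "tangent_frame n' = (t1, t2)" by (cases "tangent_frame n'")
    note tf = tangent_frame_props[OF n'(1) t]
    have k0: "\<kappa> \<noteq> 0" using n' by auto
    have tp: "t1 \<bullet> cross3 (b - a) (c - a) = 0" "t2 \<bullet> cross3 (b - a) (c - a) = 0"
      using tf(1,2) k0 unfolding n'(2) B_def C_def by simp_all
    define A where "A = (\<lambda>y. y + (\<tau> * \<theta>) *\<^sub>R L y)"
    have linA: "linear A" unfolding A_def by (rule linear_id_plus[OF L(1)])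
    have ip: "inter_pos \<tau> wt \<theta> y = (\<tau> * \<theta>) *\<^sub>R q + A y" if "y \<in> convex hull {a, b, c}" for y
      using L(2)[OF that] by (simp add: inter_pos_def A_def scaleR_add_right)
    have dd: "dir_deriv t1 (inter_pos \<tau> wt \<theta>) (a + u *\<^sub>R (b - a) + v *\<^sub>R (c - a)) = A t1"
      "dir_deriv t2 (inter_pos \<tau> wt \<theta>) (a + u *\<^sub>R (b - a) + v *\<^sub>R (c - a)) = A t2"
      using dir_deriv_triangle[OF linA ip N0(1) tp(1) uv] dir_deriv_triangle[OF linA ip N0(1) tp(2)
          uv] by simp_all
    have "cross3 (A t1) (A t2) = \<kappa> *\<^sub>R cross3 (A (b - a)) (A (c - a))"
      by (rule cross3_linear_ratio[OF linA N0(1) tp]) (use tf(3) n'(2) in \<open>simp add: B_def C_def\<close>)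
    moreover have "A (b - a) = Y \<theta> b - Y \<theta> a" "A (c - a) = Y \<theta> c - Y \<theta> a"
      using ip[OF in_hull] by (simp_all add: Y_def linear_diff[OF linA])
    ultimately show ?thesis by (simp add: inter_normal_def n'_def[symmetric] t dd Nn_def)
  qed
  have wch: "wt (a + u *\<^sub>R (b - a) + v *\<^sub>R (c - a)) = wt a + u *\<^sub>R (wt b - wt a) + v *\<^sub>R (wt c - wt a)"
    if "0 \<le> u" "0 \<le> v" "u + v \<le> 1" for u v
    using L(2)[OF convex_combination_3[OF that, of a b c]] L(2)[OF in_hull]
    by (simp add: linear_add[OF L(1)] linear_diff[OF L(1)] linear_scale[OF L(1)])
  have contY: "continuous_on {0..1} (\<lambda>\<theta>. (Y \<theta> x \<bullet> e) *\<^sub>R Nn \<theta>)" for x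
    unfolding Nn_def Y_def inter_pos_def by (intro continuous_intros continuous_on_cross)
  have iG: "integrable (lebesgue_on {0..1}) (\<lambda>\<theta>. (Y \<theta> x \<bullet> e) *\<^sub>R Nn \<theta>)" for x
    by (rule integrable_continuous_on_compact[OF _ contY subset_refl]) auto
  have hG: "((\<lambda>\<theta>. (Y \<theta> x \<bullet> e) *\<^sub>R Nn \<theta>) has_integral G x) {0..1}" for x
    unfolding G_def using lebesgue_integral_eq_integral[OF iG[of x]] integrable_on_lebesgue_on[OF
        iG[of x]]
    by (simp add: has_integral_iff)
  have grav: "gravity_vec M \<tau> e wt \<sigma> (a + u *\<^sub>R (b - a) + v *\<^sub>R (c - a)) =
      \<kappa> *\<^sub>R (G a + u *\<^sub>R (G b - G a) + v *\<^sub>R (G c - G a))"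
    if uv: "0 < u" "0 < v" "u + v < 1" for u v
  proof -
    have "(inter_pos \<tau> wt \<theta> (a + u *\<^sub>R (b - a) + v *\<^sub>R (c - a)) \<bullet> e) *\<^sub>R
        inter_normal M \<tau> wt \<theta> \<sigma> (a + u *\<^sub>R (b - a) + v *\<^sub>R (c - a)) =
      \<kappa> *\<^sub>R ((Y \<theta> a \<bullet> e) *\<^sub>R Nn \<theta> + u *\<^sub>R ((Y \<theta> b \<bullet> e) *\<^sub>R Nn \<theta> - (Y \<theta> a \<bullet> e) *\<^sub>R Nn \<theta>)
         + v *\<^sub>R ((Y \<theta> c \<bullet> e) *\<^sub>R Nn \<theta> - (Y \<theta> a \<bullet> e) *\<^sub>R Nn \<theta>))" for \<theta>
    proof -
      have "inter_pos \<tau> wt \<theta> (a + u *\<^sub>R (b - a) + v *\<^sub>R (c - a)) \<bullet> e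
        = Y \<theta> a \<bullet> e + u * (Y \<theta> b \<bullet> e - Y \<theta> a \<bullet> e) + v * (Y \<theta> c \<bullet> e - Y \<theta> a \<bullet> e)"
        unfolding Y_def inter_pos_def wch[OF less_imp_le[OF uv(1)] less_imp_le[OF uv(2)]
            less_imp_le[OF uv(3)]]
        by (simp add: inner_add_left inner_diff_left algebra_simps)
      then have z: "inter_pos \<tau> wt \<theta> (a + u *\<^sub>R (b - a) + v *\<^sub>R (c - a)) \<bullet> e
        = Y \<theta> a \<bullet> e + u * (Y \<theta> b \<bullet> e - Y \<theta> a \<bullet> e) + v * (Y \<theta> c \<bullet> e - Y \<theta> a \<bullet> e)" .
      show ?thesis unfolding inter[OF uv] z by (simp add: algebra_simps)
    qed
    then show ?thesis unfolding gravity_vec_def G_def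
      by (simp add: iG)
  qed
  have eqI: "gravity_vec M \<tau> e wt \<sigma> (tri_chart \<sigma> p) \<bullet> wt (tri_chart \<sigma> p) =
     (case p of (u, v) \<Rightarrow> (\<kappa> *\<^sub>R G a + u *\<^sub>R (\<kappa> *\<^sub>R G b - \<kappa> *\<^sub>R G a) + v *\<^sub>R (\<kappa> *\<^sub>R G c - \<kappa> *\<^sub>R G a)) \<bullet>
       (wt a + u *\<^sub>R (wt b - wt a) + v *\<^sub>R (wt c - wt a)))"
    if p: "p \<in> ref_triangle - (ref_triangle - {p. 0 < fst p \<and> 0 < snd p \<and> fst p + snd p < 1})" for p
  proof -
    obtain u v where uv: "p = (u, v)" "0 < u" "0 < v" "u + v < 1" using p by (cases p) auto
    show ?thesis unfolding uv(1) prod.case tri_chart_eq[OF abc(1)] grav[OF uv(2-)]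
        wch[OF less_imp_le[OF uv(2)] less_imp_le[OF uv(3)] less_imp_le[OF uv(4)]]
      by (simp add: scaleR_add_right scaleR_diff_right mult.commute)
  qed
  have "integral\<^sup>L (lebesgue_on ref_triangle)
      (\<lambda>p. gravity_vec M \<tau> e wt \<sigma> (tri_chart \<sigma> p) \<bullet> wt (tri_chart \<sigma> p))
    = ((\<kappa> *\<^sub>R G a + \<kappa> *\<^sub>R G b + \<kappa> *\<^sub>R G c) \<bullet> (wt a + wt b + wt c) + (\<kappa> *\<^sub>R G a) \<bullet> wt a + (\<kappa> *\<^sub>R G b)
        \<bullet> wt b
        + (\<kappa> *\<^sub>R G c) \<bullet> wt c) / 24"
    unfolding ref_triangle_integral_product[symmetric]
  proof (rule lebesgue_integral_spike(2)[OF ref_triangle_props(3) negligible_ref_triangle_boundary _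
      eqI])
    show "integrable (lebesgue_on ref_triangle) (\<lambda>p. case p of (u, v) \<Rightarrow>
       (\<kappa> *\<^sub>R G a + u *\<^sub>R (\<kappa> *\<^sub>R G b - \<kappa> *\<^sub>R G a) + v *\<^sub>R (\<kappa> *\<^sub>R G c - \<kappa> *\<^sub>R G a)) \<bullet>
       (wt a + u *\<^sub>R (wt b - wt a) + v *\<^sub>R (wt c - wt a)))"
      unfolding case_prod_unfold
      by (rule integrable_continuous_on_compact[OF ref_triangle_props(1) _ subset_refl
          ref_triangle_props(3)])
        (intro continuous_intros)
  qed
  then have J: "integral\<^sup>L (lebesgue_on ref_triangle)
      (\<lambda>p. gravity_vec M \<tau> e wt \<sigma> (tri_chart \<sigma> p) \<bullet> wt (tri_chart \<sigma> p))
    = \<kappa> * ((G a + G b + G c) \<bullet> (wt a + wt b + wt c) + G a \<bullet> wt a + G b \<bullet> wt b + G c \<bullet> wt c) / 24"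
    by (simp add: scaleR_add_right[symmetric] distrib_left[symmetric])
  have kk: "2 * tri_area \<sigma> * \<kappa> = boundary_sign M \<sigma>"
    using N0(1,2) by (simp add: tri_area_eq_normal_vec \<kappa>_def B_def C_def)
  have I: "2 * tri_area \<sigma> * integral\<^sup>L (lebesgue_on ref_triangle)
      (\<lambda>p. gravity_vec M \<tau> e wt \<sigma> (tri_chart \<sigma> p) \<bullet> wt (tri_chart \<sigma> p)) =
    boundary_sign M \<sigma> * ((G a + G b + G c) \<bullet> (wt a + wt b + wt c) + G a \<bullet> wt a + G b \<bullet> wt b + G c \<bullet>
        wt c) / 24"
    unfolding J kk[symmetric] by simp
  have ffl: "face_flux e \<theta> \<sigma> = \<tau> / 24 * (((Y \<theta> a \<bullet> e) *\<^sub>R Nn \<theta>) \<bullet> (wt a + wt b + wt c) + (((Y \<theta> b \<bullet>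
      e) *\<^sub>R Nn \<theta>) \<bullet> (wt a + wt b + wt c)
      + (((Y \<theta> c \<bullet> e) *\<^sub>R Nn \<theta>) \<bullet> (wt a + wt b + wt c) + (((Y \<theta> a \<bullet> e) *\<^sub>R Nn \<theta>) \<bullet> wt a
      + (((Y \<theta> b \<bullet> e) *\<^sub>R Nn \<theta>) \<bullet> wt b + ((Y \<theta> c \<bullet> e) *\<^sub>R Nn \<theta>) \<bullet> wt c)))))" for \<theta>
  proof -
    have y: "x + \<theta> *\<^sub>R \<tau> *\<^sub>R wt x = Y \<theta> x" for x by (simp add: Y_def inter_pos_def mult.commute)
    have nn: "cross3 (Y \<theta> b - Y \<theta> a) (Y \<theta> c - Y \<theta> a) = Nn \<theta>" by (simp only: Nn_def)
    show ?thesis unfolding face_flux_def abc(1) prod.case ww y tri_flux_def nn inner_commute[of e]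
      by (simp only: inner_add_right inner_scaleR_right inner_scaleR_left) (simp add: algebra_simps)
  qed
  have "((\<lambda>\<theta>. face_flux e \<theta> \<sigma>) has_integral \<tau> / 24 * (G a \<bullet> (wt a + wt b + wt c) + (G b \<bullet> (wt a + wt
      b + wt c)
      + (G c \<bullet> (wt a + wt b + wt c) + (G a \<bullet> wt a + (G b \<bullet> wt b + G c \<bullet> wt c)))))) {0..1}"
    unfolding ffl
    by (intro has_integral_mult_right has_integral_add
        has_integral_linear[OF hG bounded_linear_inner_left, unfolded o_def])
  from has_integral_mult_right[OF this, of "boundary_sign M \<sigma>"]
  show ?thesis unfolding I by (rule has_integral_eq_rhs) (simp add: inner_add_left field_simps)
qed

lemma continuous_on_X: "continuous_on (carrier (tets M)) X"
  using w by (auto simp: P1_def mesh_map_def intro!: continuous_intros)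

text \<open>The mesh map preserves the sign of \<open>vol4\<close>, so one and the same sign turns
  the old and the new moment into integrals.\<close>

lemma tet_moment_change_integral:
  assumes T: "T \<in> tets M"
  shows "((\<lambda>\<theta>. \<Sum>\<sigma>\<in>tet_faces T. face_sign \<sigma> T * face_flux e \<theta> \<sigma>) has_integral
     (integral (convex hull (X ` T)) (\<lambda>x. e \<bullet> x) - integral (convex hull T) (\<lambda>x. e \<bullet> x))) {0..1}"
    and "(\<lambda>x. e \<bullet> x) integrable_on (convex hull T)" "(\<lambda>x. e \<bullet> x) integrable_on (convex hull (X ` T))"
proof -
  obtain a b c d where abcd: "T = {a, b, c, d}" "distinct [a, b, c, d]" and v: "vol4 a b c d \<noteq> 0"
    by (rule tetE[OF M T])
  have inT: "a \<in> T" "b \<in> T" "c \<in> T" "d \<in> T" using abcd by auto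
  have Xinj: "X x = X y \<longleftrightarrow> x = y" if "x \<in> T" "y \<in> T" for x y
    using inj_X tet_vertex_in_carrier[OF T] that by (auto simp: inj_on_def)
  have d': "distinct [X a, X b, X c, X d]" using abcd(2) Xinj inT by simp
  have sg: "sgn (vol4 (X a) (X b) (X c) (X d)) = sgn (vol4 a b c d)" by (rule vol4_image[OF T abcd(1)])
  then have v': "vol4 (X a) (X b) (X c) (X d) \<noteq> 0" using v by (metis sgn_0_0)
  have ab: "\<bar>y\<bar> * z / 24 = sgn y * (y * z / 24)" for y z :: real by (simp add: abs_sgn)
  have i0: "((\<lambda>x. e \<bullet> x) has_integral sgn (vol4 a b c d) * tet_moment e a b c d) (convex hull T)"
    using tet_integral_linear[OF abcd(2) v, of e] unfolding abcd(1) tet_moment_def ab .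
  have XT: "X ` T = {X a, X b, X c, X d}" by (simp add: abcd(1))
  have i1: "((\<lambda>x. e \<bullet> x) has_integral sgn (vol4 a b c d) * tet_moment e (X a) (X b) (X c) (X d))
      (convex hull (X ` T))"
    using tet_integral_linear[OF d' v', of e] unfolding XT tet_moment_def ab sg .
  show "(\<lambda>x. e \<bullet> x) integrable_on (convex hull T)" "(\<lambda>x. e \<bullet> x) integrable_on (convex hull (X ` T))"
    using i0 i1 by blast+
  show "((\<lambda>\<theta>. \<Sum>\<sigma>\<in>tet_faces T. face_sign \<sigma> T * face_flux e \<theta> \<sigma>) has_integral
     (integral (convex hull (X ` T)) (\<lambda>x. e \<bullet> x) - integral (convex hull T) (\<lambda>x. e \<bullet> x))) {0..1}"
    using tet_moment_change[OF T abcd, of e] unfolding integral_unique[OF i0] integral_unique[OF i1]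
        right_diff_distrib .
qed

text \<open>Reynolds' transport theorem on the moving mesh. The flux through a face does not depend
  on the adjacent tetrahedron, since the mesh velocity is single-valued. Interior faces thus cancel
  at every \<theta>, wetted faces carry no flux, and the free faces give the gravity term.\<close>

lemma gravity_change:
  "vol_int (domain N) (\<lambda>x. x \<bullet> e) - vol_int (domain M) (\<lambda>x. x \<bullet> e)
    = \<tau> * surf_int (free M) (\<lambda>\<sigma> x. gravity_vec M \<tau> e wt \<sigma> x \<bullet> wt x)"
proof -
  let ?I = "\<lambda>T. integral (convex hull T) (\<lambda>x. e \<bullet> x)"
  have v0: "vol_int (domain M) (\<lambda>x. x \<bullet> e) = (\<Sum>T\<in>tets M. ?I T)"
    unfolding inner_commute[of _ e]
    by (rule vol_int_domain[OF M]) (auto intro!: continuous_intros integrable_integral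
        tet_moment_change_integral(2))
  have "vol_int (domain N) (\<lambda>x. x \<bullet> e) = (\<Sum>T\<in>tets N. ?I T)"
    unfolding inner_commute[of _ e]
    by (rule vol_int_domain[OF M']) (auto simp: moved_simps intro!: continuous_intros
        integrable_integral tet_moment_change_integral(3))
  also have "\<dots> = (\<Sum>T\<in>tets M. ?I (X ` T))"
    unfolding moved_simps by (subst sum.reindex[OF inj_image_tets]) simp
  finally have v1: "vol_int (domain N) (\<lambda>x. x \<bullet> e) = (\<Sum>T\<in>tets M. ?I (X ` T))" .
  have "((\<lambda>\<theta>. \<Sum>T\<in>tets M. \<Sum>\<sigma>\<in>tet_faces T. face_sign \<sigma> T * face_flux e \<theta> \<sigma>) has_integral
     (\<Sum>T\<in>tets M. ?I (X ` T) - ?I T)) {0..1}"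
    by (intro has_integral_sum finite_tets[OF M] tet_moment_change_integral(1))
  then have 1: "((\<lambda>\<theta>. \<Sum>\<sigma>\<in>boundary_faces M. boundary_sign M \<sigma> * face_flux e \<theta> \<sigma>) has_integral
     (vol_int (domain N) (\<lambda>x. x \<bullet> e) - vol_int (domain M) (\<lambda>x. x \<bullet> e))) {0..1}"
    unfolding sum_over_faces[OF M] v0 v1 sum_subtractf .
  have "(\<Sum>\<sigma>\<in>boundary_faces M. boundary_sign M \<sigma> * face_flux e \<theta> \<sigma>) = (\<Sum>\<sigma>\<in>free M. boundary_sign M \<sigma> *
      face_flux e \<theta> \<sigma>)" for \<theta>
    using mesh_faces(3,4)[OF M] face_flux_solid
    by (intro sum.mono_neutral_right finite_boundary_faces[OF M]) auto
  with 1 have 2: "((\<lambda>\<theta>. \<Sum>\<sigma>\<in>free M. boundary_sign M \<sigma> * face_flux e \<theta> \<sigma>) has_integral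
     (vol_int (domain N) (\<lambda>x. x \<bullet> e) - vol_int (domain M) (\<lambda>x. x \<bullet> e))) {0..1}"
    by simp
  have "((\<lambda>\<theta>. \<Sum>\<sigma>\<in>free M. boundary_sign M \<sigma> * face_flux e \<theta> \<sigma>) has_integral
     (\<Sum>\<sigma>\<in>free M. \<tau> * (2 * tri_area \<sigma> * integral\<^sup>L (lebesgue_on ref_triangle)
      (\<lambda>p. gravity_vec M \<tau> e wt \<sigma> (tri_chart \<sigma> p) \<bullet> wt (tri_chart \<sigma> p))))) {0..1}"
    by (intro has_integral_sum finite_free[OF M] gravity_face)
  from has_integral_unique[OF 2 this] show ?thesis
    by (simp add: surf_int_def sum_distrib_left)
qed

text \<open>In an orthonormal frame of the face the ratio of areas is the norm of
  \<open>cross3 (A t1) (A t2)\<close>, where \<open>A\<close> is the linear part of the map on the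
  face. The implicit gradient term pairs \<open>A v\<close> with \<open>A v - v\<close>, which
  bounds half the increment of the squared length of \<open>v\<close> from above.\<close>

lemma surface_face:
  assumes s: "\<sigma> \<in> free M"
  shows "tri_area (X ` \<sigma>) - tri_area \<sigma> \<le> \<tau> * (2 * tri_area \<sigma> * integral\<^sup>L (lebesgue_on ref_triangle)
    (\<lambda>p. surf_grad (outward_normal M \<sigma>) (\<lambda>x. x + \<tau> *\<^sub>R wt x) (tri_chart \<sigma> p) \<bullet>
      surf_grad (outward_normal M \<sigma>) wt (tri_chart \<sigma> p)))"
proof -
  obtain a b c L q where abc: "tri_vertices \<sigma> = (a, b, c)" "\<sigma> = {a, b, c}" "distinct [a, b, c]"
    and N0: "cross3 (b - a) (c - a) \<noteq> 0" "normal_vec \<sigma> = cross3 (b - a) (c - a)"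
    "outward_normal M \<sigma> = (boundary_sign M \<sigma> / norm (cross3 (b - a) (c - a))) *\<^sub>R cross3 (b - a) (c - a)"
    and L0: "linear L" "\<forall>y\<in>convex hull {a, b, c}. wt y = q + L y"
    and ww: "w a = wt a" "w b = wt b" "w c = wt c"
    by (rule free_faceE[OF s])
  note L = L0(1) bspec[OF L0(2)]
  have sb: "\<sigma> \<in> boundary_faces M" using subsetD[OF mesh_faces(2)[OF M] s] .
  define n' where "n' = outward_normal M \<sigma>"
  define K where "K = cross3 (b - a) (c - a)"
  define \<kappa> where "\<kappa> = boundary_sign M \<sigma> / norm K"
  have n': "norm n' = 1" "n' = \<kappa> *\<^sub>R K"
    using outward_normal_eq(3)[OF M sb] N0(3) by (simp_all add: n'_def \<kappa>_def K_def)
  have k0: "\<kappa> \<noteq> 0" using n' by auto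
  obtain t1 t2 where t: "norm t1 = 1" "norm t2 = 1" "t1 \<bullet> t2 = 0" "t1 \<bullet> n' = 0" "t2 \<bullet> n' = 0"
      "cross3 t1 t2 = n'"
    using orthonormal_frame_exists[OF n'(1)] .
  have tp: "t1 \<bullet> K = 0" "t2 \<bullet> K = 0" using t(4,5) k0 unfolding n'(2) by simp_all
  define A where "A = (\<lambda>y. y + \<tau> *\<^sub>R L y)"
  have linA: "linear A" unfolding A_def by (rule linear_id_plus[OF L(1)])
  have fA: "y + \<tau> *\<^sub>R wt y = \<tau> *\<^sub>R q + A y" if "y \<in> convex hull {a, b, c}" for y
    using L(2)[OF that] by (simp add: A_def scaleR_add_right)
  define S where "S = A t1 \<bullet> L t1 + A t2 \<bullet> L t2"
  have const: "surf_grad n' (\<lambda>x. x + \<tau> *\<^sub>R wt x) (tri_chart \<sigma> p) \<bullet> surf_grad n' wt (tri_chart \<sigma> p) = S"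
    if p: "p \<in> ref_triangle - (ref_triangle - {p. 0 < fst p \<and> 0 < snd p \<and> fst p + snd p < 1})" for p
  proof -
    obtain u v where uv: "p = (u, v)" "0 < u" "0 < v" "u + v < 1" using p by (cases p) auto
    have tv: "tang_proj n' y \<bullet> cross3 (b - a) (c - a) = 0" for y
      unfolding tang_proj_frame[OF t] K_def[symmetric] using tp by (simp add: inner_add_left)
    have "surf_grad n' (\<lambda>x. x + \<tau> *\<^sub>R wt x) (tri_chart \<sigma> p) = matrix (\<lambda>y. A (tang_proj n' y))"
      "surf_grad n' wt (tri_chart \<sigma> p) = matrix (\<lambda>y. L (tang_proj n' y))"
      unfolding surf_grad_def uv(1) tri_chart_eq[OF abc(1)]
      using dir_deriv_triangle[OF linA fA N0(1) tv uv(2-)] dir_deriv_triangle[OF L N0(1) tv uv(2-)]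
          by simp_all
    then show ?thesis unfolding tang_proj_frame[OF t]
      by (simp only: inner_matrix_tangential[OF linA L(1) t(1-3)] S_def)
  qed
  have I: "integral\<^sup>L (lebesgue_on ref_triangle)
    (\<lambda>p. surf_grad n' (\<lambda>x. x + \<tau> *\<^sub>R wt x) (tri_chart \<sigma> p) \<bullet> surf_grad n' wt (tri_chart \<sigma> p)) = S / 2"
    unfolding integral_ref_triangle_const[symmetric]
    by (rule lebesgue_integral_spike(2)[OF ref_triangle_props(3) negligible_ref_triangle_boundary
        integrable_ref_triangle_const const])
  have area: "tri_area \<sigma> = norm K / 2" by (simp add: tri_area_eq_normal_vec N0(2) K_def)
  have in_hull: "x \<in> convex hull {a, b, c}" if "x \<in> {a, b, c}" for x using that by (rule hull_inc)
  have Xv: "X x = \<tau> *\<^sub>R q + A x" if "x \<in> {a, b, c}" for x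
    using fA[OF in_hull[OF that]] ww that by (auto simp: mesh_map_def)
  have Xinj: "X x = X y \<longleftrightarrow> x = y" if "x \<in> \<sigma>" "y \<in> \<sigma>" for x y
    using inj_X face_vertex_in_carrier[OF sb] that by (auto simp: inj_on_def)
  have "distinct [X a, X b, X c]" using abc Xinj by simp
  then have "tri_area {X a, X b, X c} = norm (cross3 (X b - X a) (X c - X a)) / 2" by (rule tri_area_eq)
  moreover have "X b - X a = A (b - a)" "X c - X a = A (c - a)" using Xv by (simp_all add:
      linear_diff[OF linA])
  moreover have "X ` \<sigma> = {X a, X b, X c}" by (simp add: abc(2))
  ultimately have area': "tri_area (X ` \<sigma>) = norm (cross3 (A (b - a)) (A (c - a))) / 2" by simp
  have "cross3 (A t1) (A t2) = \<kappa> *\<^sub>R cross3 (A (b - a)) (A (c - a))"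
    by (rule cross3_linear_ratio[OF linA N0(1)]) (use tp t(6) n'(2) in \<open>simp_all add: K_def\<close>)
  then have "norm (cross3 (A t1) (A t2)) = \<bar>\<kappa>\<bar> * norm (cross3 (A (b - a)) (A (c - a)))" by simp
  moreover have "\<bar>\<kappa>\<bar> * norm K = 1" using n' by simp
  ultimately have "norm (cross3 (A (b - a)) (A (c - a))) = norm K * norm (cross3 (A t1) (A t2))"
    by (metis mult.assoc mult.commute mult.right_neutral)
  moreover have "norm (cross3 (A t1) (A t2)) \<le> (A t1 \<bullet> A t1 + A t2 \<bullet> A t2) / 2"
  proof -
    have "(norm (cross3 (A t1) (A t2)))\<^sup>2 \<le> (norm (A t1) * norm (A t2))\<^sup>2"
      using norm_cross_dot[of "A t1" "A t2"] zero_le_power2[of "A t1 \<bullet> A t2"] by linarith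
    then have "norm (cross3 (A t1) (A t2)) \<le> norm (A t1) * norm (A t2)" by (rule power2_le_imp_le) simp
    moreover have "2 * (norm (A t1) * norm (A t2)) \<le> (norm (A t1))\<^sup>2 + (norm (A t2))\<^sup>2"
      using sum_squares_bound[of "norm (A t1)" "norm (A t2)"] by simp
    ultimately show ?thesis by (simp add: power2_norm_eq_inner)
  qed
  moreover have "(A t1 \<bullet> A t1 + A t2 \<bullet> A t2) / 2 - 1 \<le> \<tau> * S"
  proof -
    have h: "A v \<bullet> A v / 2 - 1/2 \<le> \<tau> * (A v \<bullet> L v)" if "norm v = 1" for v
    proof -
      have "\<tau> *\<^sub>R L v = A v - v" by (simp add: A_def)
      then have "\<tau> * (A v \<bullet> L v) = A v \<bullet> (A v - v)" by (metis inner_scaleR_right)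
      moreover have "0 \<le> (A v - v) \<bullet> (A v - v)" by (rule inner_ge_zero)
      moreover have "v \<bullet> v = 1" using that by (simp add: norm_eq_1)
      ultimately show ?thesis by (simp add: inner_diff_left inner_diff_right inner_commute)
    qed
    show ?thesis using h[OF t(1)] h[OF t(2)] unfolding S_def distrib_left add_divide_distrib by linarith
  qed
  ultimately have "tri_area (X ` \<sigma>) - tri_area \<sigma> \<le> norm K / 2 * (\<tau> * S)"
  proof -
    assume 1: "norm (cross3 (A (b - a)) (A (c - a))) = norm K * norm (cross3 (A t1) (A t2))"
      and 2: "norm (cross3 (A t1) (A t2)) \<le> (A t1 \<bullet> A t1 + A t2 \<bullet> A t2) / 2"
      and 3: "(A t1 \<bullet> A t1 + A t2 \<bullet> A t2) / 2 - 1 \<le> \<tau> * S"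
    have "norm K / 2 * (norm (cross3 (A t1) (A t2)) - 1) \<le> norm K / 2 * (\<tau> * S)"
      by (rule mult_left_mono) (use 2 3 in linarith, simp)
    then show ?thesis unfolding area area' 1 by (simp add: algebra_simps)
  qed
  then show ?thesis unfolding n'_def[symmetric] I by (simp add: area algebra_simps)
qed

lemma surface_area_change:
  "surface_area (free N) - surface_area (free M) \<le> \<tau> * surf_grad_ip M (free M) (\<lambda>x. x + \<tau> *\<^sub>R wt x) wt"
proof -
  have "surface_area (free N) = (\<Sum>\<sigma>\<in>free M. tri_area (X ` \<sigma>))"
    unfolding surface_area_def moved_simps
    by (subst sum.reindex) (use inj_on_subset[OF inj_image_faces mesh_faces(2)[OF M]] in auto)
  then have "surface_area (free N) - surface_area (free M) = (\<Sum>\<sigma>\<in>free M. tri_area (X ` \<sigma>) - tri_area \<sigma>)"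
    by (simp add: surface_area_def sum_subtractf)
  also have "\<dots> \<le> (\<Sum>\<sigma>\<in>free M. \<tau> * (2 * tri_area \<sigma> * integral\<^sup>L (lebesgue_on ref_triangle)
    (\<lambda>p. surf_grad (outward_normal M \<sigma>) (\<lambda>x. x + \<tau> *\<^sub>R wt x) (tri_chart \<sigma> p) \<bullet>
      surf_grad (outward_normal M \<sigma>) wt (tri_chart \<sigma> p))))"
    by (rule sum_mono) (rule surface_face)
  also have "\<dots> = \<tau> * surf_grad_ip M (free M) (\<lambda>x. x + \<tau> *\<^sub>R wt x) wt"
    by (simp add: surf_grad_ip_def surf_int_def sum_distrib_left)
  finally show ?thesis .
qed

end

section \<open>Weak derivatives and traces of finite element functions\<close>

lemma integral_translation_lebesgue:
  fixes F :: "pt \<Rightarrow> real"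
  assumes "continuous_on UNIV F"
  shows "integral\<^sup>L lebesgue (\<lambda>x. F (x + c)) = integral\<^sup>L lebesgue F"
proof -
  have m: "F \<in> borel_measurable borel" using assms by (rule borel_measurable_continuous_onI)
  have "integral\<^sup>L lborel (\<lambda>x. F (c + x)) = integral\<^sup>L (distr lborel borel ((+) c)) F"
    by (subst integral_distr) (use m in auto)
  also have "\<dots> = integral\<^sup>L lborel F" by (simp add: lborel_distr_plus)
  finally have 1: "integral\<^sup>L lborel (\<lambda>x. F (x + c)) = integral\<^sup>L lborel F" by (simp add: add.commute)
  have "(\<lambda>x. F (x + c)) \<in> borel_measurable lborel" using m by measurable
  then show ?thesis using m 1 by (simp add: integral_completion)
qed

lemma integrable_continuous_compact_support:
  fixes F :: "pt \<Rightarrow> real"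
  assumes "continuous_on UNIV F" "compact K" "\<And>x. x \<notin> K \<Longrightarrow> F x = 0"
  shows "integrable lebesgue F"
proof -
  have "integrable lborel (\<lambda>x. indicator K x *\<^sub>R F x)"
    by (rule borel_integrable_compact[OF assms(2)]) (rule continuous_on_subset[OF assms(1)], simp)
  moreover have "(\<lambda>x. indicator K x *\<^sub>R F x) = F" using assms(3) by (auto simp: fun_eq_iff indicator_def)
  moreover have "F \<in> borel_measurable borel" using assms(1) by (rule borel_measurable_continuous_onI)
  ultimately show ?thesis by (simp add: integrable_completion)
qed

text \<open>The integrals of the difference quotients vanish by translation invariance, and the quotients
  converge dominatedly.\<close>

lemma integral_directional_derivative_zero:
  fixes F G :: "pt \<Rightarrow> real" and e :: pt
  assumes F: "continuous_on UNIV F" and K: "compact K" "\<And>x. x \<notin> K \<Longrightarrow> F x = 0" and e: "norm e = 1"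
    and lip: "\<delta> > 0" "\<And>x h. 0 < h \<Longrightarrow> h < \<delta> \<Longrightarrow> \<bar>F (x + h *\<^sub>R e) - F x\<bar> \<le> C * h"
    and G: "G \<in> borel_measurable lebesgue" and Z: "negligible Z"
    and der: "\<And>x. x \<notin> Z \<Longrightarrow> ((\<lambda>t. F (x + t *\<^sub>R e)) has_real_derivative G x) (at 0)"
  shows "integral\<^sup>L lebesgue G = 0"
proof -
  \<comment> \<open>The offset 2 keeps every step, including the first, at most half of
    \<open>min \<delta> 1\<close>. Steps below \<open>\<delta>\<close> admit the Lipschitz bound,
    and steps of length at most 1 keep the quotients supported in the ball of radius
    \<open>R + 1\<close>.\<close>
  define h where "h = (\<lambda>k::nat. min \<delta> 1 / (real k + 2))"
  define q where "q = (\<lambda>k x. (F (x + h k *\<^sub>R e) - F x) / h k)"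
  have h: "0 < h k" "h k < \<delta>" "h k \<le> 1" for k
  proof -
    show "0 < h k" using lip(1) by (simp add: h_def)
    have "h k \<le> min \<delta> 1 / 2" unfolding h_def using lip(1) by (intro divide_left_mono) auto
    then show "h k < \<delta>" "h k \<le> 1" using lip(1) by linarith+
  qed
  have h0: "h \<longlonglongrightarrow> 0"
    unfolding h_def using tendsto_divide_0[OF tendsto_const filterlim_at_top_imp_at_infinity[OF
        filterlim_tendsto_add_at_top[OF tendsto_const filterlim_real_sequentially]], of "min \<delta> 1" 2]
        by (simp add: add.commute)
  obtain R where R: "\<And>x. x \<in> K \<Longrightarrow> norm x \<le> R" using compact_imp_bounded[OF K(1)] by (auto simp:
      bounded_iff)
  have Fs: "continuous_on UNIV (\<lambda>x. F (x + c))" for c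
    by (intro continuous_on_compose2[OF F] continuous_intros) auto
  have ish: "integrable lebesgue (\<lambda>x. F (x + c))" for c
  proof (rule integrable_continuous_compact_support[OF Fs])
    show "compact ((\<lambda>x. x - c) ` K)" using K(1) by (intro compact_continuous_image continuous_intros)
    fix x assume x: "x \<notin> (\<lambda>x. x - c) ` K"
    have "x + c \<notin> K"
    proof
      assume "x + c \<in> K"
      then have "(x + c) - c \<in> (\<lambda>x. x - c) ` K" by (rule imageI)
      then show False using x by simp
    qed
    then show "F (x + c) = 0" by (rule K(2))
  qed
  have iq: "integrable lebesgue (q k)" for k
    unfolding q_def using ish[of "h k *\<^sub>R e"] ish[of 0] by simp
  have q0: "integral\<^sup>L lebesgue (q k) = 0" for k
    unfolding q_def using ish[of "h k *\<^sub>R e"] ish[of 0] integral_translation_lebesgue[OF F, of "h k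
        *\<^sub>R e"] by simp
  have "(\<lambda>k. integral\<^sup>L lebesgue (q k)) \<longlonglongrightarrow> integral\<^sup>L lebesgue G"
  proof (rule integral_dominated_convergence)
    show "G \<in> borel_measurable lebesgue" by (rule G)
    show "q k \<in> borel_measurable lebesgue" for k using iq by (rule borel_measurable_integrable)
    show "integrable lebesgue (\<lambda>x::pt. \<bar>C\<bar> * indicator (cball 0 (R + 1)) x)"
      by (intro integrable_mult_right integrable_real_indicator) (use
          emeasure_lborel_cball_finite[of "0::pt" "R + 1"] in auto)
    show "AE x in lebesgue. (\<lambda>k. q k x) \<longlonglongrightarrow> G x"
    proof (rule AE_I'[OF Z[unfolded negligible_iff_null_sets]], safe, rule ccontr)
      fix x assume nl: "\<not> (\<lambda>k. q k x) \<longlonglongrightarrow> G x" and "x \<notin> Z"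
      then have "((\<lambda>t. (F (x + t *\<^sub>R e) - F x) / t) \<longlongrightarrow> G x) (at 0)"
        using der[of x] by (simp add: has_field_derivative_def DERIV_def[unfolded
            has_field_derivative_def])
      moreover have "filterlim h (at 0) sequentially"
        using h0 h(1) by (auto simp: filterlim_at less_imp_neq[symmetric] intro!: always_eventually) 
      ultimately have "(\<lambda>k. (F (x + h k *\<^sub>R e) - F x) / h k) \<longlonglongrightarrow> G x"
        by (rule filterlim_compose)
      then show False using nl by (simp add: q_def)
    qed
    show "AE x in lebesgue. norm (q k x) \<le> \<bar>C\<bar> * indicator (cball 0 (R + 1)) x" for k
    proof (rule AE_I2)
      fix x :: pt
      have b: "\<bar>q k x\<bar> \<le> C"
        using lip(2)[OF h(1)[of k] h(2)[of k], of x] h(1)[of k] by (simp add: q_def abs_divide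
            pos_divide_le_eq)
      show "norm (q k x) \<le> \<bar>C\<bar> * indicator (cball 0 (R + 1)) x"
      proof (cases "x \<in> cball 0 (R + 1)")
        case True
        then show ?thesis using b by simp
      next
        case False
        then have nx: "norm x > R + 1" by simp
        have "norm x \<le> norm (x + h k *\<^sub>R e) + norm (h k *\<^sub>R e)"
          using norm_triangle_ineq4[of "x + h k *\<^sub>R e" "h k *\<^sub>R e"] by simp
        moreover have "norm (h k *\<^sub>R e) \<le> 1" using h[of k] e by simp
        ultimately have "norm (x + h k *\<^sub>R e) > R" "norm x > R" using nx by linarith+
        then have "x + h k *\<^sub>R e \<notin> K" "x \<notin> K" using R by fastforce+
        then show ?thesis by (simp add: q_def K(2))
      qed
    qed
  qed
  then show ?thesis by (simp add: q0 LIMSEQ_const_iff)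
qed

section \<open>Quadratic finite element functions: local derivatives and Lipschitz bounds\<close>

lemma P2_quadraticE:
  assumes "u \<in> P2 C" "V \<in> C"
  obtains k L B where "linear L" "bilinear B" "\<forall>x\<in>convex hull V. u x = k + L x + B x x"
  using assms unfolding P2_def by blast

lemma P2_continuous: "u \<in> P2 C \<Longrightarrow> continuous_on (carrier C) u"
  by (simp add: P2_def)

lemma has_derivative_quadratic:
  fixes L :: "pt \<Rightarrow> pt"
  assumes "linear L" "bilinear B"
  shows "((\<lambda>x. k + L x + B x x) has_derivative (\<lambda>h. L h + (B x h + B h x))) (at x)"
proof -
  have B: "bounded_bilinear B" using assms(2) by (simp add: bilinear_conv_bounded_bilinear)
  have "(L has_derivative L) (at x)" using assms(1) by (simp add: bounded_linear_imp_has_derivative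
      linear_linear)
  moreover have "((\<lambda>x. B x x) has_derivative (\<lambda>h. B x h + B h x)) (at x)"
    by (rule bounded_bilinear.FDERIV[OF B has_derivative_ident has_derivative_ident])
  ultimately have "((\<lambda>x. k + (L x + B x x)) has_derivative (\<lambda>h. 0 + (L h + (B x h + B h x)))) (at x)"
    by (intro has_derivative_add has_derivative_const)
  then show ?thesis by (simp add: add.assoc)
qed

lemma continuous_jacobian_quadratic:
  fixes L :: "pt \<Rightarrow> pt"
  assumes "bilinear B"
  shows "continuous_on UNIV (\<lambda>x. matrix (\<lambda>h. L h + (B x h + B h x)))"
proof -
  have B: "bounded_bilinear B" using assms by (simp add: bilinear_conv_bounded_bilinear)
  show ?thesis unfolding matrix_def
    by (intro continuous_on_vec_lambda continuous_intros bounded_bilinear.continuous_on[OF B])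
qed

text \<open>\<open>J\<close> is the derivative of the local polynomial. It is continuous on the
  whole space, although the Jacobian of \<open>u\<close> may jump across faces, and so provides
  explicit integrable representatives.\<close>

lemma P2_jacobian:
  fixes u :: "pt \<Rightarrow> pt"
  assumes "u \<in> P2 (tets M)" "T \<in> tets M"
  obtains J where "continuous_on UNIV J" "\<forall>x\<in>interior (convex hull T). jacobian u (at x) = J x"
    "\<forall>x\<in>interior (convex hull T). (u has_derivative (\<lambda>h. J x *v h)) (at x)"
proof -
  obtain k L B where LB: "linear L" "bilinear B" "\<forall>x\<in>convex hull T. u x = k + L x + B x x"
    by (rule P2_quadraticE[OF assms])
  define J where "J = (\<lambda>x. matrix (\<lambda>h. L h + (B x h + B h x)))"
  have d: "(u has_derivative (\<lambda>h. L h + (B x h + B h x))) (at x)" if "x \<in> interior (convex hull T)" for x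
    by (rule has_derivative_on_simplex[OF has_derivative_quadratic[OF LB(1,2)] _ that]) (use LB(3)
        in blast)
  have j: "(\<lambda>h. J x *v h) = (\<lambda>h. L h + (B x h + B h x))" if "x \<in> interior (convex hull T)" for x
    unfolding J_def using matrix_vector_mul(3)[OF has_derivative_bounded_linear[OF d[OF that]]] .
  show thesis
  proof (rule that[of J])
    show "continuous_on UNIV J" unfolding J_def by (rule continuous_jacobian_quadratic[OF LB(2)])
    show "\<forall>x\<in>interior (convex hull T). jacobian u (at x) = J x" using jacobian_eqI[OF d] by (auto
        simp: J_def)
    show "\<forall>x\<in>interior (convex hull T). (u has_derivative (\<lambda>h. J x *v h)) (at x)" by (intro ballI)
        (simp only: j d)
  qed
qed

lemma interiors_disjoint:
  assumes M: "valid_mesh M" "S \<in> tets M" "T \<in> tets M" "S \<noteq> T"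
  shows "interior (convex hull S) \<inter> interior (convex hull T) = {}"
  using negligible_tet_intersection[OF assms] negligible_convex_interior[of "convex hull S \<inter> convex
      hull T"]
  by (simp add: convex_Int interior_Int)

text \<open>The open tetrahedra are disjoint, so the sum of the \<open>g T\<close> cut off by
  indicators agrees with \<open>f\<close> off the skeleton.\<close>

lemma integrable_piecewise:
  fixes f :: "pt \<Rightarrow> 'b::euclidean_space"
  assumes M: "valid_mesh M" and g: "\<And>T. T \<in> tets M \<Longrightarrow> continuous_on UNIV (g T)"
    and f: "\<And>T x. T \<in> tets M \<Longrightarrow> x \<in> interior (convex hull T) \<Longrightarrow> f x = g T x"
  shows "integrable (lebesgue_on (domain M)) f"
proof (rule lebesgue_integral_spike(1)[OF domain_props(3) negligible_domain_skeleton[OF M]])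
  define F where "F = (\<lambda>x. \<Sum>T\<in>tets M. indicator (interior (convex hull T)) x *\<^sub>R g T x)"
  show "integrable (lebesgue_on (domain M)) F"
    unfolding F_def
  proof (rule Bochner_Integration.integrable_sum, rule integrable_mult_indicator)
    fix T assume T: "T \<in> tets M"
    show "interior (convex hull T) \<in> sets (lebesgue_on (domain M))"
      using interior_tet_subset_domain[OF T] domain_props(3)[of M]
      by (simp add: sets_restrict_space_iff borel_open)
    show "integrable (lebesgue_on (domain M)) (g T)"
      by (rule integrable_continuous_on_compact[OF compact_carrier[OF M] _ domain_props(1,3)])
        (rule continuous_on_subset[OF g[OF T]], simp)
  qed
  fix x assume "x \<in> domain M - (domain M - (\<Union>T\<in>tets M. interior (convex hull T)))"
  then obtain T where T: "T \<in> tets M" "x \<in> interior (convex hull T)" by blast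
  have "F x = (\<Sum>S\<in>{T}. indicator (interior (convex hull S)) x *\<^sub>R g S x)"
    unfolding F_def using interiors_disjoint[OF M _ T(1)] T
    by (intro sum.mono_neutral_right finite_tets[OF M]) (auto simp: indicator_def)
  then show "f x = F x" using T f by simp
qed

text \<open>The quadratic part splits as \<open>B x x - B y y = B x (x - y) + B (x - y) y\<close>,
  and each of the two terms contributes \<open>R * b2\<close> to the constant.\<close>

lemma quadratic_lipschitz_on_compact:
  fixes L :: "pt \<Rightarrow> pt"
  assumes "linear L" "bilinear B" "bounded S"
  obtains c where "c \<ge> 0" "\<forall>x\<in>S. \<forall>y\<in>S. norm ((k + L x + B x x) - (k + L y + B y y)) \<le> c * norm (x - y)"
proof -
  have B: "bounded_bilinear B" using assms(2) by (simp add: bilinear_conv_bounded_bilinear)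
  obtain b1 where b1: "\<And>x. norm (L x) \<le> norm x * b1" "b1 \<ge> 0"
    using bounded_linear.nonneg_bounded[of L] assms(1) linear_linear by blast
  obtain b2 where b2: "\<And>x y. norm (B x y) \<le> norm x * norm y * b2" "b2 \<ge> 0"
    using bounded_bilinear.nonneg_bounded[OF B] by blast
  obtain R where R: "\<And>x. x \<in> S \<Longrightarrow> norm x \<le> R" "R > 0" using assms(3) by (auto simp: bounded_pos)
  show thesis
  proof (rule that[of "b1 + 2 * R * b2"])
    show "b1 + 2 * R * b2 \<ge> 0" using b1(2) b2(2) R(2) by simp
    show "\<forall>x\<in>S. \<forall>y\<in>S. norm ((k + L x + B x x) - (k + L y + B y y)) \<le> (b1 + 2 * R * b2) * norm (x - y)"
    proof (intro ballI)
      fix x y assume xy: "x \<in> S" "y \<in> S"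
      have "(k + L x + B x x) - (k + L y + B y y) = L (x - y) + B x (x - y) + B (x - y) y"
        by (simp add: linear_diff[OF assms(1)] bounded_bilinear.diff_left[OF B]
            bounded_bilinear.diff_right[OF B])
      also have "norm \<dots> \<le> norm (L (x - y)) + norm (B x (x - y)) + norm (B (x - y) y)"
        by (meson norm_triangle_ineq norm_triangle_le order_trans add_mono order_refl)
      also have "\<dots> \<le> norm (x - y) * b1 + R * norm (x - y) * b2 + norm (x - y) * R * b2"
      proof (intro add_mono)
        show "norm (L (x - y)) \<le> norm (x - y) * b1" by (rule b1)
        show "norm (B x (x - y)) \<le> R * norm (x - y) * b2"
          using R(1)[OF xy(1)] b2(2) by (intro order_trans[OF b2(1)] mult_right_mono) auto
        show "norm (B (x - y) y) \<le> norm (x - y) * R * b2"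
          using R(1)[OF xy(2)] b2(2) by (intro order_trans[OF b2(1)] mult_right_mono mult_left_mono) auto
      qed
      finally show "norm ((k + L x + B x x) - (k + L y + B y y)) \<le> (b1 + 2 * R * b2) * norm (x - y)"
        by (simp add: algebra_simps)
    qed
  qed
qed

text \<open>A segment in the domain is cut into finitely many pieces by the tetrahedra.\<close>

lemma P2_lipschitz_on_segments:
  fixes u :: "pt \<Rightarrow> pt"
  assumes M: "valid_mesh M" and u: "u \<in> P2 (tets M)"
  obtains c where "c \<ge> 0"
    "\<And>x y. closed_segment x y \<subseteq> carrier (tets M) \<Longrightarrow> norm (u y - u x) \<le> c * norm (y - x)"
proof -
  have "\<exists>c\<ge>0. \<forall>x\<in>convex hull T. \<forall>y\<in>convex hull T. norm (u x - u y) \<le> c * norm (x - y)" if T: "T \<in>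
      tets M" for T
  proof -
    obtain k L B where LB: "linear L" "bilinear B" "\<forall>x\<in>convex hull T. u x = k + L x + B x x"
      by (rule P2_quadraticE[OF u T])
    have "bounded (convex hull T)" using finite_tet[OF M T] finite_imp_bounded_convex_hull by blast
    then obtain c where "c \<ge> 0" "\<forall>x\<in>convex hull T. \<forall>y\<in>convex hull T. norm ((k + L x + B x x) - (k +
        L y + B y y)) \<le> c * norm (x - y)"
      using quadratic_lipschitz_on_compact[OF LB(1,2)] by metis
    then show ?thesis using LB(3) by (intro exI[of _ c]) simp
  qed
  then obtain c where c: "\<And>T. T \<in> tets M \<Longrightarrow> c T \<ge> 0"
    "\<And>T x y. T \<in> tets M \<Longrightarrow> x \<in> convex hull T \<Longrightarrow> y \<in> convex hull T \<Longrightarrow> norm (u x - u y) \<le> c T * norm (x - y)"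
    by metis
  define m where "m = (\<Sum>T\<in>tets M. c T)"
  have cm: "c T \<le> m" if "T \<in> tets M" for T
    unfolding m_def using finite_tets[OF M] that c(1) by (intro member_le_sum) auto
  have m0: "m \<ge> 0" unfolding m_def by (intro sum_nonneg c(1))
  show thesis
  proof (rule that[OF m0])
    fix x y assume seg: "closed_segment x y \<subseteq> carrier (tets M)"
    define p where "p = (\<lambda>t::real. x + t *\<^sub>R (y - x))"
    \<comment> \<open>\<open>U T\<close> collects the parameters at which the segment is in
      \<open>T\<close>. A Lipschitz bound on finitely many closed sets covering the interval extends
      to the interval. The carrier may be nonconvex, which is why only segments inside it are
      compared.\<close>
    define U where "U = (\<lambda>T. {0..1} \<inter> p -` (convex hull T))"
    have pseg: "p t \<in> closed_segment x y" if "t \<in> {0..1}" for t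
      unfolding closed_segment_def p_def mem_Collect_eq
      using that by (intro exI[of _ t]) (simp add: algebra_simps)
    have "(m * norm (y - x))-lipschitz_on {0..1} (\<lambda>t. u (p t))"
    proof (rule lipschitz_on_closed_Union[of "tets M"])
      show "closed (U T)" if "T \<in> tets M" for T
      proof -
        have "closed (convex hull T)" using finite_imp_compact_convex_hull[OF finite_tet[OF M that]]
            compact_imp_closed by blast
        then show ?thesis unfolding U_def p_def
          by (intro closed_Int continuous_closed_vimage) (auto intro!: continuous_intros)
      qed
      show "(m * norm (y - x))-lipschitz_on (U T) (\<lambda>t. u (p t))" if "T \<in> tets M" for T
      proof (rule lipschitz_onI)
        show "0 \<le> m * norm (y - x)" using m0 by simp
        fix s t assume "s \<in> U T" "t \<in> U T"
        then have "norm (u (p s) - u (p t)) \<le> c T * norm (p s - p t)"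
          using c(2)[OF that] by (auto simp: U_def)
        also have "\<dots> \<le> m * norm (p s - p t)" using cm[OF that] by (intro mult_right_mono) auto
        also have "p s - p t = (s - t) *\<^sub>R (y - x)" by (simp add: p_def algebra_simps)
        finally show "dist (u (p s)) (u (p t)) \<le> m * norm (y - x) * dist s t"
          by (simp add: dist_norm mult.commute mult.left_commute)
      qed
      show "{0..1} \<subseteq> (\<Union>T\<in>tets M. U T)"
        using pseg seg by (fastforce simp: U_def carrier_def)
    qed (use finite_tets[OF M] m0 in auto)
    from lipschitz_onD[OF this, of 1 0] show "norm (u y - u x) \<le> m * norm (y - x)"
      by (simp add: p_def dist_norm)
  qed
qed

lemma smooth_partial_continuous:
  assumes "smooth \<phi>"
  shows "continuous_on UNIV \<phi>" "continuous_on UNIV (partial_deriv j \<phi>)" "\<phi> differentiable at x"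
proof -
  have d: "\<forall>x. \<psi> differentiable at x" if "smooth \<psi>" for \<psi> using that by (cases rule: smooth.cases) auto
  have p: "smooth (partial_deriv j \<phi>)" using assms by (cases rule: smooth.cases) auto
  have c: "continuous_on UNIV \<psi>" if "smooth \<psi>" for \<psi>
    using d[OF that] by (simp add: continuous_at_imp_continuous_on differentiable_imp_continuous_within)
  show "continuous_on UNIV \<phi>" "continuous_on UNIV (partial_deriv j \<phi>)" "\<phi> differentiable at x"
    using c[OF assms] c[OF p] d[OF assms] by auto
qed

lemma has_real_derivative_along:
  fixes f :: "pt \<Rightarrow> real"
  assumes "(f has_derivative f') (at (x + t *\<^sub>R e))"
  shows "((\<lambda>t. f (x + t *\<^sub>R e)) has_real_derivative f' e) (at t)"
proof -
  have "((\<lambda>t. x + t *\<^sub>R e) has_vector_derivative e) (at t)" by (auto intro!: derivative_eq_intros)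
  then have "((f \<circ> (\<lambda>t. x + t *\<^sub>R e)) has_vector_derivative f' e) (at t)"
    by (rule vector_derivative_diff_chain_within) (use assms has_derivative_at_withinI in blast)
  then show ?thesis by (simp add: o_def has_real_derivative_iff_has_vector_derivative)
qed

lemma smooth_partial_derivative:
  assumes "smooth \<phi>"
  shows "((\<lambda>t. \<phi> (x + t *\<^sub>R axis j 1)) has_real_derivative partial_deriv j \<phi> (x + t *\<^sub>R axis j 1))
      (at t)"
  unfolding partial_deriv_def
  using smooth_partial_continuous(3)[OF assms, of "x + t *\<^sub>R axis j 1"]
  by (intro has_real_derivative_along) (simp add: frechet_derivative_works)

text \<open>The product of \<open>u x $ i\<close> and the test function, extended by zero, is
  Lipschitz in direction \<open>e\<close> and differentiable off a null set, so its derivative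
  integrates to zero; the product rule separates the two terms. Lipschitz continuity across faces
  replaces the cancellation of boundary integrals between tetrahedra.\<close>

lemma weak_derivative_P2:
  fixes u :: "pt \<Rightarrow> pt"
  assumes M: "valid_mesh M" and u: "u \<in> P2 (tets M)" and test: "test_function (domain M) \<phi>"
  shows "vol_int (domain M) (\<lambda>x. u x $ i * partial_deriv j \<phi> x) =
    - vol_int (domain M) (\<lambda>x. jacobian u (at x) $ i $ j * \<phi> x)"
proof -
  define \<Omega> where "\<Omega> = domain M"
  define K where "K = closure {x. \<phi> x \<noteq> 0}"
  define e :: pt where "e = axis j 1"
  define F where "F = (\<lambda>x. if x \<in> \<Omega> then u x $ i * \<phi> x else 0)"
  define g where "g = (\<lambda>x. u x $ i * partial_deriv j \<phi> x + jacobian u (at x) $ i $ j * \<phi> x)"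
  define Z where "Z = \<Omega> - (\<Union>T\<in>tets M. interior (convex hull T))"
  have ne: "norm e = 1" by (simp add: e_def)
  have sm: "smooth \<phi>" and K: "compact K" "K \<subseteq> \<Omega>"
    using test by (auto simp: test_function_def K_def \<Omega>_def)
  note cont\<phi> = smooth_partial_continuous(1)[OF sm] smooth_partial_continuous(2)[OF sm, of j]
  have \<phi>0: "\<phi> x = 0" if "x \<notin> K" for x using that closure_subset[of "{x. \<phi> x \<noteq> 0}"] by (auto simp: K_def)
  have F0: "F x = 0" if "x \<notin> K" for x using \<phi>0[OF that] by (simp add: F_def)
  have op: "open \<Omega>" "open (- K)" using domain_props(2) K(1) by (auto simp: \<Omega>_def compact_imp_closed)
  have cu: "continuous_on (carrier (tets M)) u" by (rule P2_continuous[OF u])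
  have sub: "\<Omega> \<subseteq> carrier (tets M)" unfolding \<Omega>_def by (rule domain_props)
  have cF: "continuous_on UNIV F"
  proof -
    have "continuous_on \<Omega> (\<lambda>x. u x $ i * \<phi> x)"
      using continuous_on_subset[OF cu sub] continuous_on_subset[OF cont\<phi>(1), of \<Omega>]
      by (intro continuous_intros continuous_on_component) auto
    then have "continuous_on \<Omega> F" by (rule continuous_on_eq) (simp add: F_def)
    moreover have "continuous_on (- K) F"
      by (rule continuous_on_eq[of _ "\<lambda>x. 0"]) (simp_all add: F0)
    ultimately have "continuous_on (\<Omega> \<union> - K) F" using op by (intro continuous_on_open_Un)
    moreover have "\<Omega> \<union> - K = UNIV" using K(2) by blast
    ultimately show ?thesis by simp
  qed
  \<comment> \<open>A segment shorter than \<open>\<delta>\<close> with an endpoint in the support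
    stays in the domain, so \<open>u\<close> can be compared along it.\<close>
  obtain \<delta> where \<delta>: "\<delta> > 0" "\<And>x. x \<in> K \<Longrightarrow> cball x \<delta> \<subseteq> \<Omega>"
  proof -
    obtain d where "d > 0" "(\<Union>x\<in>K. cball x d) \<subseteq> \<Omega>"
      using compact_subset_open_imp_cball_epsilon_subset[OF K(1) op(1) K(2)] by metis
    then show thesis using that by blast
  qed
  obtain c where c: "c \<ge> 0" "\<And>x y. closed_segment x y \<subseteq> carrier (tets M) \<Longrightarrow> norm (u y - u x) \<le> c *
      norm (y - x)"
    using P2_lipschitz_on_segments[OF M u] by metis
  obtain b1 where b1: "\<And>x. x \<in> carrier (tets M) \<Longrightarrow> norm (u x) \<le> b1"
    using compact_imp_bounded[OF compact_continuous_image[OF cu compact_carrier[OF M]]] by (auto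
        simp: bounded_iff)
  obtain b2 where b2: "\<And>x. x \<in> carrier (tets M) \<Longrightarrow> norm (\<phi> x) \<le> b2"
    using compact_imp_bounded[OF compact_continuous_image[OF continuous_on_subset[OF cont\<phi>(1)]
        compact_carrier[OF M]]]
    by (auto simp: bounded_iff)
  obtain b3 where b3: "\<And>x. x \<in> carrier (tets M) \<Longrightarrow> norm (partial_deriv j \<phi> x) \<le> b3"
    using compact_imp_bounded[OF compact_continuous_image[OF continuous_on_subset[OF cont\<phi>(2)]
        compact_carrier[OF M]]]
    by (auto simp: bounded_iff)
  \<comment> \<open>From the product rule for differences: \<open>b1\<close> and \<open>b2\<close>
    bound the two factors, \<open>c\<close> and \<open>b3\<close> their rates of change.\<close>
  define C where "C = \<bar>b1\<bar> * \<bar>b3\<bar> + \<bar>b2\<bar> * c"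
  have lip: "\<bar>F (x + h *\<^sub>R e) - F x\<bar> \<le> C * h" if h: "0 < h" "h < \<delta>" for x h
  proof (cases "x \<in> K \<or> x + h *\<^sub>R e \<in> K")
    case False
    then show ?thesis using F0 h(1) c(1) by (simp add: C_def)
  next
    case True
    let ?y = "x + h *\<^sub>R e"
    have seg: "x + t *\<^sub>R e \<in> \<Omega>" if t: "0 \<le> t" "t \<le> h" for t
    proof -
      have "dist x (x + t *\<^sub>R e) \<le> \<delta>" "dist ?y (x + t *\<^sub>R e) \<le> \<delta>"
      proof -
        have "x - (x + t *\<^sub>R e) = (- t) *\<^sub>R e" "?y - (x + t *\<^sub>R e) = (h - t) *\<^sub>R e"
          by (simp_all add: algebra_simps)
        then show "dist x (x + t *\<^sub>R e) \<le> \<delta>" "dist ?y (x + t *\<^sub>R e) \<le> \<delta>"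
          unfolding dist_norm using t h ne by simp_all
      qed
      then have "x + t *\<^sub>R e \<in> cball x \<delta>" "x + t *\<^sub>R e \<in> cball ?y \<delta>" by (simp_all only: mem_cball)
      then show ?thesis using True \<delta>(2)[of x] \<delta>(2)[of ?y] by blast
    qed
    have xy: "x \<in> \<Omega>" "?y \<in> \<Omega>" using seg[of 0] seg[of h] h by auto
    have "closed_segment x ?y \<subseteq> carrier (tets M)"
    proof
      fix z assume "z \<in> closed_segment x ?y"
      then obtain v where v: "0 \<le> v" "v \<le> 1" "z = (1 - v) *\<^sub>R x + v *\<^sub>R ?y" by (auto simp:
          closed_segment_def)
      then have "z = x + (v * h) *\<^sub>R e" by (simp add: algebra_simps)
      moreover have "v * h \<le> h" "0 \<le> v * h" using v h by (simp_all add: mult_left_le_one_le)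
      ultimately show "z \<in> carrier (tets M)" using seg sub by auto
    qed
    from c(2)[OF this] have du: "\<bar>u ?y $ i - u x $ i\<bar> \<le> c * h"
      using component_le_norm_cart[of "u ?y - u x" i] h ne by simp
    obtain z where z: "0 < z" "z < h" "\<phi> (x + h *\<^sub>R e) - \<phi> (x + 0 *\<^sub>R e) = (h - 0) * partial_deriv j
        \<phi> (x + z *\<^sub>R e)"
      using MVT2[OF h(1), of "\<lambda>t. \<phi> (x + t *\<^sub>R e)" "\<lambda>t. partial_deriv j \<phi> (x + t *\<^sub>R e)"]
        smooth_partial_derivative[OF sm] unfolding e_def by metis
    have "x + z *\<^sub>R e \<in> carrier (tets M)" using seg[of z] z sub by auto
    then have "\<bar>partial_deriv j \<phi> (x + z *\<^sub>R e)\<bar> \<le> \<bar>b3\<bar>" using b3 by fastforce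
    then have d\<phi>: "\<bar>\<phi> ?y - \<phi> x\<bar> \<le> \<bar>b3\<bar> * h" using z(3) h by (simp add: abs_mult mult.commute
        mult_right_mono)
    have bu: "\<bar>u ?y $ i\<bar> \<le> \<bar>b1\<bar>"
      using component_le_norm_cart[of "u ?y" i] b1[of ?y] xy sub by force
    have b\<phi>: "\<bar>\<phi> x\<bar> \<le> \<bar>b2\<bar>" using b2[of x] xy sub by force
    have "F ?y - F x = u ?y $ i * (\<phi> ?y - \<phi> x) + \<phi> x * (u ?y $ i - u x $ i)"
      using xy by (simp add: F_def algebra_simps)
    also have "\<bar>\<dots>\<bar> \<le> \<bar>u ?y $ i\<bar> * \<bar>\<phi> ?y - \<phi> x\<bar> + \<bar>\<phi> x\<bar> * \<bar>u ?y $ i - u x $ i\<bar>"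
      by (rule order_trans[OF abs_triangle_ineq]) (simp add: abs_mult)
    also have "\<dots> \<le> \<bar>b1\<bar> * (\<bar>b3\<bar> * h) + \<bar>b2\<bar> * (c * h)"
      using bu b\<phi> du d\<phi> by (intro add_mono mult_mono) auto
    finally show ?thesis by (simp add: C_def algebra_simps)
  qed
  have i1: "integrable (lebesgue_on \<Omega>) (\<lambda>x. u x $ i * partial_deriv j \<phi> x)"
    unfolding \<Omega>_def
    using continuous_on_subset[OF cont\<phi>(2), of "carrier (tets M)"] cu
    by (intro integrable_continuous_on_compact[OF compact_carrier[OF M] _ domain_props(1,3)]
        continuous_intros continuous_on_component) auto
  have "\<exists>J. \<forall>T\<in>tets M. continuous_on UNIV (J T) \<and> (\<forall>x\<in>interior (convex hull T). jacobian u (at x) =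
      J T x) \<and>
    (\<forall>x\<in>interior (convex hull T). (u has_derivative (\<lambda>h. J T x *v h)) (at x))"
    by (rule bchoice) (metis P2_jacobian[OF u])
  then obtain J where J: "\<And>T. T \<in> tets M \<Longrightarrow> continuous_on UNIV (J T)"
    "\<And>T x. T \<in> tets M \<Longrightarrow> x \<in> interior (convex hull T) \<Longrightarrow> jacobian u (at x) = J T x"
    "\<And>T x. T \<in> tets M \<Longrightarrow> x \<in> interior (convex hull T) \<Longrightarrow> (u has_derivative (\<lambda>h. J T x *v h)) (at x)"
    by blast
  have i2: "integrable (lebesgue_on \<Omega>) (\<lambda>x. jacobian u (at x) $ i $ j * \<phi> x)"
    unfolding \<Omega>_def
    by (rule integrable_piecewise[OF M, of "\<lambda>T x. J T x $ i $ j * \<phi> x"])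
      (use J(1,2) cont\<phi>(1) in \<open>auto intro!: continuous_intros continuous_on_component\<close>)
  have \<Omega>s: "\<Omega> \<in> sets lebesgue" unfolding \<Omega>_def by (rule domain_props)
  have ig: "integrable (lebesgue_on \<Omega>) g" unfolding g_def using i1 i2 by (rule
      Bochner_Integration.integrable_add)
  then have mG: "(\<lambda>x. indicator \<Omega> x *\<^sub>R g x) \<in> borel_measurable lebesgue"
    using \<Omega>s by (intro borel_measurable_integrable) (simp add: integrable_restrict_space)
  have "integral\<^sup>L lebesgue (\<lambda>x. indicator \<Omega> x *\<^sub>R g x) = 0"
  proof (rule integral_directional_derivative_zero[OF cF K(1) F0 ne \<delta>(1) lip mG])
    show "negligible Z" unfolding Z_def \<Omega>_def by (rule negligible_domain_skeleton[OF M])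
    fix x assume x: "x \<notin> Z"
    show "((\<lambda>t. F (x + t *\<^sub>R e)) has_real_derivative indicator \<Omega> x *\<^sub>R g x) (at 0)"
    proof (cases "x \<in> \<Omega>")
      case True
      then obtain T where T: "T \<in> tets M" "x \<in> interior (convex hull T)" using x by (auto simp: Z_def)
      have "(u has_derivative (\<lambda>h. J T x *v h)) (at x)" by (rule J(3)[OF T])
      then have "((\<lambda>x. u x $ i) has_derivative (\<lambda>h. (J T x *v h) $ i)) (at x)"
        by (rule bounded_linear.has_derivative[OF bounded_linear_vec_nth])
      moreover have "(\<phi> has_derivative frechet_derivative \<phi> (at x)) (at x)"
        using smooth_partial_continuous(3)[OF sm] by (simp add: frechet_derivative_works)
      ultimately have "((\<lambda>x. u x $ i * \<phi> x) has_derivative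
         (\<lambda>h. u x $ i * frechet_derivative \<phi> (at x) h + (J T x *v h) $ i * \<phi> x)) (at x)"
        by (rule has_derivative_mult)
      then have "(F has_derivative (\<lambda>h. u x $ i * frechet_derivative \<phi> (at x) h + (J T x *v h) $ i *
          \<phi> x)) (at x)"
        by (rule has_derivative_transform_within_open[OF _ op(1) True]) (simp add: F_def)
      from has_real_derivative_along[of F _ x 0 e] this
      have "((\<lambda>t. F (x + t *\<^sub>R e)) has_real_derivative
          (u x $ i * frechet_derivative \<phi> (at x) e + (J T x *v e) $ i * \<phi> x)) (at 0)" by simp
      moreover have "(J T x *v e) $ i = jacobian u (at x) $ i $ j"
        unfolding J(2)[OF T] e_def by (simp add: matrix_vector_mult_basis column_def)
      ultimately show ?thesis using True by (simp add: g_def partial_deriv_def e_def)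
    next
      case False
      then have "x \<in> - K" using K(2) by blast
      have "((\<lambda>x. 0::real) has_derivative (\<lambda>h. 0)) (at x)" by simp
      then have "(F has_derivative (\<lambda>h. 0)) (at x)"
        by (rule has_derivative_transform_within_open[OF _ op(2) \<open>x \<in> - K\<close>]) (simp add: F0)
      from has_real_derivative_along[of F _ x 0 e] this
      show ?thesis using False by simp
    qed
  qed
  then have "integral\<^sup>L (lebesgue_on \<Omega>) g = 0"
    using \<Omega>s by (subst integral_restrict_space) auto
  then show ?thesis
    unfolding vol_int_def g_def \<Omega>_def[symmetric] using Bochner_Integration.integral_add[OF i1 i2] by
        linarith
qed

section \<open>Traces on the wetted boundary\<close>

lemma tri_chart_in_hull:
  assumes "card \<sigma> = 3" "p \<in> ref_triangle"
  shows "tri_chart \<sigma> p \<in> convex hull \<sigma>"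
proof -
  obtain a b c where abc: "tri_vertices \<sigma> = (a, b, c)" "\<sigma> = {a, b, c}" "distinct [a, b, c]"
    by (rule tri_verticesE[OF assms(1)])
  obtain s t where p: "p = (s, t)" by (cases p)
  have "0 \<le> s" "0 \<le> t" "s + t \<le> 1" using assms(2) by (auto simp: ref_triangle_def p)
  then have "a + s *\<^sub>R (b - a) + t *\<^sub>R (c - a) \<in> convex hull \<sigma>"
    unfolding abc(2) by (rule convex_combination_3)
  then show ?thesis unfolding p tri_chart_eq[OF abc(1)] .
qed

lemma continuous_tri_chart: "continuous_on UNIV (tri_chart \<sigma>)"
  unfolding tri_chart_def by (cases "tri_vertices \<sigma>") (auto simp: case_prod_unfold intro!:
      continuous_intros)

lemma boundary_face_in_carrier:
  assumes "\<sigma> \<in> boundary_faces M"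
  shows "convex hull \<sigma> \<subseteq> carrier (tets M)"
proof -
  obtain T where "T \<in> tets M" "\<sigma> \<subseteq> T" using boundary_face_in_tet[OF assms] by blast
  then show ?thesis unfolding carrier_def using hull_mono[of \<sigma> T] by blast
qed

text \<open>A finite element function is continuous up to the boundary, so the constant sequence
  serves as the approximation in the definition of the trace.\<close>

lemma P2_has_trace:
  fixes u :: "pt \<Rightarrow> pt"
  assumes M: "valid_mesh M" and u: "u \<in> P2 (tets M)"
  shows "has_trace (domain M) (solid M) u (\<lambda>x. jacobian u (at x)) u"
proof -
  have cu: "continuous_on (carrier (tets M)) u" by (rule P2_continuous[OF u])
  note int = integrable_continuous_on_compact[OF compact_carrier[OF M] _ domain_props(1,3)]
  have "\<exists>J. \<forall>T\<in>tets M. continuous_on UNIV (J T) \<and> (\<forall>x\<in>interior (convex hull T). jacobian u (at x) =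
      J T x)"
    by (rule bchoice) (metis P2_jacobian[OF u])
  then obtain J where J: "\<And>T. T \<in> tets M \<Longrightarrow> continuous_on UNIV (J T)"
    "\<And>T x. T \<in> tets M \<Longrightarrow> x \<in> interior (convex hull T) \<Longrightarrow> jacobian u (at x) = J T x"
    by blast
  have "L2 (domain M) u"
    unfolding L2_def
  proof
    show "u \<in> borel_measurable (lebesgue_on (domain M))" using int[OF cu] by (rule
        borel_measurable_integrable)
    show "integrable (lebesgue_on (domain M)) (\<lambda>x. (norm (u x))\<^sup>2)" by (intro int continuous_intros cu)
  qed
  moreover have "L2 (domain M) (\<lambda>x. jacobian u (at x))"
    unfolding L2_def
  proof
    have "integrable (lebesgue_on (domain M)) (\<lambda>x. jacobian u (at x))"
      by (rule integrable_piecewise[OF M J])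
    then show "(\<lambda>x. jacobian u (at x)) \<in> borel_measurable (lebesgue_on (domain M))" by (rule
        borel_measurable_integrable)
    show "integrable (lebesgue_on (domain M)) (\<lambda>x. (norm (jacobian u (at x)))\<^sup>2)"
      by (rule integrable_piecewise[OF M, of "\<lambda>T x. (norm (J T x))\<^sup>2"]) (use J in \<open>auto intro!:
          continuous_intros\<close>)
  qed
  ultimately have H1: "H1 (domain M) u (\<lambda>x. jacobian u (at x))"
    unfolding H1_def using weak_derivative_P2[OF M u] by blast
  have surf: "L2_surf (solid M) u"
    unfolding L2_surf_def
  proof (intro ballI conjI)
    fix \<sigma> assume "\<sigma> \<in> solid M"
    then have s: "\<sigma> \<in> boundary_faces M" using mesh_faces(1)[OF M] by blast
    then have c3: "card \<sigma> = 3" by (simp add: boundary_faces_def)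
    have c: "continuous_on ref_triangle (\<lambda>p. u (tri_chart \<sigma> p))"
      by (rule continuous_on_compose2[OF cu continuous_on_subset[OF continuous_tri_chart]])
        (use tri_chart_in_hull[OF c3] boundary_face_in_carrier[OF s] in auto)
    note intr = integrable_continuous_on_compact[OF ref_triangle_props(1) _ subset_refl
        ref_triangle_props(3)]
    show "(\<lambda>p. u (tri_chart \<sigma> p)) \<in> borel_measurable (lebesgue_on ref_triangle)"
      using intr[OF c] by (rule borel_measurable_integrable)
    show "integrable (lebesgue_on ref_triangle) (\<lambda>p. (norm (u (tri_chart \<sigma> p)))\<^sup>2)"
      by (intro intr continuous_intros c)
  qed
  have "closure (domain M) \<subseteq> carrier (tets M)"
    using domain_props(1) compact_imp_closed[OF compact_carrier[OF M]] by (rule closure_minimal)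
  then have "continuous_on (closure (domain M)) u" using cu by (rule continuous_on_subset[rotated])
  then show ?thesis
    unfolding has_trace_def using H1 surf
    by (intro conjI exI[of _ "\<lambda>k. u"] exI[of _ "\<lambda>k x. jacobian u (at x)"])
      (simp_all add: L2_norm_on_def L2_norm_surf_def vol_int_def surf_int_def)
qed

section \<open>The normal velocity on the wetted boundary\<close>

lemma normal_component_P2:
  assumes M: "valid_mesh M" and u: "u \<in> P2 (tets M)"
  shows "(\<lambda>x. n \<bullet> u x) \<in> P2 (solid M)"
  unfolding P2_def
proof (intro CollectI conjI ballI)
  have "carrier (solid M) \<subseteq> carrier (tets M)"
    unfolding carrier_def[of "solid M"] using boundary_face_in_carrier mesh_faces(1)[OF M] by blast
  then show "continuous_on (carrier (solid M)) (\<lambda>x. n \<bullet> u x)"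
    using continuous_on_subset[OF P2_continuous[OF u]] by (intro continuous_intros) auto
  fix \<sigma> assume "\<sigma> \<in> solid M"
  then obtain T where T: "T \<in> tets M" "\<sigma> \<subseteq> T" using mesh_faces(1)[OF M] boundary_face_in_tet by blast
  obtain k L B where LB: "linear L" "bilinear B" "\<forall>x\<in>convex hull T. u x = k + L x + B x x"
    by (rule P2_quadraticE[OF u T(1)])
  have ln: "linear (\<lambda>x. n \<bullet> x)" by (rule bounded_linear.linear[OF bounded_linear_inner_right])
  show "\<exists>c L B. linear L \<and> bilinear B \<and> (\<forall>x\<in>convex hull \<sigma>. n \<bullet> u x = c + L x + B x x)"
  proof (intro exI conjI ballI)
    show "linear (\<lambda>x. n \<bullet> L x)" using linear_compose[OF LB(1) ln] by (simp add: o_def)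
    show "bilinear (\<lambda>x y. n \<bullet> B x y)"
      using LB(2) linear_compose[OF _ ln] unfolding bilinear_def o_def by blast
    fix x assume "x \<in> convex hull \<sigma>"
    then have "x \<in> convex hull T" using hull_mono[OF T(2)] by blast
    then show "n \<bullet> u x = n \<bullet> k + n \<bullet> L x + n \<bullet> B x x" using LB(3) by (simp add: inner_add_right)
  qed
qed

text \<open>The normal component is itself an admissible multiplier. Testing with it turns the
  pairing into a sum of squares at the nodes with positive weights.\<close>

lemma normal_component_nodes:
  assumes M: "valid_mesh M" and u: "u \<in> P2 (tets M)"
    and orth: "\<And>lam. lam \<in> P2 (solid M) \<Longrightarrow> solid_pairing (solid M) n lam u = 0"
    and s: "\<sigma> \<in> solid M" and P: "P \<in> nodes2 \<sigma>"
  shows "n \<bullet> u P = 0"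
proof -
  have fin: "finite (nodes2 \<sigma>)" if "\<sigma> \<in> solid M" for \<sigma>
  proof -
    have "\<sigma> \<in> boundary_faces M" using that mesh_faces(1)[OF M] by blast
    then have "card \<sigma> = 3" by (simp add: boundary_faces_def)
    then have "finite \<sigma>" by (intro card_ge_0_finite) simp
    moreover have "nodes2 \<sigma> = (\<lambda>(a, b). midpoint a b) ` (\<sigma> \<times> \<sigma>)" by (auto simp: nodes2_def)
    ultimately show ?thesis by simp
  qed
  have "(\<Sum>\<sigma>\<in>solid M. tri_area \<sigma> / 6 * (\<Sum>P\<in>nodes2 \<sigma>. (n \<bullet> u P) * (n \<bullet> u P))) = 0"
    using orth[OF normal_component_P2[OF M u]] by (simp add: solid_pairing_def)
  moreover have "0 \<le> tri_area \<sigma> / 6 * (\<Sum>P\<in>nodes2 \<sigma>. (n \<bullet> u P) * (n \<bullet> u P))" for \<sigma>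
    by (intro mult_nonneg_nonneg sum_nonneg zero_le_square) (simp add: tri_area_eq_normal_vec)
  ultimately have "tri_area \<sigma> / 6 * (\<Sum>P\<in>nodes2 \<sigma>. (n \<bullet> u P) * (n \<bullet> u P)) = 0"
    using s sum_nonneg_eq_0_iff[OF finite_solid[OF M], of "\<lambda>\<sigma>. tri_area \<sigma> / 6 * (\<Sum>P\<in>nodes2 \<sigma>. (n \<bullet> u
        P) * (n \<bullet> u P))"]
    by blast
  moreover have "tri_area \<sigma> > 0" using tri_area_pos[OF M] mesh_faces(1)[OF M] s by blast
  ultimately have "(\<Sum>P\<in>nodes2 \<sigma>. (n \<bullet> u P) * (n \<bullet> u P)) = 0" by simp
  then show ?thesis using P by (subst (asm) sum_nonneg_eq_0_iff) (auto simp: fin[OF s])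
qed

text \<open>Unisolvence of the six Lagrange nodes: in the coordinates \<open>s\<close>,
  \<open>t\<close> the polynomial has six coefficients, and the nodal values form a regular linear
  system for them. As \<open>B\<close> may be nonsymmetric, the mixed coefficient
  \<open>\<epsilon>\<close> is symmetrised.\<close>

lemma quadratic_zero_on_triangle:
  fixes f :: "pt \<Rightarrow> real"
  assumes f: "f \<in> P2 C" "{a, b, c} \<in> C" and zero: "\<And>P. P \<in> nodes2 {a, b, c} \<Longrightarrow> f P = 0"
    and st: "0 \<le> s" "0 \<le> t" "s + t \<le> 1"
  shows "f (a + s *\<^sub>R (b - a) + t *\<^sub>R (c - a)) = 0"
proof -
  obtain k L B where LB: "linear L" "bilinear B" "\<forall>x\<in>convex hull {a, b, c}. f x = k + L x + B x x"
    by (rule P2_quadraticE[OF f])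
  have B: "bounded_bilinear B" using LB(2) by (simp add: bilinear_conv_bounded_bilinear)
  note expand = linear_add[OF LB(1)] linear_scale[OF LB(1)] bounded_bilinear.add_left[OF B]
      bounded_bilinear.add_right[OF B]
    bounded_bilinear.scaleR_left[OF B] bounded_bilinear.scaleR_right[OF B]
  define v where "v = b - a"
  define w where "w = c - a"
  define \<alpha> where "\<alpha> = k + L a + B a a"
  define \<beta> where "\<beta> = L v + B a v + B v a"
  define \<gamma> where "\<gamma> = L w + B a w + B w a"
  define \<epsilon> where "\<epsilon> = B v w + B w v"
  have f: "f (a + s *\<^sub>R v + t *\<^sub>R w) = \<alpha> + s * \<beta> + t * \<gamma> + s * s * B v v + s * t * \<epsilon> + t * t * B w w"
    if "0 \<le> s" "0 \<le> t" "s + t \<le> 1" for s t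
  proof -
    have "a + s *\<^sub>R v + t *\<^sub>R w \<in> convex hull {a, b, c}" unfolding v_def w_def by (rule
        convex_combination_3[OF that])
    then have "f (a + s *\<^sub>R v + t *\<^sub>R w) = k + L (a + s *\<^sub>R v + t *\<^sub>R w) + B (a + s *\<^sub>R v + t *\<^sub>R w)
        (a + s *\<^sub>R v + t *\<^sub>R w)"
      using LB(3) by blast
    then show ?thesis unfolding \<alpha>_def \<beta>_def \<gamma>_def \<epsilon>_def by (simp add: expand algebra_simps)
  qed
  have nodes: "f (midpoint x y) = 0" if "x \<in> {a, b, c}" "y \<in> {a, b, c}" for x y
    by (rule zero) (use that in \<open>unfold nodes2_def, blast\<close>)
  have pts: "midpoint a a = a + 0 *\<^sub>R v + 0 *\<^sub>R w" "midpoint b b = a + 1 *\<^sub>R v + 0 *\<^sub>R w"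
    "midpoint c c = a + 0 *\<^sub>R v + 1 *\<^sub>R w" "midpoint a b = a + (1/2) *\<^sub>R v + 0 *\<^sub>R w"
    "midpoint a c = a + 0 *\<^sub>R v + (1/2) *\<^sub>R w" "midpoint b c = a + (1/2) *\<^sub>R v + (1/2) *\<^sub>R w"
    by (simp_all add: midpoint_def v_def w_def vec_eq_iff field_simps)
  have "f (a + 0 *\<^sub>R v + 0 *\<^sub>R w) = 0" "f (a + 1 *\<^sub>R v + 0 *\<^sub>R w) = 0" "f (a + 0 *\<^sub>R v + 1 *\<^sub>R w) = 0"
    "f (a + (1/2) *\<^sub>R v + 0 *\<^sub>R w) = 0" "f (a + 0 *\<^sub>R v + (1/2) *\<^sub>R w) = 0" "f (a + (1/2) *\<^sub>R v +
        (1/2) *\<^sub>R w) = 0"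
    unfolding pts[symmetric] by (rule nodes; simp)+
  then have "\<alpha> = 0" "\<alpha> + \<beta> + B v v = 0" "\<alpha> + \<gamma> + B w w = 0" "\<alpha> + \<beta> / 2 + B v v / 4 = 0"
     "\<alpha> + \<gamma> / 2 + B w w / 4 = 0" "\<alpha> + \<beta> / 2 + \<gamma> / 2 + B v v / 4 + \<epsilon> / 4 + B w w / 4 = 0"
    using f[of 0 0] f[of 1 0] f[of 0 1] f[of "1/2" 0] f[of 0 "1/2"] f[of "1/2" "1/2"] by simp_all
  then have "\<alpha> = 0" "\<beta> = 0" "\<gamma> = 0" "B v v = 0" "B w w = 0" "\<epsilon> = 0" by linarith+
  then show ?thesis using f[OF st] by (simp add: v_def w_def)
qed

lemma normal_component_zero:
  assumes M: "valid_mesh M" and u: "u \<in> P2 (tets M)"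
    and orth: "\<And>lam. lam \<in> P2 (solid M) \<Longrightarrow> solid_pairing (solid M) n lam u = 0"
    and s: "\<sigma> \<in> solid M" and p: "p \<in> ref_triangle"
  shows "n \<bullet> u (tri_chart \<sigma> p) = 0"
proof -
  have "card \<sigma> = 3" using s mesh_faces(1)[OF M] by (auto simp: boundary_faces_def)
  then obtain a b c where abc: "tri_vertices \<sigma> = (a, b, c)" "\<sigma> = {a, b, c}" "distinct [a, b, c]"
    by (rule tri_verticesE)
  obtain v w where vw: "p = (v, w)" by (cases p)
  have st: "0 \<le> v" "0 \<le> w" "v + w \<le> 1" using p by (auto simp: ref_triangle_def vw)
  have zero: "n \<bullet> u P = 0" if "P \<in> nodes2 {a, b, c}" for P
    by (rule normal_component_nodes[OF M u orth s]) (use that abc(2) in simp_all)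
  show ?thesis unfolding vw tri_chart_eq[OF abc(1)]
    by (rule quadratic_zero_on_triangle[OF normal_component_P2[OF M u] _ zero st]) (use s abc(2) in simp)
qed

lemma surf_int_cong:
  assumes "\<And>\<sigma> p. \<sigma> \<in> \<Gamma> \<Longrightarrow> p \<in> ref_triangle \<Longrightarrow> f \<sigma> (tri_chart \<sigma> p) = g \<sigma> (tri_chart \<sigma> p)"
  shows "surf_int \<Gamma> f = surf_int \<Gamma> g"
  unfolding surf_int_def
proof (intro sum.cong refl arg_cong[where f = "\<lambda>t. _ * t"] Bochner_Integration.integral_cong)
  fix \<sigma> p assume "\<sigma> \<in> \<Gamma>" "p \<in> space (lebesgue_on ref_triangle)"
  then show "f \<sigma> (tri_chart \<sigma> p) = g \<sigma> (tri_chart \<sigma> p)" using assms by simp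
qed

section \<open>The energy law\<close>

lemma integral_affine_unit_interval:
  fixes p q :: real
  shows "integral\<^sup>L (lebesgue_on {0..1}) (\<lambda>s. p + s * q) = p + q / 2"
proof -
  have "integrable (lebesgue_on {0..1}) (\<lambda>s. p + s * q)"
    by (rule integrable_continuous_on_compact[of "{0..1}"]) (auto intro!: continuous_intros)
  then have "integral\<^sup>L (lebesgue_on {0..1}) (\<lambda>s. p + s * q) = integral {0..1} (\<lambda>s. p + s * q)"
    by (rule lebesgue_integral_eq_integral) simp
  also have "((\<lambda>s. p + s * q) has_integral ((p * 1 + 1\<^sup>2 * q / 2) - (p * 0 + 0\<^sup>2 * q / 2))) {0..1}"
    by (rule fundamental_theorem_of_calculus[of 0 1 "\<lambda>s. p * s + s\<^sup>2 * q / 2"])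
      (auto simp: has_real_derivative_iff_has_vector_derivative[symmetric] intro!: derivative_eq_intros)
  then have "integral {0..1} (\<lambda>s. p + s * q) = p + q / 2" by (simp add: integral_unique)
  finally show ?thesis .
qed

lemma zero_in_P2: "(\<lambda>x. 0::real) \<in> P2 C"
  unfolding P2_def
proof (intro CollectI conjI ballI exI)
  fix V x
  show "linear (\<lambda>x::pt. 0::real)" by (rule linear_zero)
  show "bilinear (\<lambda>x y::pt. 0::real)" by (simp add: bilinear_def linear_zero)
  show "(0::real) = 0 + 0 + 0" by simp
qed simp

section \<open>Work at the contact line and the energy balance of one step\<close>

context mesh_step
begin

lemma X_carrier: "X ` carrier (tets M) \<subseteq> carrier (tets N)"
proof
  fix y assume "y \<in> X ` carrier (tets M)"
  then obtain x T where x: "y = X x" "T \<in> tets M" "x \<in> convex hull T" by (auto simp: carrier_def)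
  obtain A q where linA: "linear A" and XA': "\<forall>x\<in>convex hull T. X x = q + A x"
    by (rule X_affineE[OF x(2)])
  note XA = bspec[OF XA']
  have "X x \<in> (\<lambda>v. q + v) ` A ` (convex hull T)" using XA[OF x(3)] x(3) by blast
  also have "\<dots> = convex hull ((\<lambda>v. q + v) ` A ` T)"
    by (simp only: convex_hull_translation convex_hull_linear_image[OF linA])
  also have "(\<lambda>v. q + v) ` A ` T = X ` T"
    unfolding image_image by (intro image_cong refl XA[symmetric] hull_inc)
  finally show "y \<in> carrier (tets N)" using x by (auto simp: carrier_def moved_simps)
qed

text \<open>The half-step conormal is constant in the open edge and \<open>wt\<close> is affine on
  it, so their pairing integrates to \<open>edge_flux\<close> exactly. The friction part contributes
  \<open>- c\<close> times a square, and the part along \<open>n\<close> vanishes because contact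
  vertices move within the substrate.\<close>

lemma contact_edge_term:
  assumes ab: "(a, b) \<in> directed_contact n M" and c: "0 \<le> c"
  shows "norm (b - a) * integral\<^sup>L (lebesgue_on {0..1}) (\<lambda>s.
      (\<gamma> *\<^sub>R conormal_half \<tau> n wt (a, b) (a + s *\<^sub>R (b - a))
        - (c * (wt (a + s *\<^sub>R (b - a)) \<bullet> conormal n (a, b))) *\<^sub>R conormal n (a, b)
        + d *\<^sub>R n) \<bullet> wt (a + s *\<^sub>R (b - a)))
    \<le> \<gamma> * edge_flux a b"
proof -
  have e: "{a, b} \<in> contact_edges M" using ab directed_contact_iff[OF M] by blast
  then have ne: "a \<noteq> b" by (auto simp: contact_edges_def)
  obtain \<sigma> \<sigma>' where s: "\<sigma> \<in> free M" "{a, b} \<subseteq> \<sigma>" and s': "\<sigma>' \<in> solid M" "{a, b} \<subseteq> \<sigma>'"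
    using e by (auto simp: contact_edges_def)
  obtain L q where L: "linear L" "\<And>x. x \<in> convex hull \<sigma> \<Longrightarrow> wt x = q + L x"
    using P1_affineE[OF wt s(1)] by metis
  have cf: "convex hull \<sigma> \<subseteq> carrier (free M)" using s(1) by (auto simp: carrier_def)
  have vert: "a \<in> convex hull \<sigma>" "b \<in> convex hull \<sigma>" using s(2) by (auto intro: hull_inc)
  have ww: "w a = wt a" "w b = wt b" using vert cf w_wt by auto
  have nw: "n \<bullet> wt a = 0" "n \<bullet> wt b = 0"
    unfolding ww[symmetric] using normal_velocity_zero[OF s'(1)] s'(2) by auto
  define l where "l = norm (b - a)"
  have l: "l > 0" using ne by (simp add: l_def)
  define p where "p = (\<lambda>s. a + s *\<^sub>R (b - a))"
  have pin: "p s \<in> convex hull \<sigma>" if "0 \<le> s" "s \<le> 1" for s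
  proof -
    have "p s \<in> closed_segment a b" unfolding closed_segment_def p_def mem_Collect_eq
      using that by (intro exI[of _ s]) (simp add: algebra_simps)
    then show ?thesis using s(2) hull_mono[of "{a, b}" \<sigma> convex] by (auto simp: segment_convex_hull)
  qed
  have wp: "wt (p s) = wt a + s *\<^sub>R (wt b - wt a)" if "0 \<le> s" "s \<le> 1" for s
    using L(2)[OF pin[OF that]] L(2)[OF vert(1)] L(2)[OF vert(2)]
    by (simp add: p_def linear_add[OF L(1)] linear_scale[OF L(1)] linear_diff[OF L(1)])
  define K where "K = cross3 ((b - a) + (\<tau>/2) *\<^sub>R (wt b - wt a)) n"
  have ch: "conormal_half \<tau> n wt (a, b) (p s) = (1 / l) *\<^sub>R K" if s: "0 < s" "s < 1" for s
  proof -
    let ?t = "(1 / l) *\<^sub>R (b - a)"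
    \<comment> \<open>The direction is a unit vector while \<open>s\<close> is a fraction of the
      edge, hence the factor \<open>l\<close>: this is the distance from \<open>p s\<close> to the
      nearer endpoint.\<close>
    define \<epsilon> where "\<epsilon> = l * min s (1 - s)"
    have \<epsilon>: "\<epsilon> > 0" using l s by (simp add: \<epsilon>_def)
    have line: "p s + r *\<^sub>R ?t \<in> convex hull \<sigma>" if "\<bar>r\<bar> < \<epsilon>" for r
    proof -
      have "\<bar>r\<bar> / l < \<epsilon> / l" using that l by (rule divide_strict_right_mono)
      also have "\<epsilon> / l = min s (1 - s)" using l by (simp add: \<epsilon>_def)
      finally have "\<bar>r / l\<bar> < min s (1 - s)" using l by (simp add: abs_divide)
      then have "0 \<le> s + r / l" "s + r / l \<le> 1" by linarith+
      then have "p (s + r / l) \<in> convex hull \<sigma>" by (rule pin)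
      then show ?thesis by (simp add: p_def algebra_simps)
    qed
    have lin: "linear (\<lambda>v. v + \<tau> *\<^sub>R L v)"
      by (rule linear_id_plus[OF L(1)])
    have d1: "dir_deriv ?t (\<lambda>y. y) (p s) = ?t"
      by (rule dir_deriv_affine[of "\<lambda>v. v" UNIV _ 0 1]) (simp_all add: linear_ident)
    have d2: "dir_deriv ?t (\<lambda>y. y + \<tau> *\<^sub>R wt y) (p s) = ?t + \<tau> *\<^sub>R L ?t"
      by (rule dir_deriv_affine[OF lin _ \<epsilon> line, where q = "\<tau> *\<^sub>R q"]) (simp add: L(2) scaleR_add_right)
    have "L ?t = (1 / l) *\<^sub>R (wt b - wt a)"
      using L(2)[OF vert(1)] L(2)[OF vert(2)] by (simp add: linear_scale[OF L(1)] linear_diff[OF L(1)])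
    moreover have "(1/2) *\<^sub>R (?t + (?t + \<tau> *\<^sub>R (1 / l) *\<^sub>R (wt b - wt a))) = (1 / l) *\<^sub>R ((b - a) +
        (\<tau>/2) *\<^sub>R (wt b - wt a))"
    proof -
      have h: "(1/2) *\<^sub>R (x + (x + y)) = x + (1/2) *\<^sub>R y" for x y :: pt
        by (simp add: vec_eq_iff field_simps)
      show ?thesis unfolding h by (simp add: scaleR_add_right mult.commute)
    qed
    ultimately show ?thesis
      unfolding conormal_half_def tangent_def fst_conv snd_conv l_def[symmetric] d1 d2 K_def
      by (simp only: cross_mult_left)
  qed
  define \<mu> where "\<mu> = conormal n (a, b)"
  let ?f = "\<lambda>s. (\<gamma> *\<^sub>R conormal_half \<tau> n wt (a, b) (p s) - (c * (wt (p s) \<bullet> \<mu>)) *\<^sub>R \<mu> + d *\<^sub>R n) \<bullet>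
      wt (p s)"
  let ?W = "\<lambda>s. wt a + s *\<^sub>R (wt b - wt a)"
  let ?g = "\<lambda>s. \<gamma> / l * (K \<bullet> ?W s) - c * (?W s \<bullet> \<mu>)\<^sup>2"
  have eq: "?f s = ?g s" if "s \<in> {0..1} - {0, 1}" for s
  proof -
    have s: "0 < s" "s < 1" using that by auto
    have "n \<bullet> ?W s = 0" by (simp add: inner_add_right inner_diff_right nw)
    then show ?thesis unfolding ch[OF s] wp[OF less_imp_le[OF s(1)] less_imp_le[OF s(2)]]
      by (simp add: inner_diff_left inner_add_left power2_eq_square inner_commute[of \<mu>])
  qed
  have ig: "integrable (lebesgue_on {0..1}) ?g"
    by (rule integrable_continuous_on_compact[of "{0..1}"]) (use l in \<open>auto intro!: continuous_intros\<close>)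
  have ih: "integrable (lebesgue_on {0..1}) (\<lambda>s. \<gamma> / l * (K \<bullet> ?W s))"
    by (rule integrable_continuous_on_compact[of "{0..1}"]) (use l in \<open>auto intro!: continuous_intros\<close>)
  have "integral\<^sup>L (lebesgue_on {0..1}) ?f = integral\<^sup>L (lebesgue_on {0..1}) ?g"
    by (rule lebesgue_integral_spike(2)[OF _ _ ig, where Z = "{0, 1}"]) (simp, simp add:
        negligible_finite, rule eq)
  also have "\<dots> \<le> integral\<^sup>L (lebesgue_on {0..1}) (\<lambda>s. \<gamma> / l * (K \<bullet> ?W s))"
    by (rule integral_mono[OF ig ih]) (use c in simp)
  also have "\<dots> = \<gamma> / l * (K \<bullet> wt a + K \<bullet> (wt b - wt a) / 2)"
    using integral_affine_unit_interval[of "K \<bullet> wt a" "K \<bullet> (wt b - wt a)"] by (simp add: inner_add_right)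
  also have "\<dots> = \<gamma> / l * edge_flux a b"
    unfolding edge_flux_def ww K_def[symmetric] by (simp add: inner_add_right inner_diff_right
        field_simps)
  finally have "l * integral\<^sup>L (lebesgue_on {0..1}) ?f \<le> l * (\<gamma> / l * edge_flux a b)"
    using l by (intro mult_left_mono) auto
  then show ?thesis using l by (simp add: l_def p_def \<mu>_def)
qed

lemma contact_term:
  assumes "0 \<le> c"
  shows "\<tau> * curve_int (directed_contact n M) (\<lambda>e x. (\<gamma> *\<^sub>R conormal_half \<tau> n wt e x
      - (c * (wt x \<bullet> conormal n e)) *\<^sub>R conormal n e + d e *\<^sub>R n) \<bullet> wt x)
    \<le> \<gamma> * (surface_area (solid N) - surface_area (solid M))"
proof -
  have "curve_int (directed_contact n M) (\<lambda>e x. (\<gamma> *\<^sub>R conormal_half \<tau> n wt e x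
      - (c * (wt x \<bullet> conormal n e)) *\<^sub>R conormal n e + d e *\<^sub>R n) \<bullet> wt x)
    \<le> (\<Sum>(a, b)\<in>directed_contact n M. \<gamma> * edge_flux a b)"
    unfolding curve_int_def
  proof (rule sum_mono, clarify)
    fix a b assume "(a, b) \<in> directed_contact n M"
    then show "norm (b - a) * integral\<^sup>L (lebesgue_on {0..1}) (\<lambda>s.
      (\<gamma> *\<^sub>R conormal_half \<tau> n wt (a, b) (a + s *\<^sub>R (b - a))
        - (c * (wt (a + s *\<^sub>R (b - a)) \<bullet> conormal n (a, b))) *\<^sub>R conormal n (a, b)
        + d (a, b) *\<^sub>R n) \<bullet> wt (a + s *\<^sub>R (b - a))) \<le> \<gamma> * edge_flux a b"
      using assms by (rule contact_edge_term)
  qed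
  also have "\<dots> = \<gamma> * (\<Sum>(a, b)\<in>directed_contact n M. edge_flux a b)"
    by (simp add: sum_distrib_left case_prod_unfold)
  finally show ?thesis
    unfolding solid_area_change using tau by (simp add: mult.left_commute mult_left_mono)
qed

text \<open>Testing with the solution itself: the multipliers, the pressure and the mean curvature drop
  out, and the remaining terms bound the increments of the parts of the energy.\<close>

lemma energy_step:
  assumes We: "We > 0" and \<beta>: "\<beta>\<^sub>c \<ge> 0"
    and scheme: "scheme_solution Rey We \<beta>\<^sub>s \<beta>\<^sub>c g \<theta>\<^sub>Y \<tau> ez n M' M u\<^sub>0 w\<^sub>0 wt\<^sub>0 u p \<kappa> H wt \<phi> \<psi>"
    and u0: "continuous_on (carrier (tets M')) u\<^sub>0" and M'v: "valid_mesh M'"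
    and map: "continuous_on (carrier (tets M')) (mesh_map \<tau> w\<^sub>0)"
      "mesh_map \<tau> w\<^sub>0 ` carrier (tets M') \<subseteq> carrier (tets M)"
  shows "energy We g \<theta>\<^sub>Y ez M N u
      + \<tau> * (2 / Rey * (L2_norm_on (domain M) (D u))\<^sup>2 + \<beta>\<^sub>s * (L2_norm_surf (solid M) u)\<^sup>2)
    \<le> energy We g \<theta>\<^sub>Y ez M' M u\<^sub>0"
proof -
  have sp: "u \<in> P2 (tets M)" "p \<in> P1 (tets M)" "\<kappa> \<in> P2 (solid M)" "H \<in> P1 (free M)"
    "wt \<in> P1 (free M)" "\<phi> \<in> P1 (contact_edges M)" "\<psi> \<in> P1 (contact_edges M)"
    and test: "\<And>lam. lam \<in> P2 (solid M) \<Longrightarrow>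
        eq_momentum Rey We \<beta>\<^sub>s \<tau> n M' M u\<^sub>0 w\<^sub>0 u p \<kappa> H wt u p lam \<phi> \<psi> \<and>
        eq_curvature We \<beta>\<^sub>c g \<theta>\<^sub>Y \<tau> ez n M (transported \<tau> M' w\<^sub>0 wt\<^sub>0) H wt \<phi> \<psi> wt \<and>
        eq_kinematic \<tau> M u wt H"
    using scheme unfolding scheme_solution_def by blast+
  define v where "v = u \<circ> mesh_map \<tau> w\<^sub>0"
  define C where "C = directed_contact n M"
  define U where "U = vol_int (domain M) (\<lambda>x. (norm (u x))\<^sup>2)"
  define A where "A = vol_int (domain M') (\<lambda>x. (norm (u\<^sub>0 x))\<^sup>2)"
  define B where "B = vol_int (domain M') (\<lambda>x. (norm (v x))\<^sup>2)"
  define Z where "Z = vol_ip (domain M') u\<^sub>0 v"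
  define P where "P = surf_int (free M) (\<lambda>\<sigma> x. (u x \<bullet> outward_normal M \<sigma>) * H x)"
  define S where "S = surf_int (solid M) (\<lambda>\<sigma> x. tang_proj n (u x) \<bullet> tang_proj n (u x))"
  define C1 where "C1 = curve_lump C (\<lambda>e x. wt x \<bullet> (\<phi> x *\<^sub>R n))"
  define C2 where "C2 = curve_lump C (\<lambda>e x. wt x \<bullet> (\<psi> x *\<^sub>R tangent e))"
  define E where "E = vol_int (domain M) (\<lambda>x. (norm (D u x))\<^sup>2)"
  define Gr where "Gr = surf_grad_ip M (free M) (\<lambda>x. x + \<tau> *\<^sub>R wt x) wt"
  define CI where "CI = curve_int C (\<lambda>e x.
         (cos \<theta>\<^sub>Y *\<^sub>R conormal_half \<tau> n wt e x
          - (We * \<beta>\<^sub>c * (wt x \<bullet> conormal n e)) *\<^sub>R conormal n e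
          + sin (contact_angle We \<beta>\<^sub>c \<theta>\<^sub>Y n (transported \<tau> M' w\<^sub>0 wt\<^sub>0) e) *\<^sub>R n) \<bullet> wt x)"
  define SG where "SG = surf_int (free M) (\<lambda>\<sigma> x. gravity_vec M \<tau> ez wt \<sigma> x \<bullet> wt x)"
  \<comment> \<open>The tests are \<open>u\<close>, \<open>p\<close>, \<open>\<phi>\<close> and
    \<open>\<psi>\<close>. The pressure terms cancel, the skew convection form vanishes on equal
    arguments, and \<open>C1\<close>, \<open>C2\<close> are the terms that reappear in the curvature
    equation. The wetted multiplier \<open>lam\<close> is left free.\<close>
  have mom: "1 / (2 * \<tau>) * U + 1 / (2 * \<tau>) * B + 2 / Rey * E + P - solid_pairing (solid M) n \<kappa> u
     + solid_pairing (solid M) n lam u + \<beta>\<^sub>s * S + 1 / We * C1 + 1 / We * C2 = 1 / \<tau> * Z"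
    if "lam \<in> P2 (solid M)" for lam
  proof -
    have 1: "vol_ip (domain M) u u = U" "vol_ip (domain M') v v = B"
      by (simp_all add: vol_ip_def U_def B_def power2_norm_eq_inner)
    have 2: "vol_ip (domain M) (\<lambda>x. (2 / Rey) *\<^sub>R D u x) (D u) = 2 / Rey * E"
      by (simp add: vol_ip_def E_def power2_norm_eq_inner vol_int_def)
    have 3: "convection (domain M') (\<lambda>x. u\<^sub>0 x - w\<^sub>0 x) v v = 0" by (simp add: convection_def)
    have 4: "surf_int (free M) (\<lambda>\<sigma> x. (H x *\<^sub>R outward_normal M \<sigma>) \<bullet> u x) = P"
      by (simp add: P_def inner_commute mult.commute)
    have "eq_momentum Rey We \<beta>\<^sub>s \<tau> n M' M u\<^sub>0 w\<^sub>0 u p \<kappa> H wt u p lam \<phi> \<psi>" using test[OF that] by blast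
    then show ?thesis unfolding eq_momentum_def Let_def v_def[symmetric] 1 2 3 4
      by (simp add: S_def C1_def C2_def C_def Z_def)
  qed
  \<comment> \<open>\<open>lam\<close> enters through a single linear term, so comparing with the
    zero multiplier isolates the constraint on the normal velocity. With
    \<open>lam = \<kappa>\<close> it also removes the curvature \<open>\<kappa>\<close>.\<close>
  have orth: "solid_pairing (solid M) n lam u = 0" if "lam \<in> P2 (solid M)" for lam
    using mom[OF that] mom[OF zero_in_P2] by (simp add: solid_pairing_def)
  have S: "S = (L2_norm_surf (solid M) u)\<^sup>2"
  proof -
    have "S = surf_int (solid M) (\<lambda>\<sigma> x. (norm (u x))\<^sup>2)"
      unfolding S_def
      by (rule surf_int_cong)
        (simp add: tang_proj_def normal_component_zero[OF M sp(1) orth] power2_norm_eq_inner)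
    moreover have "0 \<le> surf_int (solid M) (\<lambda>\<sigma> x. (norm (u x))\<^sup>2)"
      unfolding surf_int_def by (intro sum_nonneg mult_nonneg_nonneg integral_nonneg) (auto simp:
          tri_area_eq_normal_vec)
    ultimately show ?thesis by (simp add: L2_norm_surf_def)
  qed
  have E: "E = (L2_norm_on (domain M) (D u))\<^sup>2"
    by (simp add: E_def L2_norm_on_def vol_int_def integral_nonneg)
  \<comment> \<open>The curvature equation is tested with \<open>wt\<close> and the kinematic one
    with \<open>H\<close>. Both contain the same lumped product, which is thereby replaced by the
    surface integral \<open>P\<close> of the momentum equation.\<close>
  have cur: "- P = - 1 / We * Gr + 1 / We * C1 + 1 / We * CI + 1 / We * C2 - g * SG"
  proof -
    have 1: "surf_lump (free M) (\<lambda>\<sigma> x. (H x *\<^sub>R normal_half M \<tau> wt \<sigma> x) \<bullet> wt x) =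
      surf_lump (free M) (\<lambda>\<sigma> x. (wt x \<bullet> normal_half M \<tau> wt \<sigma> x) * H x)"
      by (simp add: inner_commute mult.commute)
    have 2: "surf_lump (free M) (\<lambda>\<sigma> x. (wt x \<bullet> normal_half M \<tau> wt \<sigma> x) * H x) = P"
      using test[OF sp(3)] by (simp add: eq_kinematic_def P_def)
    have 3: "curve_lump C (\<lambda>e x. (\<phi> x *\<^sub>R n) \<bullet> wt x) = C1" "curve_lump C (\<lambda>e x. (\<psi> x *\<^sub>R tangent e)
        \<bullet> wt x) = C2"
      by (simp_all add: C1_def C2_def inner_commute)
    have "eq_curvature We \<beta>\<^sub>c g \<theta>\<^sub>Y \<tau> ez n M (transported \<tau> M' w\<^sub>0 wt\<^sub>0) H wt \<phi> \<psi> wt"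
      using test[OF sp(3)] by blast
    then show ?thesis
      unfolding eq_curvature_def Let_def C_def[symmetric] 1 2 3 Gr_def[symmetric] CI_def[symmetric]
          SG_def[symmetric] .
  qed
  \<comment> \<open>\<open>B\<close> is the squared norm of the new velocity pulled back to the old
    mesh. It has weight one half in the balance, exactly what Young's inequality absorbs, leaving
    \<open>A / 2\<close> for the old kinetic energy.\<close>
  have young: "2 * Z \<le> A + B"
  proof -
    note int = integrable_continuous_on_compact[OF compact_carrier[OF M'v] _ domain_props(1,3)]
    have cv: "continuous_on (carrier (tets M')) v"
      unfolding v_def o_def by (rule continuous_on_compose2[OF P2_continuous[OF sp(1)] map])
    have "2 * Z = integral\<^sup>L (lebesgue_on (domain M')) (\<lambda>x. 2 * (u\<^sub>0 x \<bullet> v x))"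
      by (simp add: Z_def vol_ip_def vol_int_def)
    also have "\<dots> \<le> integral\<^sup>L (lebesgue_on (domain M')) (\<lambda>x. (norm (u\<^sub>0 x))\<^sup>2 + (norm (v x))\<^sup>2)"
    proof (rule integral_mono)
      show "integrable (lebesgue_on (domain M')) (\<lambda>x. 2 * (u\<^sub>0 x \<bullet> v x))"
        "integrable (lebesgue_on (domain M')) (\<lambda>x. (norm (u\<^sub>0 x))\<^sup>2 + (norm (v x))\<^sup>2)"
        by (intro int continuous_intros u0 cv)+
      fix x
      have "0 \<le> (u\<^sub>0 x - v x) \<bullet> (u\<^sub>0 x - v x)" by (rule inner_ge_zero)
      then show "2 * (u\<^sub>0 x \<bullet> v x) \<le> (norm (u\<^sub>0 x))\<^sup>2 + (norm (v x))\<^sup>2"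
        by (simp add: power2_norm_eq_inner inner_diff_left inner_diff_right inner_commute)
    qed
    also have "\<dots> = A + B"
      unfolding A_def B_def vol_int_def
      by (intro Bochner_Integration.integral_add int continuous_intros u0 cv)
    finally show ?thesis .
  qed
  have "1 / (2 * \<tau>) * U + 1 / (2 * \<tau>) * B + 2 / Rey * E + \<beta>\<^sub>s * S + (Gr / We - CI / We + g * SG) = 1
      / \<tau> * Z"
    using mom[OF sp(3)] cur by simp
  then have "\<tau> * (1 / (2 * \<tau>) * U + 1 / (2 * \<tau>) * B + 2 / Rey * E + \<beta>\<^sub>s * S + (Gr / We - CI / We + g
      * SG)) = \<tau> * (1 / \<tau> * Z)"
    by simp
  moreover have "\<tau> * (1 / (2 * \<tau>) * x) = x / 2" "\<tau> * (1 / \<tau> * x) = x" for x using tau by simp_all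
  ultimately have bal: "U / 2 + B / 2 + \<tau> * (2 / Rey * E + \<beta>\<^sub>s * S) + \<tau> * Gr / We - \<tau> * CI / We + g
      * (\<tau> * SG) = Z"
    unfolding distrib_left right_diff_distrib by (simp add: mult.left_commute)
  have f1: "(surface_area (free N) - surface_area (free M)) / We \<le> \<tau> * Gr / We"
    using surface_area_change We unfolding Gr_def by (intro divide_right_mono) auto
  have f2: "\<tau> * CI / We \<le> cos \<theta>\<^sub>Y * (surface_area (solid N) - surface_area (solid M)) / We"
    unfolding CI_def C_def using contact_term[where c = "We * \<beta>\<^sub>c" and \<gamma> = "cos \<theta>\<^sub>Y"
        and d = "\<lambda>e. sin (contact_angle We \<beta>\<^sub>c \<theta>\<^sub>Y n (transported \<tau> M' w\<^sub>0 wt\<^sub>0) e)"] We \<beta>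
    by (intro divide_right_mono) auto
  have f3: "\<tau> * SG = vol_int (domain N) (\<lambda>x. x \<bullet> ez) - vol_int (domain M) (\<lambda>x. x \<bullet> ez)"
    unfolding SG_def by (rule gravity_change[symmetric])
  have "U / 2 + \<tau> * (2 / Rey * E + \<beta>\<^sub>s * S) + surface_area (free N) / We - surface_area (free M) / We
     - cos \<theta>\<^sub>Y * surface_area (solid N) / We + cos \<theta>\<^sub>Y * surface_area (solid M) / We
     + g * vol_int (domain N) (\<lambda>x. x \<bullet> ez) - g * vol_int (domain M) (\<lambda>x. x \<bullet> ez) \<le> A / 2"
    using bal f1 f2 young unfolding f3 right_diff_distrib diff_divide_distrib by linarith
  then show ?thesis
    unfolding energy_def E[symmetric] S[symmetric] U_def[symmetric] A_def[symmetric]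
        times_divide_eq_left mult_1
    by linarith
qed

end

section \<open>Decay of the energy and of the velocity\<close>

theorem theorem4p4:
  fixes Rey We \<beta>\<^sub>s \<beta>\<^sub>c g \<theta>\<^sub>Y \<tau> :: real
    and ez n\<^sub>s :: pt
    and u_init :: "pt \<Rightarrow> pt"
    and M :: "nat \<Rightarrow> mesh"
    and u w wt :: "nat \<Rightarrow> pt \<Rightarrow> pt"
    and p \<kappa> H \<phi> \<psi> :: "nat \<Rightarrow> pt \<Rightarrow> real"
  assumes "Rey > 0" and "We > 0" and "\<beta>\<^sub>s > 0" and "\<beta>\<^sub>c > 0" and "\<tau> > 0"
    and "0 \<le> \<theta>\<^sub>Y" and "\<theta>\<^sub>Y \<le> pi"
    and "norm ez = 1" and "norm n\<^sub>s = 1"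
    and valid: "\<And>m. valid_mesh (M m)"
    and regular: "\<exists>C. \<forall>m. shape_regular C (M m) \<and> quasi_uniform C (M m)"
    and flat: "\<exists>c. \<forall>m. flat_substrate n\<^sub>s c (M m)"
    and contact_line: "\<And>m. closed_contact_line (M m)"
    and initial: "P2_interpolant (tets (M 0)) u_init (u 0)" "w 0 = (\<lambda>x. 0)" "wt 0 = (\<lambda>x. 0)"
    and update: "\<And>m. M (Suc m) = moved (mesh_map \<tau> (w (Suc m))) (M m)"
    and nondegenerate: "\<And>m \<theta>. 0 \<le> \<theta> \<Longrightarrow> \<theta> \<le> 1 \<Longrightarrow>
      nondegenerate_map (M m) (mesh_map (\<theta> * \<tau>) (w (Suc m)))"
    and scheme: "\<And>m. scheme_solution Rey We \<beta>\<^sub>s \<beta>\<^sub>c g \<theta>\<^sub>Y \<tau> ez n\<^sub>s (M (m - 1)) (M m)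
      (u m) (w m) (wt m)
      (u (Suc m)) (p (Suc m)) (\<kappa> (Suc m)) (H (Suc m)) (wt (Suc m)) (\<phi> (Suc m)) (\<psi> (Suc m))"
    and bulk: "\<And>m. bulk_mesh_velocity n\<^sub>s (M m) (wt (Suc m)) (w (Suc m))"
    and energy_bounded: "\<exists>B. \<forall>m. B \<le> energy We g \<theta>\<^sub>Y ez (M (m - 1)) (M m) (u m)"
    and wetted: "\<And>m. surface_area (solid (M m)) > 0"
    and korn: "\<exists>C>0. \<forall>m. korn_inequality C (M m)"
  shows "(\<lambda>m. L2_norm_on (domain (M m)) (u (Suc m))) \<longlonglongrightarrow> 0"
proof -
  obtain k where flat_k: "\<And>m. flat_substrate n\<^sub>s k (M m)" using flat by blast
  have step: "mesh_step \<tau> k n\<^sub>s (M m) (w (Suc m)) (wt (Suc m))" for m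
  proof
    show "valid_mesh (moved (mesh_map \<tau> (w (Suc m))) (M m))" using valid[of "Suc m"] unfolding update .
    show "flat_substrate n\<^sub>s k (moved (mesh_map \<tau> (w (Suc m))) (M m))" using flat_k[of "Suc m"]
        unfolding update .
    show "nondegenerate_map (M m) (mesh_map \<tau> (w (Suc m)))" using nondegenerate[of 1 m] by simp
    show "w (Suc m) \<in> P1 (tets (M m))" "\<And>x. x \<in> carrier (free (M m)) \<Longrightarrow> w (Suc m) x = wt (Suc m) x"
      using bulk[of m] unfolding bulk_mesh_velocity_def by blast+
    show "wt (Suc m) \<in> P1 (free (M m))" using scheme[of m] unfolding scheme_solution_def by blast
  qed (use assms valid flat_k in auto)
  have uP2: "u (Suc m) \<in> P2 (tets (M m))" for m using scheme[of m] unfolding scheme_solution_def by blast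
  \<comment> \<open>For \<open>m = 0\<close> truncated subtraction makes the previous mesh equal to
    \<open>M 0\<close>, where \<open>u 0\<close> is the interpolant and the mesh map is the
    identity. All other indices refer to the preceding step.\<close>
  have cu: "continuous_on (carrier (tets (M (m - 1)))) (u m)" for m
    using initial(1) uP2[of "m - 1"] by (cases m) (auto simp: P2_interpolant_def intro: P2_continuous)
  have map: "continuous_on (carrier (tets (M (m - 1)))) (mesh_map \<tau> (w m))"
    "mesh_map \<tau> (w m) ` carrier (tets (M (m - 1))) \<subseteq> carrier (tets (M m))" for m
  proof -
    show "continuous_on (carrier (tets (M (m - 1)))) (mesh_map \<tau> (w m))"
      using mesh_step.continuous_on_X[OF step[of "m - 1"]]
      by (cases m) (simp_all add: initial(2) mesh_map_def)
    show "mesh_map \<tau> (w m) ` carrier (tets (M (m - 1))) \<subseteq> carrier (tets (M m))"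
      using mesh_step.X_carrier[OF step[of "m - 1"]]
      by (cases m) (simp_all add: initial(2) mesh_map_def update)
  qed
  define E where "E = (\<lambda>m. energy We g \<theta>\<^sub>Y ez (M (m - 1)) (M m) (u m))"
  define d where "d = (\<lambda>m. (L2_norm_on (domain (M m)) (D (u (Suc m))))\<^sup>2)"
  define s where "s = (\<lambda>m. (L2_norm_surf (solid (M m)) (u (Suc m)))\<^sup>2)"
  have nonneg: "0 \<le> d m" "0 \<le> s m" for m by (simp_all add: d_def s_def)
  have dec: "\<tau> * (2 / Rey * d m + \<beta>\<^sub>s * s m) \<le> E m - E (Suc m)" for m
    using mesh_step.energy_step[OF step[of m] \<open>We > 0\<close> less_imp_le[OF \<open>\<beta>\<^sub>c > 0\<close>] scheme[of m] cu[of
        m] valid[of "m - 1"] map[of m]]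
    by (simp add: E_def d_def s_def update[symmetric])
  obtain B where B: "\<And>m. B \<le> E m" using energy_bounded by (auto simp: E_def)
  have "decseq E"
  proof (rule decseq_SucI)
    fix m
    have "0 \<le> \<tau> * (2 / Rey * d m + \<beta>\<^sub>s * s m)" using nonneg assms(1,3,5) by simp
    then show "E (Suc m) \<le> E m" using dec[of m] by linarith
  qed
  then obtain l where l: "E \<longlonglongrightarrow> l" using decseq_convergent[of E B] B by metis
  then have "(\<lambda>m. E m - E (Suc m)) \<longlonglongrightarrow> l - l" by (intro tendsto_diff LIMSEQ_Suc)
  then have E0: "(\<lambda>m. E m - E (Suc m)) \<longlonglongrightarrow> 0" by simp
  obtain C where C: "C > 0" "\<And>m. korn_inequality C (M m)" using korn by blast
  \<comment> \<open>Both parts of the dissipation are nonnegative, so each alone is bounded by the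
    drop of the energy. Dividing by their factors \<open>2 * \<tau> / Rey\<close> and
    \<open>\<tau> * \<beta>\<^sub>s\<close> and applying Korn's inequality gives this constant,
    which does not depend on \<open>m\<close>.\<close>
  define K where "K = C * (Rey / (2 * \<tau>) + 1 / (\<tau> * \<beta>\<^sub>s))"
  have K: "(L2_norm_on (domain (M m)) (u (Suc m)))\<^sup>2 \<le> K * (E m - E (Suc m))" for m
  proof -
    have 1: "(L2_norm_on (domain (M m)) (u (Suc m)))\<^sup>2 \<le> C * (d m + s m)"
      using C(2)[of m] P2_has_trace[OF valid uP2[of m]]
      unfolding korn_inequality_def d_def s_def D_def[abs_def] by blast
    have "0 \<le> \<tau> * (2 / Rey * d m)" "0 \<le> \<tau> * (\<beta>\<^sub>s * s m)" using nonneg[of m] assms(1,3,5) by simp_all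
    then have "\<tau> * (2 / Rey * d m) \<le> E m - E (Suc m)" "\<tau> * (\<beta>\<^sub>s * s m) \<le> E m - E (Suc m)"
      using dec[of m] unfolding distrib_left by linarith+
    then have "d m \<le> Rey / (2 * \<tau>) * (E m - E (Suc m))" "s m \<le> 1 / (\<tau> * \<beta>\<^sub>s) * (E m - E (Suc m))"
      using assms(1,3,5) by (simp_all add: field_simps)
    then have "d m + s m \<le> (Rey / (2 * \<tau>) + 1 / (\<tau> * \<beta>\<^sub>s)) * (E m - E (Suc m))"
      unfolding distrib_right by linarith
    then have "C * (d m + s m) \<le> K * (E m - E (Suc m))"
      unfolding K_def mult.assoc using C(1) by (intro mult_left_mono) auto
    with 1 show ?thesis by linarith
  qed
  have "(\<lambda>m. (L2_norm_on (domain (M m)) (u (Suc m)))\<^sup>2) \<longlonglongrightarrow> 0"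
  proof (rule tendsto_sandwich[OF _ _ tendsto_const])
    show "(\<lambda>m. K * (E m - E (Suc m))) \<longlonglongrightarrow> 0" using tendsto_mult_left[OF E0, of K] by simp
  qed (use K in auto)
  then have "(\<lambda>m. sqrt ((L2_norm_on (domain (M m)) (u (Suc m)))\<^sup>2)) \<longlonglongrightarrow> sqrt 0" by (rule tendsto_real_sqrt)
  moreover have "0 \<le> L2_norm_on (domain (M m)) (u (Suc m))" for m
    by (simp add: L2_norm_on_def vol_int_def integral_nonneg)
  ultimately show ?thesis by simp
qed

end
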